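(* Let $m\ge1$, $n\ge m+1$, let $r_1,\dots,r_n$ be positive integers, $\mathbf r=(r_1,\dots,r_n)$, and suppose that $\Lambda=\frac{1}{m+1}(r_1+\cdots+r_n)$ is an integer. Then the multiplicity of the one-dimensional representation $\det^{\Lambda}$ of $U(m+1)$ in $\bigotimes_{j=1}^n\mathcal S^{r_j}(\mathbb C^{m+1})$ is equal to the multiplicity of the weight $\mathbf r$ in the irreducible representation $C^{\Lambda}\bigwedge^{m+1}\mathbb C^n$ of $U(n)$. This common multiplicity is equal to the number of lattice points in the polytope $\mathbf P$.
   Context: $\mathcal S^{k}(\mathbb C^{m+1})$ is the $k$-th symmetric power of the standard representation of $U(m+1)$. $C^{\Lambda}\bigwedge^{m+1}\mathbb C^n$, the $\Lambda$-th Cartan power of the $(m+1)$-st exterior power of the standard representation of $U(n)$, is the irreducible representation of $U(n)$ with highest weight $(\Lambda,\dots,\Lambda,0,\dots,0)$ ($m+1$ entries $\Lambda$ and $n-m-1$ zeros). $\mathbf P$ is the set of real triangular arrays $(\lambda_{ij})_{0\le i\le n-1,\,1\le j\le i+1}$ such that: (1) $\lambda_{n-1,j}=\Lambda$ for $1\le j\le m+1$ and $\lambda_{n-1,j}=0$ for $m+2\le j\le n$; (2) $\sum_{j=1}^{i+1}\lambda_{ij}=r_1+\cdots+r_{i+1}$ for every $0\le i\le n-1$; (3) $\lambda_{ij}\ge\lambda_{i-1,j}\ge\lambda_{i,j+1}$ for $1\le i\le n-1$, $1\le j\le i$. A lattice point of $\mathbf P$ is an array in $\mathbf P$ all of whose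 entries are integers. *)

theory Defs
  imports
    "Jordan_Normal_Form.Schur_Decomposition"
    "HOL-Library.Function_Algebras"
    "HOL-Combinatorics.Permutations"
    "HOL-Combinatorics.List_Permutation"
begin

section \<open>Complex function spaces\<close>

text \<open>
  All representations below live on spaces of functions from an index type to the complex
  numbers which vanish outside a finite set of indices.
\<close>

interpretation cfun: vector_space "\<lambda>(c::complex) (f :: 'i \<Rightarrow> complex) i. c * f i"
  by unfold_locales (simp_all only: fun_eq_iff plus_fun_apply distrib_left distrib_right mult.assoc mult_1_left simp_thms)

text \<open>The space of linear maps out of \<open>\<complex>\<close> into such a function space.\<close>

interpretation chom: vector_space "\<lambda>(c::complex) (\<phi> :: complex \<Rightarrow> 'i \<Rightarrow> complex) z i. c * \<phi> z i"
  by unfold_locales (simp_all only: fun_eq_iff plus_fun_apply distrib_left distrib_right mult.assoc mult_1_left simp_thms)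


section \<open>Unitary group, invariant subspaces, multiplicities, weights\<close>

definition unitary_group :: "nat \<Rightarrow> complex mat set" where
  "unitary_group d = {g \<in> carrier_mat d d. g * mat_adjoint g = 1\<^sub>m d}"

definition unitary_torus :: "nat \<Rightarrow> complex mat set" where
  "unitary_torus d = {t \<in> unitary_group d. diagonal_mat t}"

text \<open>
  A representation of a matrix group \<open>G\<close> is given by a subspace \<open>V\<close> of a function space together
  with an action \<open>\<rho>\<close> that leaves \<open>V\<close> invariant.
\<close>

definition invariant_subspace ::
  "complex mat set \<Rightarrow> (complex mat \<Rightarrow> ('i \<Rightarrow> complex) \<Rightarrow> 'i \<Rightarrow> complex) \<Rightarrow> ('i \<Rightarrow> complex) set \<Rightarrow> bool"
where
  "invariant_subspace G \<rho> V \<longleftrightarrow> cfun.subspace V \<and> (\<forall>g\<in>G. \<forall>v\<in>V. \<rho> g v \<in> V)"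

definition irreducible_rep ::
  "complex mat set \<Rightarrow> (complex mat \<Rightarrow> ('i \<Rightarrow> complex) \<Rightarrow> 'i \<Rightarrow> complex) \<Rightarrow> ('i \<Rightarrow> complex) set \<Rightarrow> bool"
where
  "irreducible_rep G \<rho> V \<longleftrightarrow> invariant_subspace G \<rho> V \<and> V \<noteq> {0} \<and>
     (\<forall>W. W \<subseteq> V \<longrightarrow> invariant_subspace G \<rho> W \<longrightarrow> W = {0} \<or> W = V)"

text \<open>
  The multiplicity in \<open>V\<close> of the one-dimensional representation of \<open>G\<close> on \<open>\<complex>\<close> given by the
  character \<open>\<chi>\<close> is the dimension of the space of intertwiners \<open>Hom\<^sub>G(\<complex>, V)\<close>.
\<close>

definition character_multiplicity ::
  "complex mat set \<Rightarrow> (complex mat \<Rightarrow> complex) \<Rightarrow>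
   (complex mat \<Rightarrow> ('i \<Rightarrow> complex) \<Rightarrow> 'i \<Rightarrow> complex) \<Rightarrow> ('i \<Rightarrow> complex) set \<Rightarrow> nat"
where
  "character_multiplicity G \<chi> \<rho> V = chom.dim
     {\<phi>. Vector_Spaces.linear (*) (\<lambda>c f i. c * f i) \<phi> \<and> range \<phi> \<subseteq> V \<and>
         (\<forall>g\<in>G. \<forall>z. \<phi> (\<chi> g * z) = \<rho> g (\<phi> z))}"

text \<open>
  Weights of \<open>U(d)\<close> are integer vectors with entries \<open>\<mu> 1, \<dots>, \<mu> d\<close>; matrix indices start at 0.
\<close>

definition weight_character :: "nat \<Rightarrow> (nat \<Rightarrow> int) \<Rightarrow> complex mat \<Rightarrow> complex" where
  "weight_character d \<mu> t = (\<Prod>i=1..d. (t $$ (i - 1, i - 1)) powi \<mu> i)"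

definition weight_space ::
  "nat \<Rightarrow> (complex mat \<Rightarrow> ('i \<Rightarrow> complex) \<Rightarrow> 'i \<Rightarrow> complex) \<Rightarrow> ('i \<Rightarrow> complex) set \<Rightarrow>
   (nat \<Rightarrow> int) \<Rightarrow> ('i \<Rightarrow> complex) set"
where
  "weight_space d \<rho> V \<mu> =
     {v \<in> V. \<forall>t\<in>unitary_torus d. \<rho> t v = (\<lambda>i. weight_character d \<mu> t * v i)}"

definition weight_multiplicity ::
  "nat \<Rightarrow> (complex mat \<Rightarrow> ('i \<Rightarrow> complex) \<Rightarrow> 'i \<Rightarrow> complex) \<Rightarrow> ('i \<Rightarrow> complex) set \<Rightarrow>
   (nat \<Rightarrow> int) \<Rightarrow> nat"
where
  "weight_multiplicity d \<rho> V \<mu> = cfun.dim (weight_space d \<rho> V \<mu>)"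

definition simple_root :: "nat \<Rightarrow> nat \<Rightarrow> int" where
  "simple_root k i = (if i = k then 1 else if i = k + 1 then - 1 else 0)"

text \<open>
  \<open>\<nu>\<close> is the highest weight of \<open>V\<close>: it is a weight, and every weight of \<open>V\<close> is obtained from it by
  subtracting a nonnegative integer combination of the simple roots.
\<close>

definition has_highest_weight ::
  "nat \<Rightarrow> (complex mat \<Rightarrow> ('i \<Rightarrow> complex) \<Rightarrow> 'i \<Rightarrow> complex) \<Rightarrow> ('i \<Rightarrow> complex) set \<Rightarrow>
   (nat \<Rightarrow> int) \<Rightarrow> bool"
where
  "has_highest_weight d \<rho> V \<nu> \<longleftrightarrow> weight_space d \<rho> V \<nu> \<noteq> {0} \<and>
     (\<forall>\<mu>. weight_space d \<rho> V \<mu> \<noteq> {0} \<longrightarrow>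
        (\<exists>c :: nat \<Rightarrow> nat. \<forall>i\<in>{1..d}. \<nu> i - \<mu> i = (\<Sum>k=1..<d. int (c k) * simple_root k i)))"


section \<open>Tensor products, symmetric and exterior powers\<close>

text \<open>
  An element of the \<open>k\<close>-fold tensor power of \<open>\<complex>\<^sup>d\<close> is its array of coordinates with respect to the
  basis \<open>e\<^sub>a\<^sub>1 \<otimes> \<dots> \<otimes> e\<^sub>a\<^sub>k\<close>, a function on the multi-indices \<open>[a\<^sub>1, \<dots>, a\<^sub>k]\<close> extended by zero.
  In characteristic 0, the symmetric and the exterior power are the spaces of symmetric and of
  alternating tensors.
\<close>

definition multi_index :: "nat \<Rightarrow> nat \<Rightarrow> nat list set" where
  "multi_index d k = listset (replicate k {..<d})"

definition sym_power :: "nat \<Rightarrow> nat \<Rightarrow> (nat list \<Rightarrow> complex) set" where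
  "sym_power d k = {T. (\<forall>I. I \<notin> multi_index d k \<longrightarrow> T I = 0) \<and>
     (\<forall>I\<in>multi_index d k. \<forall>p. p permutes {..<k} \<longrightarrow> T (permute_list p I) = T I)}"

definition ext_power :: "nat \<Rightarrow> nat \<Rightarrow> (nat list \<Rightarrow> complex) set" where
  "ext_power d k = {T. (\<forall>I. I \<notin> multi_index d k \<longrightarrow> T I = 0) \<and>
     (\<forall>I\<in>multi_index d k. \<forall>p. p permutes {..<k} \<longrightarrow> T (permute_list p I) = of_int (sign p) * T I)}"

definition pure_tensor :: "('i \<Rightarrow> complex) list \<Rightarrow> 'i list \<Rightarrow> complex" where
  "pure_tensor fs I = (if length I = length fs then \<Prod>p<length fs. (fs ! p) (I ! p) else 0)"

definition tensor_product :: "('i \<Rightarrow> complex) set list \<Rightarrow> ('i list \<Rightarrow> complex) set" where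
  "tensor_product Vs = cfun.span (pure_tensor ` listset Vs)"

text \<open>
  \<open>matrix_act X a\<close> is the linear map with matrix coefficients \<open>a i j\<close> for \<open>i, j \<in> X\<close>, and
  \<open>tensor_coeff a\<close> gives the coefficients of a tensor power (Kronecker power) of the matrix \<open>a\<close>.
\<close>

definition matrix_act :: "'i set \<Rightarrow> ('i \<Rightarrow> 'i \<Rightarrow> complex) \<Rightarrow> ('i \<Rightarrow> complex) \<Rightarrow> 'i \<Rightarrow> complex" where
  "matrix_act X a v = (\<lambda>i. if i \<in> X then \<Sum>j\<in>X. a i j * v j else 0)"

definition tensor_coeff :: "('i \<Rightarrow> 'i \<Rightarrow> complex) \<Rightarrow> 'i list \<Rightarrow> 'i list \<Rightarrow> complex" where
  "tensor_coeff a I J = (\<Prod>p<length I. a (I ! p) (J ! p))"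

text \<open>
  The action of \<open>d \<times> d\<close> matrices on \<open>(\<complex>\<^sup>d)\<^bsup>\<otimes>k\<^sub>1\<^esup> \<otimes> \<dots> \<otimes> (\<complex>\<^sup>d)\<^bsup>\<otimes>k\<^sub>s\<^esup>\<close>, where \<open>ks = [k\<^sub>1, \<dots>, k\<^sub>s]\<close>; it is
  restricted below to tensor products of symmetric or exterior powers.
\<close>

definition tensor_act ::
  "nat \<Rightarrow> nat list \<Rightarrow> complex mat \<Rightarrow> (nat list list \<Rightarrow> complex) \<Rightarrow> nat list list \<Rightarrow> complex"
where
  "tensor_act d ks g = matrix_act (listset (map (multi_index d) ks))
     (tensor_coeff (tensor_coeff (\<lambda>i j. g $$ (i, j))))"

text \<open>
  The \<open>L\<close>-th Cartan power of the \<open>k\<close>-th exterior power of \<open>\<complex>\<^sup>d\<close>, realised inside the \<open>L\<close>-th tensor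
  power of the exterior power, where the weight \<open>(L, \<dots>, L, 0, \<dots>, 0)\<close> occurs with multiplicity one.
\<close>

definition cartan_power_ext :: "nat \<Rightarrow> nat \<Rightarrow> nat \<Rightarrow> (nat list list \<Rightarrow> complex) set" where
  "cartan_power_ext d k L = (THE V.
     V \<subseteq> tensor_product (replicate L (ext_power d k)) \<and>
     irreducible_rep (unitary_group d) (tensor_act d (replicate L k)) V \<and>
     has_highest_weight d (tensor_act d (replicate L k)) V (\<lambda>i. if i \<le> k then int L else 0))"


section \<open>The polytope\<close>

text \<open>Arrays are functions that vanish outside the triangle of admissible index pairs.\<close>

definition gt_polytope :: "nat \<Rightarrow> nat \<Rightarrow> (nat \<Rightarrow> nat) \<Rightarrow> nat \<Rightarrow> (nat \<Rightarrow> nat \<Rightarrow> real) set" where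
  "gt_polytope m n r L = {x.
     (\<forall>i j. \<not> (i \<le> n - 1 \<and> 1 \<le> j \<and> j \<le> i + 1) \<longrightarrow> x i j = 0) \<and>
     (\<forall>j\<in>{1..m+1}. x (n - 1) j = real L) \<and>
     (\<forall>j\<in>{m+2..n}. x (n - 1) j = 0) \<and>
     (\<forall>i\<in>{0..n-1}. (\<Sum>j=1..i+1. x i j) = real (\<Sum>j=1..i+1. r j)) \<and>
     (\<forall>i\<in>{1..n-1}. \<forall>j\<in>{1..i}. x i j \<ge> x (i - 1) j \<and> x (i - 1) j \<ge> x i (j + 1))}"

definition lattice_points :: "(nat \<Rightarrow> nat \<Rightarrow> real) set \<Rightarrow> (nat \<Rightarrow> nat \<Rightarrow> real) set" where
  "lattice_points P = {x \<in> P. \<forall>i j. x i j \<in> \<int>}"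

end

(* Both multiplicities are computed from products of L maximal minors of an n x (m+1) matrix whose rows
   are multiplied r_1, ..., r_n times. The tensors on which U(m+1) acts by det^L are, by polarization,
   polynomials that transform by det^L; every product of minors with content r is one of them. On the
   other side, C^L of the exterior power is the span of the U(n)-orbit of the L-th tensor power of
   e_1 wedge ... wedge e_(m+1), so its weight-r coordinates are again the products of minors with content r.

   Products of minors belonging to semistandard tableaux are independent, because after the substitution
   x_(a,q) = t^(B^(a(m+1)+q)) their degrees are pairwise distinct. Conversely, an invariant is determined by
   its coordinates at standard words: at a coordinate of maximal weight in its support, the relations coming
   from the raising operators of sl_2 for two adjacent letters force the standardness inequalities. Hence
   the standard products are a basis of the invariants, and the resulting straightening law bounds
   the weight space by the same number. The standard exponent matrices are the differences of the rows of
   the lattice points of P. Identities for U(d) pass to all matrices by Zariski density. *)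

theory Submission
  imports Defs
begin

section \<open>Sums over subsets of a fixed size\<close>

text \<open>Each multiplicity is trapped between an independent family (lower bound) and an
  injective evaluation at equally many coordinates (upper bound), both indexed by
  \<open>standard_matrices\<close>. The obstacle is injectivity on the invariants. Where
  standardness fails, the raising relations tie the offending tensor factor to the earlier ones and
  become a ladder of functions on subsets. The violated inequality is exactly what makes a chain of
  Hermitian pairings end in 0, and following the chain back gives a vanishing sum of squares.
  Straightening is then a consequence of a dimension count, without exchange relations between
  minors. On the Cartan side the translates of the highest weight vector are not weight vectors;
  these are extracted as coefficients of a polynomial curve of translates, with a base
  \<open>B\<close> so large that one exponent records a whole matrix of multiplicities. Singular
  matrices (points of the curve, coordinate projections) must be allowed to act, so density is
  stated for homogeneous functions, where the denominator of the Cayley transform can be scaled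
  away.\<close>

lemma sum_subset_exchange:
  fixes F :: "'a set \<Rightarrow> 'a \<Rightarrow> 'b::comm_monoid_add"
  assumes "finite P"
  shows "(\<Sum>R\<in>{R. R \<subseteq> P \<and> card R = j}. \<Sum>x\<in>P - R. F (insert x R) x)
       = (\<Sum>R\<in>{R. R \<subseteq> P \<and> card R = Suc j}. \<Sum>x\<in>R. F R x)"
proof -
  have fin: "finite {R. R \<subseteq> P \<and> card R = i}" for i
    using assms by simp
  have finR: "finite R" if "R \<subseteq> P" for R
    using that assms finite_subset by blast
  have "(\<Sum>R\<in>{R. R \<subseteq> P \<and> card R = j}. \<Sum>x\<in>P - R. F (insert x R) x)
     = (\<Sum>(R,x)\<in>(SIGMA R:{R. R \<subseteq> P \<and> card R = j}. P - R). F (insert x R) x)"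
    using assms by (intro sum.Sigma fin) auto
  \<comment> \<open>Both sides run over flags: a \<open>j\<close>-set with a point outside is a
    \<open>Suc j\<close>-set with a marked point.\<close>
  also have "\<dots> = (\<Sum>(R,x)\<in>(SIGMA R:{R. R \<subseteq> P \<and> card R = Suc j}. R). F R x)"
    by (rule sum.reindex_bij_witness[where i = "\<lambda>(R,x). (R - {x}, x)"
          and j = "\<lambda>(R,x). (insert x R, x)"])
       (auto simp: insert_absorb finR card_insert_disjoint)
  also have "\<dots> = (\<Sum>R\<in>{R. R \<subseteq> P \<and> card R = Suc j}. \<Sum>x\<in>R. F R x)"
    using finR by (intro sum.Sigma[symmetric] fin) auto
  finally show ?thesis .
qed

text \<open>The hypothesis makes \<open>h\<close> harmonic: the sum over all one-point enlargements
  of any set vanishes. Enlarging \<open>Q\<close> by one point in every way meets each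
  \<open>S\<close> exactly \<open>q - card Q\<close> times, so the claim for \<open>Q\<close>
  follows from the claims for larger sets by a division in characteristic 0.\<close>

lemma subset_sum_superset_zero:
  fixes h :: "'a set \<Rightarrow> 'b::field_char_0"
  assumes fin: "finite P"
    and zero: "\<And>S. S \<subseteq> P \<Longrightarrow> (\<Sum>x\<in>P - S. h (insert x S)) = 0"
    and "Q \<subseteq> P" "card Q < q"
  shows "(\<Sum>S | S \<subseteq> P \<and> card S = q \<and> Q \<subseteq> S. h S) = 0"
  using assms(3,4)
proof (induction "q - card Q" arbitrary: Q rule: less_induct)
  case less
  have finQ: "finite Q" using less.prems fin finite_subset by blast
  have finS: "finite {S. S \<subseteq> P \<and> card S = q \<and> Q \<subseteq> S}"
    using fin by (rule_tac finite_subset[of _ "Pow P"]) auto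
  show ?case
  proof (cases "Suc (card Q) = q")
    case True
    have "(\<Sum>S | S \<subseteq> P \<and> card S = q \<and> Q \<subseteq> S. h S) = (\<Sum>x\<in>P - Q. h (insert x Q))"
    proof (rule sum.reindex_bij_betw[symmetric, where h = "\<lambda>x. insert x Q"], unfold bij_betw_def, intro conjI)
      show "inj_on (\<lambda>x. insert x Q) (P - Q)" by (auto simp: inj_on_def)
      show "(\<lambda>x. insert x Q) ` (P - Q) = {S. S \<subseteq> P \<and> card S = q \<and> Q \<subseteq> S}"
      proof (intro equalityI subsetI)
        fix S assume S: "S \<in> {S. S \<subseteq> P \<and> card S = q \<and> Q \<subseteq> S}"
        then have "card (S - Q) = 1" using True finQ card_Diff_subset[of Q S] by auto
        then obtain x where "S - Q = {x}" by (auto simp: card_1_singleton_iff)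
        then have "S = insert x Q" "x \<in> P - Q" using S by auto
        then show "S \<in> (\<lambda>x. insert x Q) ` (P - Q)" by blast
      qed (use True finQ less.prems in auto)
    qed
    then show ?thesis using zero less.prems by simp
  next
    case False
    have "(\<Sum>x\<in>P - Q. \<Sum>S | S \<subseteq> P \<and> card S = q \<and> insert x Q \<subseteq> S. h S) = 0"
      using less False finQ by (intro sum.neutral ballI less.hyps) auto
    also have "(\<Sum>x\<in>P - Q. \<Sum>S | S \<subseteq> P \<and> card S = q \<and> insert x Q \<subseteq> S. h S)
       = (\<Sum>x\<in>P - Q. \<Sum>S | S \<subseteq> P \<and> card S = q \<and> Q \<subseteq> S. if x \<in> S then h S else 0)"
      by (intro sum.cong refl sum.mono_neutral_cong_left finS) auto
    also have "\<dots> = (\<Sum>S | S \<subseteq> P \<and> card S = q \<and> Q \<subseteq> S. \<Sum>x\<in>P - Q. if x \<in> S then h S else 0)"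
      by (rule sum.swap)
    also have "\<dots> = (\<Sum>S | S \<subseteq> P \<and> card S = q \<and> Q \<subseteq> S. of_nat (q - card Q) * h S)"
    proof (intro sum.cong refl)
      fix S assume S: "S \<in> {S. S \<subseteq> P \<and> card S = q \<and> Q \<subseteq> S}"
      have "(\<Sum>x\<in>P - Q. if x \<in> S then h S else 0) = (\<Sum>x\<in>S - Q. h S)"
        using S fin by (intro sum.mono_neutral_cong_right) auto
      then show "(\<Sum>x\<in>P - Q. if x \<in> S then h S else 0) = of_nat (q - card Q) * h S"
        using S finQ by (simp add: card_Diff_subset)
    qed
    finally have "of_nat (q - card Q) * (\<Sum>S | S \<subseteq> P \<and> card S = q \<and> Q \<subseteq> S. h S) = 0"
      by (simp add: sum_distrib_left)
    then show ?thesis using less.prems by simp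
  qed
qed

text \<open>Inclusion-exclusion, one forbidden point at a time: avoiding \<open>z\<close> is
  everything minus requiring \<open>z\<close>. Turning a forbidden point into a required one leaves
  \<open>card Q + card Z\<close> unchanged, which is why the bound is on the sum.\<close>

lemma subset_sum_avoiding_zero:
  fixes h :: "'a set \<Rightarrow> 'b::field_char_0"
  assumes fin: "finite P"
    and zero: "\<And>S. S \<subseteq> P \<Longrightarrow> (\<Sum>x\<in>P - S. h (insert x S)) = 0"
    and "Z \<subseteq> P" "Q \<subseteq> P" "Q \<inter> Z = {}" "card Q + card Z < q"
  shows "(\<Sum>S | S \<subseteq> P \<and> card S = q \<and> Q \<subseteq> S \<and> S \<inter> Z = {}. h S) = 0"
proof -
  have "finite Z" using assms finite_subset by blast
  then show ?thesis using assms(3-)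
  proof (induction Z arbitrary: Q rule: finite_induct)
    case empty
    then show ?case using subset_sum_superset_zero[OF fin zero] by simp
  next
    case (insert z Z)
    have finQ: "finite Q" using insert.prems fin finite_subset by blast
    have fs: "finite {S. S \<subseteq> P \<and> card S = q \<and> Q \<subseteq> S \<and> S \<inter> Z = {}}"
      using fin by (rule_tac finite_subset[of _ "Pow P"]) auto
    have "(\<Sum>S | S \<subseteq> P \<and> card S = q \<and> Q \<subseteq> S \<and> S \<inter> Z = {}. h S)
       = (\<Sum>S | S \<subseteq> P \<and> card S = q \<and> Q \<subseteq> S \<and> S \<inter> insert z Z = {}. h S)
       + (\<Sum>S | S \<subseteq> P \<and> card S = q \<and> insert z Q \<subseteq> S \<and> S \<inter> Z = {}. h S)"
      by (subst sum.union_disjoint[symmetric])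
         (use fs in \<open>auto intro!: sum.cong elim!: finite_subset[rotated]\<close>)
    moreover have "(\<Sum>S | S \<subseteq> P \<and> card S = q \<and> Q \<subseteq> S \<and> S \<inter> Z = {}. h S) = 0"
      using insert by (intro insert.IH) auto
    moreover have "(\<Sum>S | S \<subseteq> P \<and> card S = q \<and> insert z Q \<subseteq> S \<and> S \<inter> Z = {}. h S) = 0"
      using insert finQ by (intro insert.IH) auto
    ultimately show ?case by simp
  qed
qed

text \<open>An \<open>sl_2\<close> argument carried out by positivity. Summing over one-point
  enlargements takes \<open>h j\<close> to a nonzero multiple of \<open>h (Suc j)\<close> and kills
  \<open>h b\<close>. The pairings \<open>G j\<close> of \<open>h (b - j)\<close> with the sums
  \<open>D\<close> are consecutively proportional; \<open>big\<close> forces \<open>G b = 0\<close>,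
  hence \<open>G 0 = 0\<close>, and \<open>G 0\<close> is the sum of the squared moduli of
  \<open>h b\<close> over the \<open>q\<close>-sets.\<close>

lemma subset_ladder_zero:
  fixes h :: "nat \<Rightarrow> 'a set \<Rightarrow> complex"
  assumes fin: "finite P"
    and step: "\<And>j S. j < b \<Longrightarrow> S \<subseteq> P \<Longrightarrow> (\<Sum>x\<in>P - S. h j (insert x S)) = - c j * h (Suc j) S"
    and c: "\<And>j. j < b \<Longrightarrow> c j \<noteq> 0"
    and top: "\<And>S. S \<subseteq> P \<Longrightarrow> (\<Sum>x\<in>P - S. h b (insert x S)) = 0"
    and big: "card P < 2 * q + b"
    and S: "S \<subseteq> P" "card S = q"
  shows "h b S = 0"
proof -
  define K where "K j = {R. R \<subseteq> P \<and> card R = j}" for j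
  have finK: "finite (K j)" for j using fin by (simp add: K_def)
  have finR: "finite R" if "R \<subseteq> P" for R using that fin finite_subset by blast
  \<comment> \<open>Up to a factorial, the iterated adjoint of the enlargement operator applied to
    \<open>h b\<close> on \<open>q\<close>-sets; on a \<open>q\<close>-set it returns
    \<open>h b\<close> itself.\<close>
  define D where "D R = (\<Sum>S | S \<subseteq> P \<and> card S = q \<and> S \<subseteq> R. h b S)" for R
  \<comment> \<open>Lying in \<open>R\<close> means avoiding \<open>P - R\<close>, and harmonicity
    of \<open>h b\<close> kills the sum as soon as fewer than \<open>q\<close> points are
    forbidden.\<close>
  have D0: "D R = 0" if "R \<subseteq> P" "card P < card R + q" for R
  proof -
    have "{S. S \<subseteq> P \<and> card S = q \<and> S \<subseteq> R} = {S. S \<subseteq> P \<and> card S = q \<and> {} \<subseteq> S \<and> S \<inter> (P - R) = {}}"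
      using that by auto
    moreover have "card (P - R) < q" using that finR[of R] card_mono[OF fin, of R] by (simp add: card_Diff_subset)
    ultimately show ?thesis unfolding D_def
      using subset_sum_avoiding_zero[OF fin top, of "P - R" "{}" q] by simp
  qed
  have Dstep: "(\<Sum>x\<in>R. cnj (D (R - {x}))) = of_nat (Suc j) * cnj (D R)"
    if R: "R \<in> K (q + Suc j)" for R j
  proof -
    have fR: "finite R" and RP: "R \<subseteq> P" using R finR by (auto simp: K_def)
    have fs: "finite {S. S \<subseteq> P \<and> card S = q \<and> S \<subseteq> R}"
      using fin by (rule_tac finite_subset[of _ "Pow P"]) auto
    have "(\<Sum>x\<in>R. D (R - {x})) = (\<Sum>x\<in>R. \<Sum>S | S \<subseteq> P \<and> card S = q \<and> S \<subseteq> R. if x \<notin> S then h b S else 0)"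
      unfolding D_def by (intro sum.cong refl sum.mono_neutral_cong_left fs) auto
    also have "\<dots> = (\<Sum>S | S \<subseteq> P \<and> card S = q \<and> S \<subseteq> R. \<Sum>x\<in>R. if x \<notin> S then h b S else 0)"
      by (rule sum.swap)
    also have "\<dots> = (\<Sum>S | S \<subseteq> P \<and> card S = q \<and> S \<subseteq> R. of_nat (Suc j) * h b S)"
    proof (intro sum.cong refl)
      fix S assume S: "S \<in> {S. S \<subseteq> P \<and> card S = q \<and> S \<subseteq> R}"
      have "(\<Sum>x\<in>R. if x \<notin> S then h b S else 0) = (\<Sum>x\<in>R - S. h b S)"
        using fR by (intro sum.mono_neutral_cong_right) auto
      also have "\<dots> = of_nat (card (R - S)) * h b S" by simp
      also have "card (R - S) = Suc j"
        using S R fR finite_subset[of S R] by (subst card_Diff_subset) (auto simp: K_def)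
      finally show "(\<Sum>x\<in>R. if x \<notin> S then h b S else 0) = of_nat (Suc j) * h b S" .
    qed
    finally have "(\<Sum>x\<in>R. D (R - {x})) = of_nat (Suc j) * D R"
      by (simp add: sum_distrib_left D_def)
    then have "cnj (\<Sum>x\<in>R. D (R - {x})) = cnj (of_nat (Suc j) * D R)" by simp
    then show ?thesis by (simp del: of_nat_Suc)
  qed
  define G where "G j = (\<Sum>R\<in>K (q + j). h (b - j) R * cnj (D R))" for j
  have Gstep: "- c (b - Suc j) * G j = of_nat (Suc j) * G (Suc j)" if "j < b" for j
  proof -
    have bj: "b - j = Suc (b - Suc j)" using that by simp
    have "- c (b - Suc j) * G j
        = (\<Sum>R\<in>K (q + j). \<Sum>x\<in>P - R. h (b - Suc j) (insert x R) * cnj (D (insert x R - {x})))"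
      unfolding G_def sum_distrib_left
    proof (intro sum.cong refl)
      fix R assume R: "R \<in> K (q + j)"
      have "(\<Sum>x\<in>P - R. h (b - Suc j) (insert x R) * cnj (D (insert x R - {x})))
          = (\<Sum>x\<in>P - R. h (b - Suc j) (insert x R)) * cnj (D R)"
        unfolding sum_distrib_right by (intro sum.cong refl) auto
      also have "\<dots> = - c (b - Suc j) * (h (b - j) R * cnj (D R))"
        using step[of "b - Suc j" R] R that by (simp add: K_def bj)
      finally show "- c (b - Suc j) * (h (b - j) R * cnj (D R))
          = (\<Sum>x\<in>P - R. h (b - Suc j) (insert x R) * cnj (D (insert x R - {x})))" ..
    qed
    also have "\<dots> = (\<Sum>R\<in>K (Suc (q + j)). \<Sum>x\<in>R. h (b - Suc j) R * cnj (D (R - {x})))"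
      unfolding K_def
      by (rule sum_subset_exchange[OF fin, where F = "\<lambda>R x. h (b - Suc j) R * cnj (D (R - {x}))"])
    also have "\<dots> = of_nat (Suc j) * G (Suc j)"
      unfolding G_def sum_distrib_left
      by (intro sum.cong) (simp_all add: sum_distrib_left[symmetric] Dstep del: of_nat_Suc)
    finally show ?thesis .
  qed
  have "G b = 0"
    unfolding G_def using big by (intro sum.neutral) (auto simp: K_def D0)
  \<comment> \<open>Back down the chain: the factors \<open>c\<close> are nonzero, so each
    \<open>Gstep\<close> can be divided out.\<close>
  have "G (b - i) = 0" if "i \<le> b" for i
    using that
  proof (induction i)
    case (Suc i)
    then have "Suc (b - Suc i) = b - i" by simp
    then have "- c (b - Suc (b - Suc i)) * G (b - Suc i) = 0"
      using Gstep[of "b - Suc i"] Suc by simp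
    moreover have "c (b - Suc (b - Suc i)) \<noteq> 0" using Suc.prems c by simp
    ultimately show ?case by simp
  qed (use \<open>G b = 0\<close> in simp)
  from this[of b] have "0 = (\<Sum>R\<in>K q. h b R * cnj (D R))" by (simp add: G_def)
  also have "\<dots> = (\<Sum>R\<in>K q. of_real ((cmod (h b R))\<^sup>2))"
  proof (intro sum.cong refl)
    fix R assume R: "R \<in> K q"
    then have "{S. S \<subseteq> P \<and> card S = q \<and> S \<subseteq> R} = {R}"
      using card_subset_eq[OF finR, of R] by (auto simp: K_def)
    then show "h b R * cnj (D R) = of_real ((cmod (h b R))\<^sup>2)"
      unfolding D_def by (simp add: complex_norm_square del: of_real_power)
  qed
  finally have "complex_of_real (\<Sum>R\<in>K q. (cmod (h b R))\<^sup>2) = 0"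
    by (simp del: of_real_power)
  then have "(\<Sum>R\<in>K q. (cmod (h b R))\<^sup>2) = 0"
    by (simp only: of_real_eq_0_iff)
  then have "(cmod (h b S))\<^sup>2 = 0"
    using S by (subst (asm) sum_nonneg_eq_0_iff) (auto simp: finK, auto simp: K_def)
  then show ?thesis by simp
qed

section \<open>Dimensions and subspaces of function spaces\<close>

lemma sum_apply: "(\<Sum>x\<in>A. f x) i = (\<Sum>x\<in>A. f x i)"
  for f :: "'a \<Rightarrow> 'b \<Rightarrow> 'c::comm_monoid_add"
  by (induction A rule: infinite_finite_induct) auto

text \<open>The injection into a span of at most \<open>card Z\<close> vectors bounds the dimension
  above, the independent family bounds it below; a vector outside the span of the family would give
  an independent set that is too large. Independence is that of an indexed family, so it also yields
  injectivity of \<open>b\<close>.\<close>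

lemma (in vector_space_pair) dim_eq_card_via_injection:
  assumes f: "Vector_Spaces.linear s1 s2 f" and S: "vs1.subspace S"
    and inj: "\<And>v. v \<in> S \<Longrightarrow> f v = 0 \<Longrightarrow> v = 0"
    and img: "\<And>v. v \<in> S \<Longrightarrow> f v \<in> vs2.span t" and t: "finite t" "card t \<le> card Z"
    and Z: "finite Z" and b: "\<And>z. z \<in> Z \<Longrightarrow> b z \<in> S"
    and ind: "\<And>c. (\<Sum>z\<in>Z. s1 (c z) (b z)) = 0 \<Longrightarrow> \<forall>z\<in>Z. c z = 0"
  shows "vs1.dim S = card Z" and "S \<subseteq> vs1.span (b ` Z)"
proof -
  interpret f: Vector_Spaces.linear s1 s2 f by (rule f)
  have inj_b: "inj_on b Z"
  proof (rule inj_onI, rule ccontr)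
    fix x y assume xy: "x \<in> Z" "y \<in> Z" "b x = b y" "x \<noteq> y"
    define c where "c z = (if z = x then 1 else if z = y then - 1 else (0::'a))" for z
    have "(\<Sum>z\<in>Z. s1 (c z) (b z)) = (\<Sum>z\<in>{x, y}. s1 (c z) (b z))"
      using xy Z by (intro sum.mono_neutral_right) (auto simp: c_def)
    also have "\<dots> = 0" using xy by (simp add: c_def)
    finally have "c x = 0" using ind xy by blast
    then show False by (simp add: c_def)
  qed
  have indep: "vs1.independent (b ` Z)"
  proof (rule vs1.independent_if_scalars_zero)
    fix g x assume g: "(\<Sum>x\<in>b ` Z. s1 (g x) x) = 0" and x: "x \<in> b ` Z"
    have "(\<Sum>z\<in>Z. s1 (g (b z)) (b z)) = 0"
      using g by (subst (asm) sum.reindex[OF inj_b]) simp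
    then show "g x = 0" using ind[of "\<lambda>z. g (b z)"] x by auto
  qed (use Z in simp)
  show span: "S \<subseteq> vs1.span (b ` Z)"
  proof (rule subsetI, rule ccontr)
    fix v assume v: "v \<in> S" "v \<notin> vs1.span (b ` Z)"
    let ?B = "insert v (b ` Z)"
    have iB: "vs1.independent ?B" using v indep by (simp add: vs1.independent_insert)
    have BS: "vs1.span ?B \<subseteq> S" using v b S by (intro vs1.span_minimal) auto
    have "inj_on f (vs1.span ?B)"
    proof (rule inj_onI)
      fix x y assume "x \<in> vs1.span ?B" "y \<in> vs1.span ?B" "f x = f y"
      then show "x = y"
        using inj[of "x - y"] vs1.subspace_diff[OF S, of x y] BS by (auto simp: f.diff)
    qed
    then have "vs2.independent (f ` ?B)"
      using linear_independent_injective_image[OF f iB] by simp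
    moreover have "f ` ?B \<subseteq> vs2.span t" using img v b by auto
    ultimately have "card (f ` ?B) \<le> card t" using vs2.independent_span_bound t by blast
    moreover have "card (f ` ?B) = card ?B"
      using \<open>inj_on f (vs1.span ?B)\<close> vs1.span_superset by (intro card_image) (rule inj_on_subset)
    moreover have "card ?B = Suc (card Z)"
      using v vs1.span_base[of _ "b ` Z"] Z by (subst card_insert_disjoint) (auto simp: card_image[OF inj_b])
    ultimately show False using t by simp
  qed
  have "card (b ` Z) = vs1.dim S" using b indep span by (intro vs1.basis_card_eq_dim) auto
  then show "vs1.dim S = card Z" by (simp add: card_image[OF inj_b])
qed

lemma finite_support_in_span:
  fixes u :: "'i \<Rightarrow> complex"
  assumes "finite F" "\<And>i. i \<notin> F \<Longrightarrow> u i = 0"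
  shows "u \<in> cfun.span ((\<lambda>z i. if i = z then 1 else 0) ` F)"
proof -
  have "u = (\<Sum>z\<in>F. (\<lambda>i. u z * (if i = z then 1 else 0)))"
    using assms by (auto simp: fun_eq_iff sum_apply if_distrib cong: if_cong)
  also have "\<dots> \<in> cfun.span ((\<lambda>z i. if i = z then 1 else 0) ` F)"
    by (intro cfun.span_sum cfun.span_scale cfun.span_base) auto
  finally show ?thesis .
qed

text \<open>The injection is evaluation at the points \<open>pt z\<close>. The second conclusion, an
  expansion with explicit coefficients, is the source of the straightening law.\<close>

lemma cfun_dim_eq_card:
  fixes S :: "('i \<Rightarrow> complex) set"
  assumes S: "cfun.subspace S" and Z: "finite Z"
    and inj: "\<And>v. v \<in> S \<Longrightarrow> (\<And>z. z \<in> Z \<Longrightarrow> v (pt z) = 0) \<Longrightarrow> v = 0"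
    and b: "\<And>z. z \<in> Z \<Longrightarrow> b z \<in> S"
    and ind: "\<And>c. (\<And>i. (\<Sum>z\<in>Z. c z * b z i) = 0) \<Longrightarrow> \<forall>z\<in>Z. c z = 0"
  shows "cfun.dim S = card Z" and "v \<in> S \<Longrightarrow> \<exists>c. \<forall>i. v i = (\<Sum>z\<in>Z. c z * b z i)"
proof -
  interpret vector_space_pair "\<lambda>(c::complex) (f :: 'i \<Rightarrow> complex) i. c * f i"
    "\<lambda>(c::complex) (f :: 'z \<Rightarrow> complex) i. c * f i" ..
  let ?f = "\<lambda>v z. if z \<in> Z then v (pt z) else (0::complex)"
  let ?t = "(\<lambda>z i. if i = z then 1 else 0) ` Z"
  have lin: "Vector_Spaces.linear (\<lambda>c f i. c * f i) (\<lambda>c f i. c * f i) ?f"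
    by unfold_locales (auto simp: fun_eq_iff)
  have inj': "v = 0" if "v \<in> S" "?f v = 0" for v
    using inj[OF that(1)] that(2) by (auto simp: fun_eq_iff split: if_splits)
  have ind': "\<forall>z\<in>Z. c z = 0" if "(\<Sum>z\<in>Z. (\<lambda>i. c z * b z i)) = 0" for c
  proof (rule ind)
    fix i
    have "(\<Sum>z\<in>Z. (\<lambda>i. c z * b z i)) i = 0" using that by simp
    then show "(\<Sum>z\<in>Z. c z * b z i) = 0" by (simp add: sum_apply)
  qed
  have img: "?f v \<in> cfun.span ?t" for v using Z by (intro finite_support_in_span) auto
  have t: "finite ?t" "card ?t \<le> card Z" using Z by (auto intro: card_image_le)
  note * = dim_eq_card_via_injection[where b = b, OF lin S inj' img t Z b ind']
  show "cfun.dim S = card Z" by (rule *(1))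
  have span: "S \<subseteq> cfun.span (b ` Z)" by (rule *(2))
  have "cfun.subspace {v. \<exists>c. \<forall>i. v i = (\<Sum>z\<in>Z. c z * b z i)}"
    unfolding cfun.subspace_def
  proof (intro conjI ballI allI CollectI)
    show "\<exists>c. \<forall>i. (0 :: 'i \<Rightarrow> complex) i = (\<Sum>z\<in>Z. c z * b z i)" by (rule exI[of _ "\<lambda>_. 0"]) simp
  next
    fix u v assume "u \<in> {v. \<exists>c. \<forall>i. v i = (\<Sum>z\<in>Z. c z * b z i)}" "v \<in> {v. \<exists>c. \<forall>i. v i = (\<Sum>z\<in>Z. c z * b z i)}"
    then obtain c d where "\<And>i. u i = (\<Sum>z\<in>Z. c z * b z i)" "\<And>i. v i = (\<Sum>z\<in>Z. d z * b z i)" by blast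
    then show "\<exists>c. \<forall>i. (u + v) i = (\<Sum>z\<in>Z. c z * b z i)"
      by (intro exI[of _ "\<lambda>z. c z + d z"]) (simp add: distrib_right sum.distrib)
  next
    fix e v assume "v \<in> {v. \<exists>c. \<forall>i. v i = (\<Sum>z\<in>Z. c z * b z i)}"
    then obtain c where "\<And>i. v i = (\<Sum>z\<in>Z. c z * b z i)" by blast
    then show "\<exists>c. \<forall>i. e * v i = (\<Sum>z\<in>Z. c z * b z i)"
      by (intro exI[of _ "\<lambda>z. e * c z"]) (simp add: sum_distrib_left mult.assoc)
  qed
  moreover have "b ` Z \<subseteq> {v. \<exists>c. \<forall>i. v i = (\<Sum>z\<in>Z. c z * b z i)}"
  proof (intro image_subsetI CollectI)
    fix z assume "z \<in> Z"
    then show "\<exists>c. \<forall>i. b z i = (\<Sum>z\<in>Z. c z * b z i)"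
      using Z by (intro exI[of _ "\<lambda>z'. if z' = z then 1 else 0"]) (simp add: if_distrib[of "\<lambda>x. x * _"] cong: if_cong)
  qed
  ultimately have "cfun.span (b ` Z) \<subseteq> {v. \<exists>c. \<forall>i. v i = (\<Sum>z\<in>Z. c z * b z i)}"
    by (intro cfun.span_minimal)
  then show "\<exists>c. \<forall>i. v i = (\<Sum>z\<in>Z. c z * b z i)" if "v \<in> S" using that span by blast
qed

text \<open>A linear map out of the complex numbers is its value at 1, so the preceding count
  carries over to the space in which \<open>character_multiplicity\<close> is measured.\<close>

lemma chom_dim_eq_card:
  fixes S :: "('i \<Rightarrow> complex) set"
  assumes S: "cfun.subspace S" and Z: "finite Z"
    and inj: "\<And>v. v \<in> S \<Longrightarrow> (\<And>z. z \<in> Z \<Longrightarrow> v (pt z) = 0) \<Longrightarrow> v = 0"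
    and b: "\<And>z. z \<in> Z \<Longrightarrow> b z \<in> S"
    and ind: "\<And>c. (\<And>i. (\<Sum>z\<in>Z. c z * b z i) = 0) \<Longrightarrow> \<forall>z\<in>Z. c z = 0"
  shows "chom.dim {\<phi>. Vector_Spaces.linear (*) (\<lambda>c f i. c * f i) \<phi> \<and> \<phi> 1 \<in> S} = card Z"
proof -
  interpret vector_space_pair "\<lambda>(c::complex) (\<phi> :: complex \<Rightarrow> 'i \<Rightarrow> complex) z i. c * \<phi> z i"
    "\<lambda>(c::complex) (f :: 'z \<Rightarrow> complex) i. c * f i" ..
  let ?f = "\<lambda>\<phi> z. if z \<in> Z then \<phi> (1::complex) (pt z) else (0::complex)"
  let ?t = "(\<lambda>z i. if i = z then 1 else 0) ` Z"
  have lin: "Vector_Spaces.linear (*) (\<lambda>c f i. c * f i) \<phi> \<longleftrightarrow>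
     (\<forall>x y. \<phi> (x + y) = \<phi> x + \<phi> y) \<and> (\<forall>c x. \<phi> (c * x) = (\<lambda>i. c * \<phi> x i))"
    for \<phi> :: "complex \<Rightarrow> 'i \<Rightarrow> complex"
  proof
    assume "Vector_Spaces.linear (*) (\<lambda>c f i. c * f i) \<phi>"
    then interpret l: Vector_Spaces.linear "(*)" "\<lambda>c f i. c * f i" \<phi> .
    show "(\<forall>x y. \<phi> (x + y) = \<phi> x + \<phi> y) \<and> (\<forall>c x. \<phi> (c * x) = (\<lambda>i. c * \<phi> x i))"
      using l.add l.scale by blast
  next
    assume *: "(\<forall>x y. \<phi> (x + y) = \<phi> x + \<phi> y) \<and> (\<forall>c x. \<phi> (c * x) = (\<lambda>i. c * \<phi> x i))"
    show "Vector_Spaces.linear (*) (\<lambda>c f i. c * f i) \<phi>"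
      by unfold_locales (use * in \<open>auto simp: fun_eq_iff algebra_simps\<close>)
  qed
  have eval: "\<phi> x = (\<lambda>i. x * \<phi> 1 i)" if "Vector_Spaces.linear (*) (\<lambda>c f i. c * f i) \<phi>"
    for x and \<phi> :: "complex \<Rightarrow> 'i \<Rightarrow> complex"
    using that unfolding lin by (metis mult.right_neutral)
  have S': "0 \<in> S" "\<And>u v. u \<in> S \<Longrightarrow> v \<in> S \<Longrightarrow> u + v \<in> S" "\<And>c u. u \<in> S \<Longrightarrow> (\<lambda>i. c * u i) \<in> S"
    using S unfolding cfun.subspace_def by auto
  show ?thesis
  proof (rule dim_eq_card_via_injection(1)[where f = ?f and t = ?t and b = "\<lambda>z x i. x * b z i"])
    show "Vector_Spaces.linear (\<lambda>c \<phi> z i. c * \<phi> z i) (\<lambda>c f i. c * f i) ?f"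
      by unfold_locales (auto simp: fun_eq_iff)
    show "chom.subspace {\<phi>. Vector_Spaces.linear (*) (\<lambda>c f i. c * f i) \<phi> \<and> \<phi> 1 \<in> S}"
      unfolding chom.subspace_def lin mem_Collect_eq
      apply (intro conjI ballI allI impI)
      subgoal by simp
      subgoal by (simp add: fun_eq_iff)
      subgoal using S'(1) by simp
      subgoal by simp
      subgoal by (simp add: fun_eq_iff distrib_left)
      subgoal using S'(2) by simp
      subgoal by (simp add: fun_eq_iff distrib_left)
      subgoal by (simp add: fun_eq_iff)
      subgoal using S'(3) by simp
      done
    show "\<phi> = 0" if "\<phi> \<in> {\<phi>. Vector_Spaces.linear (*) (\<lambda>c f i. c * f i) \<phi> \<and> \<phi> 1 \<in> S}" "?f \<phi> = 0" for \<phi>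
    proof -
      have "\<phi> 1 = 0" using inj[of "\<phi> 1"] that by (auto simp: fun_eq_iff split: if_splits)
      show ?thesis
      proof (intro ext)
        fix x i
        have "\<phi> x i = x * \<phi> 1 i" using that(1) by (intro fun_cong[OF eval]) blast
        also have "\<phi> 1 i = 0" by (simp only: \<open>\<phi> 1 = 0\<close> zero_fun_apply)
        finally show "\<phi> x i = 0 x i" by simp
      qed
    qed
    show "\<forall>z\<in>Z. c z = 0" if "(\<Sum>z\<in>Z. (\<lambda>x i. c z * (x * b z i))) = 0" for c
    proof (rule ind)
      fix i
      have "(\<Sum>z\<in>Z. (\<lambda>x i. c z * (x * b z i))) 1 i = 0" using that by simp
      then show "(\<Sum>z\<in>Z. c z * b z i) = 0" by (simp add: sum_apply)
    qed
    show "card ?t \<le> card Z" using Z by (rule card_image_le)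
    show "?f v \<in> cfun.span ?t" for v using Z by (intro finite_support_in_span) auto
    show "(\<lambda>x i. x * b z i) \<in> {\<phi>. Vector_Spaces.linear (*) (\<lambda>c f i. c * f i) \<phi> \<and> \<phi> 1 \<in> S}" if "z \<in> Z" for z
      unfolding lin mem_Collect_eq
      apply (intro conjI allI)
      subgoal by (simp add: fun_eq_iff distrib_right)
      subgoal by (simp add: fun_eq_iff)
      subgoal using b[OF that] by simp
      done
  qed (use Z in auto)
qed

text \<open>A basis of \<open>V\<close> together with \<open>v\<close> is independent, so the values
  0 and 1 can be prescribed on it. This turns membership in a subspace into the vanishing of scalar
  functions, to which polynomial arguments apply.\<close>

lemma cfun_separating_functional:
  fixes V :: "('i \<Rightarrow> complex) set"
  assumes V: "cfun.subspace V" and v: "v \<notin> V"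
  obtains g where "Vector_Spaces.linear (\<lambda>c f i. c * f i) (*) g" "\<And>w. w \<in> V \<Longrightarrow> g w = (0::complex)" "g v = 1"
proof -
  interpret vector_space_pair "\<lambda>(c::complex) (f :: 'i \<Rightarrow> complex) i. c * f i" "(*) :: complex \<Rightarrow> _"
    by (rule vector_space_pair.intro[OF cfun.vector_space_axioms]) (unfold_locales, simp_all add: algebra_simps)
  obtain B where B: "B \<subseteq> V" "cfun.independent B" "V \<subseteq> cfun.span B"
    by (rule cfun.basis_exists[of V])
  have BV: "cfun.span B = V" using B V by (simp add: cfun.span_minimal subset_antisym)
  have "cfun.independent (insert v B)" using B BV v by (simp add: cfun.independent_insert)
  from linear_independent_extend[OF this, of "\<lambda>x. if x = v then 1 else 0"] obtain g
    where g: "Vector_Spaces.linear (\<lambda>c f i. c * f i) (*) g" "\<forall>x\<in>insert v B. g x = (if x = v then 1 else 0)"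
    by (elim exE conjE)
  interpret g: Vector_Spaces.linear "\<lambda>c f i. c * f i" "(*)" g by (rule g)
  have "g w = 0" if "w \<in> V" for w
  proof (rule g.eq_0_on_span)
    show "w \<in> cfun.span B" using that BV by simp
    show "g x = 0" if "x \<in> B" for x using g(2) that B v by auto
  qed
  then show ?thesis using that g by auto
qed

lemma cfun_linear_expand:
  assumes g: "Vector_Spaces.linear (\<lambda>c f i. c * f i) (*) g"
    and F: "finite F" "\<And>i. i \<notin> F \<Longrightarrow> u i = 0"
  shows "g u = (\<Sum>z\<in>F. u z * g (\<lambda>i. if i = z then 1 else 0) :: complex)"
proof -
  interpret g: Vector_Spaces.linear "\<lambda>c f i. c * f i" "(*)" g by (rule g)
  have "u = (\<Sum>z\<in>F. (\<lambda>i. u z * (if i = z then 1 else 0)))"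
    using F by (auto simp: fun_eq_iff sum_apply if_distrib cong: if_cong)
  then have "g u = (\<Sum>z\<in>F. g (\<lambda>i. u z * (if i = z then 1 else 0)))"
    by (metis g.sum)
  then show ?thesis by (simp only: g.scale)
qed

text \<open>A functional that kills \<open>V\<close> but not the coefficient vector would turn the
  curve into a polynomial with infinitely many zeros and a nonzero coefficient.\<close>

lemma subspace_polynomial_curve:
  fixes c :: "'i \<Rightarrow> complex poly"
  assumes V: "cfun.subspace V" and T: "infinite T"
    and mem: "\<And>t. t \<in> T \<Longrightarrow> (\<lambda>i. poly (c i) t) \<in> V"
    and F: "finite F" "\<And>i. i \<notin> F \<Longrightarrow> c i = 0"
  shows "(\<lambda>i. coeff (c i) j) \<in> V"
proof (rule ccontr)
  assume "(\<lambda>i. coeff (c i) j) \<notin> V"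
  then obtain g where g: "Vector_Spaces.linear (\<lambda>c f i. c * f i) (*) g"
    "\<And>w. w \<in> V \<Longrightarrow> g w = (0::complex)" "g (\<lambda>i. coeff (c i) j) = 1"
    using cfun_separating_functional[OF V] by blast
  define p where "p = (\<Sum>z\<in>F. smult (g (\<lambda>i. if i = z then 1 else 0)) (c z))"
  have "poly p t = g (\<lambda>i. poly (c i) t)" for t
    by (subst cfun_linear_expand[OF g(1) F(1)]) (auto simp: F p_def poly_sum mult.commute)
  then have "T \<subseteq> {t. poly p t = 0}" using g(2) mem by auto
  then have "p = 0" using T poly_roots_finite finite_subset by blast
  moreover have "coeff p j = g (\<lambda>i. coeff (c i) j)"
    by (subst cfun_linear_expand[OF g(1) F(1)]) (auto simp: F p_def coeff_sum mult.commute)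
  ultimately show False using g(3) by simp
qed

section \<open>Zariski density of the unitary group\<close>

text \<open>A predicate on functions, so that polynomiality passes through determinants and tensor
  coordinates without naming a polynomial at each stage.\<close>

definition poly_fun :: "(complex \<Rightarrow> complex) \<Rightarrow> bool" where
  "poly_fun f \<longleftrightarrow> (\<exists>p. \<forall>t. f t = poly p t)"

lemma poly_fun_const [intro, simp]: "poly_fun (\<lambda>_. c)"
  unfolding poly_fun_def by (rule exI[of _ "[:c:]"]) simp

lemma poly_fun_id [intro, simp]: "poly_fun (\<lambda>t. t)"
  unfolding poly_fun_def by (rule exI[of _ "[:0, 1:]"]) simp

lemma poly_fun_add [intro]: "poly_fun f \<Longrightarrow> poly_fun g \<Longrightarrow> poly_fun (\<lambda>t. f t + g t)"
  unfolding poly_fun_def by (metis poly_add)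

lemma poly_fun_mult [intro]: "poly_fun f \<Longrightarrow> poly_fun g \<Longrightarrow> poly_fun (\<lambda>t. f t * g t)"
  unfolding poly_fun_def by (metis poly_mult)

lemma poly_fun_diff [intro]: "poly_fun f \<Longrightarrow> poly_fun g \<Longrightarrow> poly_fun (\<lambda>t. f t - g t)"
  unfolding poly_fun_def by (metis poly_diff)

lemma poly_fun_sum [intro]: "(\<And>x. x \<in> A \<Longrightarrow> poly_fun (f x)) \<Longrightarrow> poly_fun (\<lambda>t. \<Sum>x\<in>A. f x t)"
  by (induction A rule: infinite_finite_induct) auto

lemma poly_fun_prod [intro]: "(\<And>x. x \<in> A \<Longrightarrow> poly_fun (f x)) \<Longrightarrow> poly_fun (\<lambda>t. \<Prod>x\<in>A. f x t)"
  by (induction A rule: infinite_finite_induct) auto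

lemma poly_fun_power [intro]: "poly_fun f \<Longrightarrow> poly_fun (\<lambda>t. f t ^ n)"
  by (induction n) auto

lemma poly_fun_finite_zeros: "poly_fun f \<Longrightarrow> f s \<noteq> 0 \<Longrightarrow> finite {t. f t = 0}"
  unfolding poly_fun_def by (metis (mono_tags, lifting) Collect_cong poly_0 poly_roots_finite)

lemma poly_fun_eq_0: "poly_fun f \<Longrightarrow> infinite T \<Longrightarrow> (\<And>t. t \<in> T \<Longrightarrow> f t = 0) \<Longrightarrow> f s = 0"
  using poly_fun_finite_zeros finite_subset[of T "{t. f t = 0}"] by blast

section \<open>Matrices depending polynomially on a parameter\<close>

definition poly_curve :: "nat \<Rightarrow> (complex \<Rightarrow> complex mat) \<Rightarrow> bool" where
  "poly_curve d M \<longleftrightarrow> (\<forall>t. M t \<in> carrier_mat d d) \<and> (\<forall>i<d. \<forall>j<d. poly_fun (\<lambda>t. M t $$ (i, j)))"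

lemma smult_mat_one: "(1::complex) \<cdot>\<^sub>m A = A"
  by (rule eq_matI) auto

lemma smult_smult_mat: "a \<cdot>\<^sub>m (b \<cdot>\<^sub>m A) = (a * b) \<cdot>\<^sub>m (A :: complex mat)"
  by (rule eq_matI) auto

lemma poly_curve_line:
  assumes "A \<in> carrier_mat d d" "B \<in> carrier_mat d d"
  shows "poly_curve d (\<lambda>t. A + t \<cdot>\<^sub>m B)"
  using assms by (auto simp: poly_curve_def intro!: poly_fun_add poly_fun_mult)

lemma poly_curve_mult:
  assumes "poly_curve d M" "poly_curve d N"
  shows "poly_curve d (\<lambda>t. M t * N t)"
proof -
  have c: "M t \<in> carrier_mat d d" "N t \<in> carrier_mat d d" for t
    using assms by (auto simp: poly_curve_def)
  have "(M t * N t) $$ (i, j) = (\<Sum>k = 0..<d. M t $$ (i, k) * N t $$ (k, j))" if "i < d" "j < d" for t i j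
    using that c[of t] by (auto simp: scalar_prod_def)
  then show ?thesis
    using assms c mult_carrier_mat[OF c] unfolding poly_curve_def by (auto intro!: poly_fun_sum poly_fun_mult)
qed

lemma poly_fun_det:
  assumes "poly_curve d M"
  shows "poly_fun (\<lambda>t. det (M t))"
proof -
  have c: "M t \<in> carrier_mat d d" for t using assms by (auto simp: poly_curve_def)
  show ?thesis
    unfolding det_def'[OF c]
    using assms by (intro poly_fun_sum poly_fun_mult poly_fun_prod poly_fun_const)
      (auto simp: poly_curve_def permutes_in_image[of _ "{0..<d}"])
qed

text \<open>The entries of the adjugate are signed minors, so unlike the inverse it stays
  polynomial.\<close>

lemma poly_curve_adj_mat:
  assumes "poly_curve d M"
  shows "poly_curve d (\<lambda>t. adj_mat (M t))"
proof -
  have c: "M t \<in> carrier_mat d d" for t using assms by (auto simp: poly_curve_def)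
  have "poly_curve (d - 1) (\<lambda>t. mat_delete (M t) i j)" if "i < d" "j < d" for i j
  proof -
    have "mat_delete (M t) i j $$ (k, l) =
        M t $$ (if k < i then k else Suc k, if l < j then l else Suc l)"
      if "k < d - 1" "l < d - 1" for k l t
      using that c[of t] by (auto simp: mat_delete_def)
    then show ?thesis
      using assms that mat_delete_carrier[OF c] by (auto simp: poly_curve_def)
  qed
  note del = poly_fun_det[OF this]
  have "poly_fun (\<lambda>t. cofactor (M t) i j)" if "i < d" "j < d" for i j
    unfolding cofactor_def by (intro poly_fun_mult poly_fun_const del that)
  moreover have "adj_mat (M t) $$ (i, j) = cofactor (M t) j i" if "i < d" "j < d" for i j t
    using that c[of t] by (auto simp: adj_mat_def)
  ultimately show ?thesis using adj_mat(1)[OF c] by (auto simp: poly_curve_def)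
qed

section \<open>Adjoints and the Cayley transform\<close>

lemma mat_adjoint_carrier: "A \<in> carrier_mat n m \<Longrightarrow> mat_adjoint A \<in> carrier_mat m n"
  unfolding mat_adjoint_def by auto

lemma mat_adjoint_index: "A \<in> carrier_mat n m \<Longrightarrow> i < m \<Longrightarrow> j < n \<Longrightarrow> mat_adjoint A $$ (i, j) = conjugate (A $$ (j, i))"
  unfolding mat_adjoint_def by (auto simp: mat_of_rows_def)

lemma mat_adjoint_mult:
  fixes A B :: "complex mat"
  assumes A: "A \<in> carrier_mat n m" and B: "B \<in> carrier_mat m l"
  shows "mat_adjoint (A * B) = mat_adjoint B * mat_adjoint A"
proof (rule eq_matI)
  note cs = mat_adjoint_carrier[OF A] mat_adjoint_carrier[OF B] mult_carrier_mat[OF A B]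
  show "dim_row (mat_adjoint (A * B)) = dim_row (mat_adjoint B * mat_adjoint A)"
    "dim_col (mat_adjoint (A * B)) = dim_col (mat_adjoint B * mat_adjoint A)"
    using cs mat_adjoint_carrier[OF cs(3)] by auto
  fix i j assume "i < dim_row (mat_adjoint B * mat_adjoint A)" "j < dim_col (mat_adjoint B * mat_adjoint A)"
  then have ij: "i < l" "j < n" using cs by auto
  show "mat_adjoint (A * B) $$ (i, j) = (mat_adjoint B * mat_adjoint A) $$ (i, j)"
    using ij A B cs by (simp add: mat_adjoint_index[OF cs(3)] scalar_prod_def mat_adjoint_index[OF A]
        mat_adjoint_index[OF B] mult.commute)
qed

lemma mat_adjoint_smult:
  fixes A :: "complex mat"
  assumes "A \<in> carrier_mat n m"
  shows "mat_adjoint (c \<cdot>\<^sub>m A) = cnj c \<cdot>\<^sub>m mat_adjoint A"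
proof (rule eq_matI)
  have c: "c \<cdot>\<^sub>m A \<in> carrier_mat n m" using assms by simp
  note cs = mat_adjoint_carrier[OF assms] mat_adjoint_carrier[OF c]
  show "dim_row (mat_adjoint (c \<cdot>\<^sub>m A)) = dim_row (cnj c \<cdot>\<^sub>m mat_adjoint A)"
    "dim_col (mat_adjoint (c \<cdot>\<^sub>m A)) = dim_col (cnj c \<cdot>\<^sub>m mat_adjoint A)" using cs by auto
  fix i j assume "i < dim_row (cnj c \<cdot>\<^sub>m mat_adjoint A)" "j < dim_col (cnj c \<cdot>\<^sub>m mat_adjoint A)"
  then have "i < m" "j < n" using cs by auto
  then show "mat_adjoint (c \<cdot>\<^sub>m A) $$ (i, j) = (cnj c \<cdot>\<^sub>m mat_adjoint A) $$ (i, j)"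
    using assms cs c by (simp add: mat_adjoint_index[OF c] mat_adjoint_index[OF assms])
qed

lemma mat_adjoint_one: "mat_adjoint (1\<^sub>m n) = (1\<^sub>m n :: complex mat)"
proof (rule eq_matI)
  show "mat_adjoint (1\<^sub>m n) $$ (i, j) = (1\<^sub>m n :: complex mat) $$ (i, j)"
    if "i < dim_row (1\<^sub>m n :: complex mat)" "j < dim_col (1\<^sub>m n :: complex mat)" for i j
    using that by (simp add: mat_adjoint_index[OF one_carrier_mat[of n]])
qed (simp_all add: mat_adjoint_def)

lemma mat_adjoint_add:
  fixes A B :: "complex mat"
  assumes A: "A \<in> carrier_mat n m" and B: "B \<in> carrier_mat n m"
  shows "mat_adjoint (A + B) = mat_adjoint A + mat_adjoint B"
proof (rule eq_matI)
  have c: "A + B \<in> carrier_mat n m" using assms by simp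
  note cs = mat_adjoint_carrier[OF A] mat_adjoint_carrier[OF B] mat_adjoint_carrier[OF c]
  show "dim_row (mat_adjoint (A + B)) = dim_row (mat_adjoint A + mat_adjoint B)"
    "dim_col (mat_adjoint (A + B)) = dim_col (mat_adjoint A + mat_adjoint B)" using cs by auto
  fix i j assume "i < dim_row (mat_adjoint A + mat_adjoint B)" "j < dim_col (mat_adjoint A + mat_adjoint B)"
  then have "i < m" "j < n" using cs by auto
  then show "mat_adjoint (A + B) $$ (i, j) = (mat_adjoint A + mat_adjoint B) $$ (i, j)"
    using assms cs c by (simp add: mat_adjoint_index[OF c] mat_adjoint_index[OF A] mat_adjoint_index[OF B])
qed

text \<open>The Cayley transform \<open>(1 - A) (1 + A)^(-1)\<close> multiplied by
  \<open>det (1 + A)\<close>: this version is polynomial in \<open>A\<close> and makes sense when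
  \<open>1 + A\<close> is singular. The scalars \<open>1\<close> and \<open>- 1\<close> give both
  factors the shape \<open>1 + c A\<close>, so that one curve statement covers them.\<close>

definition cayley :: "nat \<Rightarrow> complex mat \<Rightarrow> complex mat" where
  "cayley d A = (1\<^sub>m d + (- 1) \<cdot>\<^sub>m A) * adj_mat (1\<^sub>m d + 1 \<cdot>\<^sub>m A)"

lemma cayley_carrier: "A \<in> carrier_mat d d \<Longrightarrow> cayley d A \<in> carrier_mat d d"
  unfolding cayley_def by (intro mult_carrier_mat[of _ d d] adj_mat(1)) auto

lemma poly_curve_cayley:
  assumes "A \<in> carrier_mat d d" "B \<in> carrier_mat d d"
  shows "poly_curve d (\<lambda>t. cayley d (A + t \<cdot>\<^sub>m B))"
proof -
  have "poly_curve d (\<lambda>t. 1\<^sub>m d + c \<cdot>\<^sub>m (A + t \<cdot>\<^sub>m B))" for c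
    using assms by (auto simp: poly_curve_def intro!: poly_fun_add poly_fun_mult)
  then show ?thesis unfolding cayley_def
    by (intro poly_curve_mult poly_curve_adj_mat)
qed

text \<open>For skew-Hermitian \<open>K\<close> the adjoint of \<open>1 + K\<close> is
  \<open>1 - K\<close>, and the two commute. The product of the transform with its adjoint therefore
  collapses to the squared modulus of the determinant.\<close>

lemma cayley_skew_unitary:
  assumes K: "K \<in> carrier_mat d d" and skew: "mat_adjoint K = (- 1) \<cdot>\<^sub>m K"
    and det: "det (1\<^sub>m d + K) \<noteq> 0"
  shows "(1 / det (1\<^sub>m d + K)) \<cdot>\<^sub>m cayley d K \<in> unitary_group d"
proof -
  define \<delta> where "\<delta> = det (1\<^sub>m d + K)"
  define M where "M = 1\<^sub>m d + K"
  define Mh where "Mh = 1\<^sub>m d + (- 1) \<cdot>\<^sub>m K"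
  define B where "B = adj_mat M"
  define C where "C = cayley d K"
  have c [simp]: "M \<in> carrier_mat d d" "Mh \<in> carrier_mat d d" "B \<in> carrier_mat d d"
    using K adj_mat(1)[of M d] by (auto simp: M_def Mh_def B_def)
  define Bh where "Bh = mat_adjoint B"
  have cBh [simp]: "Bh \<in> carrier_mat d d" unfolding Bh_def by (intro mat_adjoint_carrier c)
  have prods [simp]: "U * V \<in> carrier_mat d d"
    if "U \<in> carrier_mat d d" "V \<in> carrier_mat d d" for U V :: "complex mat"
    using that by (rule mult_carrier_mat)
  have ones [simp]: "1\<^sub>m d * U = U" "U * 1\<^sub>m d = U" if "U \<in> carrier_mat d d" for U :: "complex mat"
    using that by auto
  have C: "C = Mh * B"
    using K by (simp add: C_def cayley_def Mh_def B_def M_def smult_mat_one[of K])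
  have cC [simp]: "C \<in> carrier_mat d d" unfolding C by (rule mult_carrier_mat[of _ d d]) auto
  have MB: "M * B = \<delta> \<cdot>\<^sub>m 1\<^sub>m d" "B * M = \<delta> \<cdot>\<^sub>m 1\<^sub>m d"
    unfolding B_def \<delta>_def M_def[symmetric] by (rule adj_mat[OF c(1)])+
  have d0: "\<delta> \<noteq> 0" using det by (simp add: \<delta>_def)
  have Madj: "mat_adjoint M = Mh"
    unfolding M_def Mh_def using K by (simp add: mat_adjoint_add[of _ d d] mat_adjoint_one skew)
  have Mhadj: "mat_adjoint Mh = M"
    unfolding M_def Mh_def using K
    by (simp add: mat_adjoint_add[of _ d d] mat_adjoint_one mat_adjoint_smult[of _ d d] skew smult_smult_mat smult_mat_one)
  have MhBh: "Mh * Bh = cnj \<delta> \<cdot>\<^sub>m 1\<^sub>m d"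
    using arg_cong[OF MB(2), of mat_adjoint]
    by (simp add: mat_adjoint_mult[of _ d d _ d] Madj Bh_def[symmetric] mat_adjoint_smult[of _ d d] mat_adjoint_one)
  have comm: "M * Mh = Mh * M"
  proof -
    have "M * Mh = 1\<^sub>m d + K + (- 1) \<cdot>\<^sub>m (K + K * K)"
      unfolding M_def Mh_def using K
      by (simp add: add_mult_distrib_mat[of _ d d] mult_add_distrib_mat[of _ d d _ d] mult_smult_distrib[of _ d d _ d])
    moreover have "Mh * M = 1\<^sub>m d + (- 1) \<cdot>\<^sub>m K + (K + (-1) \<cdot>\<^sub>m (K * K))"
      unfolding M_def Mh_def using K
      by (simp add: add_mult_distrib_mat[of _ d d] mult_add_distrib_mat[of _ d d _ d] mult_smult_assoc_mat[of _ d d _ d])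
    moreover have "1\<^sub>m d + (- 1) \<cdot>\<^sub>m K + (K + (-1) \<cdot>\<^sub>m (K * K)) = 1\<^sub>m d + K + (- 1) \<cdot>\<^sub>m (K + K * K)"
      by (rule eq_matI) (use K in auto)
    ultimately show ?thesis by simp
  qed
  have "B * (M * Mh) * B = B * (Mh * M) * B" using comm by simp
  moreover have "B * (M * Mh) * B = \<delta> \<cdot>\<^sub>m (Mh * B)"
    by (simp add: assoc_mult_mat[of B d d M d Mh d, symmetric] MB mult_smult_assoc_mat[of _ d d _ d])
  moreover have "B * (Mh * M) * B = \<delta> \<cdot>\<^sub>m (B * Mh)"
  proof -
    have "B * (Mh * M) * B = B * Mh * M * B"
      by (simp add: assoc_mult_mat[of B d d Mh d M d, symmetric])
    also have "\<dots> = B * Mh * (M * B)" by (rule assoc_mult_mat[of _ d d _ d _ d]) auto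
    also have "\<dots> = \<delta> \<cdot>\<^sub>m (B * Mh)"
      by (simp add: MB mult_smult_distrib[of _ d d _ d])
    finally show ?thesis .
  qed
  ultimately have "\<delta> \<cdot>\<^sub>m (Mh * B) = \<delta> \<cdot>\<^sub>m (B * Mh)" by simp
  then have "(1 / \<delta>) \<cdot>\<^sub>m (\<delta> \<cdot>\<^sub>m (Mh * B)) = (1 / \<delta>) \<cdot>\<^sub>m (\<delta> \<cdot>\<^sub>m (B * Mh))" by simp
  \<comment> \<open>The other order of the factors: it puts \<open>Mh\<close> next to
    \<open>Bh\<close>, so that \<open>C\<close> times its adjoint telescopes.\<close>
  then have CB: "C = B * Mh" using d0 by (simp add: smult_smult_mat smult_mat_one C)
  have Cadj: "mat_adjoint C = Bh * M"
    unfolding C by (simp add: mat_adjoint_mult[of _ d d _ d] Mhadj Bh_def)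
  have "C * mat_adjoint C = B * Mh * (Bh * M)" by (subst Cadj) (simp add: CB)
  also have "\<dots> = B * (Mh * (Bh * M))" by (rule assoc_mult_mat[of _ d d _ d _ d]) auto
  also have "Mh * (Bh * M) = Mh * Bh * M" by (rule assoc_mult_mat[of _ d d _ d _ d, symmetric]) auto
  also have "\<dots> = cnj \<delta> \<cdot>\<^sub>m M" by (simp add: MhBh mult_smult_assoc_mat[of _ d d _ d])
  also have "B * \<dots> = (cnj \<delta> * \<delta>) \<cdot>\<^sub>m 1\<^sub>m d"
    by (simp add: mult_smult_distrib[of _ d d _ d] MB smult_smult_mat)
  finally have "C * mat_adjoint C = (cnj \<delta> * \<delta>) \<cdot>\<^sub>m 1\<^sub>m d" .
  then have "((1 / \<delta>) \<cdot>\<^sub>m C) * mat_adjoint ((1 / \<delta>) \<cdot>\<^sub>m C) = 1\<^sub>m d"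
    using d0 by (simp add: mat_adjoint_smult[of _ d d] mult_smult_distrib[of _ d d _ d] mult_smult_assoc_mat[of _ d d _ d]
        mat_adjoint_carrier smult_smult_mat smult_mat_one)
  then show ?thesis unfolding unitary_group_def C_def \<delta>_def
    using cayley_carrier[OF K] by simp
qed

text \<open>The Cayley transform reduces the density to the skew-Hermitian matrices, a real form of all matrices.\<close>

lemma unitary_group_dense:
  fixes p :: "complex mat \<Rightarrow> complex"
  assumes pf: "\<And>M. poly_curve d M \<Longrightarrow> poly_fun (\<lambda>t. p (M t))"
    and hom: "\<And>c Y. Y \<in> carrier_mat d d \<Longrightarrow> p (c \<cdot>\<^sub>m Y) = c ^ N * p Y"
    and zero: "\<And>g. g \<in> unitary_group d \<Longrightarrow> p g = 0"
    and X: "X \<in> carrier_mat d d"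
  shows "p X = 0"
proof -
  have inf: "infinite (range complex_of_real)"
    using infinite_UNIV_char_0[where 'a = real] by (auto dest!: finite_imageD simp: inj_on_def)
  have inf': "infinite (range complex_of_real - F)" if "finite F" for F
    using inf that by simp
  have det_fin: "finite {t. det (1\<^sub>m d + t \<cdot>\<^sub>m Y) = 0}" if Y: "Y \<in> carrier_mat d d" for Y :: "complex mat"
  proof (rule poly_fun_finite_zeros[where s = 0])
    show "poly_fun (\<lambda>t. det (1\<^sub>m d + t \<cdot>\<^sub>m Y))"
      by (intro poly_fun_det[of d] poly_curve_line one_carrier_mat Y)
    have "1\<^sub>m d + 0 \<cdot>\<^sub>m Y = 1\<^sub>m d" by (rule eq_matI) (use Y in auto)
    then show "det (1\<^sub>m d + 0 \<cdot>\<^sub>m Y) \<noteq> 0" by simp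
  qed
  \<comment> \<open>For real \<open>t\<close> the matrix \<open>t K\<close> stays skew-Hermitian, so
    \<open>p\<close> vanishes for all but finitely many of them; polynomiality reaches
    \<open>t = 1\<close> even when \<open>1 + K\<close> is singular.\<close>
  have skew: "p (cayley d K) = 0" if K: "K \<in> carrier_mat d d" "mat_adjoint K = (- 1) \<cdot>\<^sub>m K" for K
  proof -
    let ?f = "\<lambda>t. p (cayley d (0\<^sub>m d d + t \<cdot>\<^sub>m K))"
    have "?f 1 = 0"
    proof (rule poly_fun_eq_0[where f = ?f])
      show "poly_fun ?f" by (intro pf poly_curve_cayley K) auto
      show "infinite (range complex_of_real - {t. det (1\<^sub>m d + t \<cdot>\<^sub>m K) = 0})"
        by (intro inf' det_fin K)
      fix t assume t: "t \<in> range complex_of_real - {t. det (1\<^sub>m d + t \<cdot>\<^sub>m K) = 0}"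
      then have ct: "cnj t = t" by auto
      have K': "0\<^sub>m d d + t \<cdot>\<^sub>m K = t \<cdot>\<^sub>m K" "t \<cdot>\<^sub>m K \<in> carrier_mat d d" using K by auto
      have sk: "mat_adjoint (t \<cdot>\<^sub>m K) = (- 1) \<cdot>\<^sub>m (t \<cdot>\<^sub>m K)"
        using K by (simp add: mat_adjoint_smult[of _ d d] ct smult_smult_mat)
      let ?c = "det (1\<^sub>m d + t \<cdot>\<^sub>m K)"
      have c: "?c \<noteq> 0" using t by blast
      have cc: "cayley d (t \<cdot>\<^sub>m K) \<in> carrier_mat d d" by (rule cayley_carrier[OF K'(2)])
      \<comment> \<open>Homogeneity of \<open>p\<close> absorbs the scalar by which
        \<open>cayley\<close> differs from a unitary matrix.\<close>
      have "cayley d (t \<cdot>\<^sub>m K) = ?c \<cdot>\<^sub>m ((1 / ?c) \<cdot>\<^sub>m cayley d (t \<cdot>\<^sub>m K))"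
        using c by (simp add: smult_smult_mat smult_mat_one)
      then have "p (cayley d (t \<cdot>\<^sub>m K)) = ?c ^ N * p ((1 / ?c) \<cdot>\<^sub>m cayley d (t \<cdot>\<^sub>m K))"
        using hom[of "(1 / ?c) \<cdot>\<^sub>m cayley d (t \<cdot>\<^sub>m K)" ?c] cc by simp
      then show "?f t = 0"
        using zero[OF cayley_skew_unitary[OF K'(2) sk c]] by (simp add: K')
    qed
    moreover have "0\<^sub>m d d + 1 \<cdot>\<^sub>m K = K" using K by (simp add: smult_mat_one)
    ultimately show ?thesis by simp
  qed
  have all: "p (cayley d A) = 0" if A: "A \<in> carrier_mat d d" for A
  proof -
    \<comment> \<open>The skew-Hermitian parts of \<open>A\<close>. Real combinations of
      \<open>H1\<close> and \<open>H2\<close> are again skew-Hermitian, and \<open>A\<close> itself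
      is reached by letting the real parameter become the imaginary unit.\<close>
    define H1 where "H1 = mat d d (\<lambda>(i, j). (A $$ (i, j) - cnj (A $$ (j, i))) / 2)"
    define H2 where "H2 = mat d d (\<lambda>(i, j). (A $$ (i, j) + cnj (A $$ (j, i))) / (2 * \<i>))"
    have H: "H1 \<in> carrier_mat d d" "H2 \<in> carrier_mat d d" by (auto simp: H1_def H2_def)
    let ?f = "\<lambda>t. p (cayley d (H1 + t \<cdot>\<^sub>m H2))"
    have "?f \<i> = 0"
    proof (rule poly_fun_eq_0[where f = ?f])
      show "poly_fun ?f" by (intro pf poly_curve_cayley H) 
      show "infinite (range complex_of_real)" by (rule inf)
      fix t assume "t \<in> range complex_of_real"
      then have ct: "cnj t = t" by auto
      show "?f t = 0"
      proof (rule skew)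
        show cH: "H1 + t \<cdot>\<^sub>m H2 \<in> carrier_mat d d" using H by simp
        show "mat_adjoint (H1 + t \<cdot>\<^sub>m H2) = - 1 \<cdot>\<^sub>m (H1 + t \<cdot>\<^sub>m H2)"
        proof (rule eq_matI)
          fix i j assume "i < dim_row (- 1 \<cdot>\<^sub>m (H1 + t \<cdot>\<^sub>m H2))" "j < dim_col (- 1 \<cdot>\<^sub>m (H1 + t \<cdot>\<^sub>m H2))"
          then have ij: "i < d" "j < d" using H by auto
          have "mat_adjoint (H1 + t \<cdot>\<^sub>m H2) $$ (i, j) = cnj (H1 $$ (j, i)) + t * cnj (H2 $$ (j, i))"
            using ij H by (simp add: mat_adjoint_index[OF cH] ct)
          also have "\<dots> = - (H1 $$ (i, j) + t * H2 $$ (i, j))"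
            using ij by (simp add: H1_def H2_def field_simps)
          finally show "mat_adjoint (H1 + t \<cdot>\<^sub>m H2) $$ (i, j) = (- 1 \<cdot>\<^sub>m (H1 + t \<cdot>\<^sub>m H2)) $$ (i, j)"
            using ij H by simp
        qed (use mat_adjoint_carrier[OF cH] cH in auto)
      qed
    qed
    moreover have "H1 + \<i> \<cdot>\<^sub>m H2 = A"
      by (rule eq_matI) (use A in \<open>auto simp: H1_def H2_def field_simps\<close>)
    ultimately show ?thesis by simp
  qed
  \<comment> \<open>The Cayley transform is an involution up to a scalar: for
    \<open>A = (1 - Y) (1 + Y)^(-1)\<close> one finds \<open>1 + A = 2 J\<close> and
    \<open>1 - A = 2 Y J\<close>, so \<open>cayley d A\<close> is a nonzero multiple of
    \<open>Y\<close>.\<close>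
  have inv: "p Y = 0" if Y: "Y \<in> carrier_mat d d" and det: "det (1\<^sub>m d + Y) \<noteq> 0" for Y
  proof -
    define \<epsilon> where "\<epsilon> = det (1\<^sub>m d + Y)"
    define J where "J = (1 / \<epsilon>) \<cdot>\<^sub>m adj_mat (1\<^sub>m d + Y)"
    define A where "A = (1\<^sub>m d + (- 1) \<cdot>\<^sub>m Y) * J"
    have cY: "1\<^sub>m d + Y \<in> carrier_mat d d" using Y by simp
    note ad = adj_mat[OF cY]
    have cJ: "J \<in> carrier_mat d d" using ad by (simp add: J_def)
    have cA: "A \<in> carrier_mat d d" unfolding A_def using Y cJ by (intro mult_carrier_mat[of _ d d]) auto
    have YJ: "(1\<^sub>m d + Y) * J = 1\<^sub>m d"
      unfolding J_def using ad cY det by (simp add: mult_smult_distrib[of _ d d _ d] \<epsilon>_def smult_smult_mat smult_mat_one)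
    have JY: "J * (1\<^sub>m d + Y) = 1\<^sub>m d"
      unfolding J_def using ad cY det by (simp add: mult_smult_assoc_mat[of _ d d _ d] \<epsilon>_def smult_smult_mat smult_mat_one)
    have cYJ: "Y * J \<in> carrier_mat d d" using Y cJ by simp
    have YJ': "J + Y * J = 1\<^sub>m d" using YJ Y cJ by (simp add: add_mult_distrib_mat[of _ d d])
    have A: "A = J + (- 1) \<cdot>\<^sub>m (Y * J)"
      unfolding A_def using Y cJ by (simp add: add_mult_distrib_mat[of _ d d] mult_smult_assoc_mat[of _ d d _ d])
    have ent: "J $$ (i, j) + (Y * J) $$ (i, j) = 1\<^sub>m d $$ (i, j)" if "i < d" "j < d" for i j
      using arg_cong[OF YJ', of "\<lambda>M. M $$ (i, j)"] that cJ cYJ Y by simp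
    have A1: "1\<^sub>m d + 1 \<cdot>\<^sub>m A = 2 \<cdot>\<^sub>m J"
    proof (rule eq_matI)
      fix i j assume "i < dim_row (2 \<cdot>\<^sub>m J)" "j < dim_col (2 \<cdot>\<^sub>m J)"
      then have ij: "i < d" "j < d" using cJ by auto
      have "(1\<^sub>m d + 1 \<cdot>\<^sub>m A) $$ (i, j) = 1\<^sub>m d $$ (i, j) + (J $$ (i, j) - (Y * J) $$ (i, j))"
        unfolding A using ij cJ cYJ Y by (simp del: index_mult_mat(1) index_one_mat(1))
      then show "(1\<^sub>m d + 1 \<cdot>\<^sub>m A) $$ (i, j) = (2 \<cdot>\<^sub>m J) $$ (i, j)"
        unfolding ent[OF ij, symmetric] using ij cJ by simp
    qed (use cJ cA in auto)
    have A2: "1\<^sub>m d + (- 1) \<cdot>\<^sub>m A = 2 \<cdot>\<^sub>m (Y * J)"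
    proof (rule eq_matI)
      fix i j assume "i < dim_row (2 \<cdot>\<^sub>m (Y * J))" "j < dim_col (2 \<cdot>\<^sub>m (Y * J))"
      then have ij: "i < d" "j < d" using cYJ by auto
      have "(1\<^sub>m d + (- 1) \<cdot>\<^sub>m A) $$ (i, j) = 1\<^sub>m d $$ (i, j) - (J $$ (i, j) - (Y * J) $$ (i, j))"
        unfolding A using ij cJ cYJ Y by (simp del: index_mult_mat(1) index_one_mat(1))
      also have "\<dots> = 2 * (Y * J) $$ (i, j)"
        unfolding ent[OF ij, symmetric] by simp
      finally show "(1\<^sub>m d + (- 1) \<cdot>\<^sub>m A) $$ (i, j) = (2 \<cdot>\<^sub>m (Y * J)) $$ (i, j)"
        using ij cYJ Y cJ by (simp del: index_mult_mat(1))
    qed (use cYJ cA in auto)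
    let ?D = "adj_mat (2 \<cdot>\<^sub>m J)"
    have c2: "2 \<cdot>\<^sub>m J \<in> carrier_mat d d" using cJ by simp
    note ad2 = adj_mat[OF c2]
    have "cayley d A = (Y * (2 \<cdot>\<^sub>m J)) * ?D"
      unfolding cayley_def A1 A2 using Y cJ by (simp add: mult_smult_distrib[of _ d d _ d])
    also have "\<dots> = Y * (2 \<cdot>\<^sub>m J * ?D)" by (rule assoc_mult_mat[OF Y c2 ad2(1)])
    also have "\<dots> = det (2 \<cdot>\<^sub>m J) \<cdot>\<^sub>m Y"
      using Y by (simp add: ad2 mult_smult_distrib[of _ d d _ d])
    finally have "0 = det (2 \<cdot>\<^sub>m J) ^ N * p Y"
      using all[OF cA] hom[OF Y] by simp
    moreover have "det (2 \<cdot>\<^sub>m J) \<noteq> 0"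
    proof -
      have "det (1\<^sub>m d + Y) * det J = 1"
        using det_mult[OF cY cJ] YJ by simp
      then show ?thesis using cJ by (auto simp: det_smult)
    qed
    ultimately show ?thesis by simp
  qed
  \<comment> \<open>Some nonzero multiple \<open>s X\<close> makes \<open>1 + s X\<close>
    invertible, and homogeneity brings the conclusion back to \<open>X\<close>.\<close>
  have "infinite (- {t. det (1\<^sub>m d + t \<cdot>\<^sub>m X) = 0} - {0::complex})"
    using det_fin[OF X] by (simp add: finite_compl infinite_UNIV_char_0)
  then have "- {t. det (1\<^sub>m d + t \<cdot>\<^sub>m X) = 0} - {0::complex} \<noteq> {}" by (metis finite.emptyI)
  then obtain s where s: "s \<noteq> 0" "det (1\<^sub>m d + s \<cdot>\<^sub>m X) \<noteq> 0" by auto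
  then have "p (s \<cdot>\<^sub>m X) = 0" using X by (intro inv) auto
  then show ?thesis using hom[OF X, of s] s by simp
qed

section \<open>Tensors as functions of words\<close>

text \<open>Pairs of a tensor factor and a slot in it. Nested multi-indices become functions
  ("words") on this single finite set, so products and sums over coordinates need no recursion over
  lists.\<close>

definition positions :: "nat list \<Rightarrow> (nat \<times> nat) set" where
  "positions ks = (SIGMA a:{..<length ks}. {..<ks ! a})"

definition blocks :: "nat list \<Rightarrow> (nat \<times> nat \<Rightarrow> nat) \<Rightarrow> nat list list" where
  "blocks ks w = map (\<lambda>a. map (\<lambda>p. w (a, p)) [0..<ks ! a]) [0..<length ks]"

abbreviation multi_indices :: "nat \<Rightarrow> nat list \<Rightarrow> nat list list set" where
  "multi_indices d ks \<equiv> listset (map (multi_index d) ks)"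

abbreviation words :: "nat \<Rightarrow> nat list \<Rightarrow> (nat \<times> nat \<Rightarrow> nat) set" where
  "words d ks \<equiv> positions ks \<rightarrow>\<^sub>E {..<d}"

lemma listset_iff: "xs \<in> listset As \<longleftrightarrow> length xs = length As \<and> (\<forall>i<length As. xs ! i \<in> As ! i)"
proof (induction As arbitrary: xs)
  case (Cons A As)
  then show ?case
    by (cases xs) (auto simp: set_Cons_def nth_Cons split: nat.splits)
qed auto

lemma multi_index_iff: "I \<in> multi_index d k \<longleftrightarrow> length I = k \<and> (\<forall>p<k. I ! p < d)"
  unfolding multi_index_def listset_iff by auto

lemma finite_positions [simp]: "finite (positions ks)"
  by (auto simp: positions_def)

lemma finite_words [simp]: "finite (words d ks)"
  by (intro finite_PiE) auto

lemma positions_iff [simp]: "(a, p) \<in> positions ks \<longleftrightarrow> a < length ks \<and> p < ks ! a"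
  by (auto simp: positions_def)

lemma blocks_nth: "a < length ks \<Longrightarrow> blocks ks w ! a = map (\<lambda>p. w (a, p)) [0..<ks ! a]"
  by (simp add: blocks_def)

lemma length_blocks [simp]: "length (blocks ks w) = length ks"
  by (simp add: blocks_def)

lemma blocks_nth_nth: "(a, p) \<in> positions ks \<Longrightarrow> blocks ks w ! a ! p = w (a, p)"
  by (simp add: blocks_nth)

lemma blocks_cong: "(\<And>x. x \<in> positions ks \<Longrightarrow> w x = w' x) \<Longrightarrow> blocks ks w = blocks ks w'"
  by (auto simp: blocks_def)

lemma blocks_eq_iff: "blocks ks w = blocks ks w' \<longleftrightarrow> (\<forall>x\<in>positions ks. w x = w' x)"
proof
  assume "blocks ks w = blocks ks w'"
  then show "\<forall>x\<in>positions ks. w x = w' x" by (metis blocks_nth_nth surj_pair)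
qed (auto intro: blocks_cong)

lemma blocks_in_multi_indices:
  "blocks ks w \<in> multi_indices d ks \<longleftrightarrow> (\<forall>x\<in>positions ks. w x < d)"
  by (auto simp: listset_iff blocks_nth multi_index_iff)

lemma bij_betw_blocks: "bij_betw (blocks ks) (words d ks) (multi_indices d ks)"
  unfolding bij_betw_def
proof (intro conjI equalityI subsetI)
  show "inj_on (blocks ks) (words d ks)"
    by (intro inj_onI PiE_ext) (auto simp: blocks_eq_iff)
next
  fix J assume "J \<in> blocks ks ` words d ks"
  then show "J \<in> multi_indices d ks" by (auto simp: blocks_in_multi_indices simp flip: lessThan_iff)
next
  fix J assume J: "J \<in> multi_indices d ks"
  let ?w = "restrict (\<lambda>(a, p). J ! a ! p) (positions ks)"
  have "?w \<in> words d ks" using J by (auto simp: listset_iff multi_index_iff)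
  moreover have "blocks ks ?w = J"
    using J by (intro nth_equalityI) (auto simp: listset_iff blocks_nth multi_index_iff intro!: nth_equalityI)
  ultimately show "J \<in> blocks ks ` words d ks" by (metis imageI)
qed

lemma multi_indices_cases:
  assumes "J \<in> multi_indices d ks"
  obtains w where "w \<in> words d ks" "J = blocks ks w"
  using assms bij_betw_blocks[of ks d] unfolding bij_betw_def by blast

lemma words_D: "w \<in> words d ks \<Longrightarrow> x \<in> positions ks \<Longrightarrow> w x < d"
  by auto

lemma blocks_words: "w \<in> words d ks \<Longrightarrow> blocks ks w \<in> multi_indices d ks"
  by (auto simp: blocks_in_multi_indices simp flip: lessThan_iff)

lemma finite_multi_indices [simp]: "finite (multi_indices d ks)"
  using bij_betw_finite[OF bij_betw_blocks] finite_words by blast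

lemma tensor_coeff_blocks:
  "tensor_coeff (tensor_coeff a) (blocks ks w) (blocks ks w') = (\<Prod>x\<in>positions ks. a (w x) (w' x))"
proof -
  have "tensor_coeff (tensor_coeff a) (blocks ks w) (blocks ks w')
      = (\<Prod>b<length ks. \<Prod>p<ks ! b. a (w (b, p)) (w' (b, p)))"
    by (simp add: tensor_coeff_def blocks_nth)
  also have "\<dots> = (\<Prod>x\<in>positions ks. a (w x) (w' x))"
    unfolding positions_def by (subst prod.Sigma) (auto intro!: prod.cong)
  finally show ?thesis .
qed

lemma tensor_act_blocks:
  assumes "w \<in> words d ks"
  shows "tensor_act d ks X T (blocks ks w)
    = (\<Sum>w'\<in>words d ks. (\<Prod>x\<in>positions ks. X $$ (w x, w' x)) * T (blocks ks w'))"
  using blocks_words[OF assms]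
  by (simp add: tensor_act_def matrix_act_def sum.reindex_bij_betw[OF bij_betw_blocks, symmetric] tensor_coeff_blocks)

lemma tensor_act_outside: "J \<notin> multi_indices d ks \<Longrightarrow> tensor_act d ks X T J = 0"
  by (simp add: tensor_act_def matrix_act_def)

lemma multi_indices_ext:
  assumes "\<And>J. J \<notin> multi_indices d ks \<Longrightarrow> T J = T' J"
    and "\<And>w. w \<in> words d ks \<Longrightarrow> T (blocks ks w) = T' (blocks ks w)"
  shows "T = T'"
  using assms by (metis ext multi_indices_cases)

lemma tensor_act_linear:
  "Vector_Spaces.linear (\<lambda>c f i. c * f i) (\<lambda>c f i. c * f i) (tensor_act d ks X)"
  by (intro Vector_Spaces.linear.intro cfun.vector_space_axioms module_hom.intro module_hom_axioms.intro cfun.module_axioms)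
     (auto simp: fun_eq_iff tensor_act_def matrix_act_def algebra_simps sum.distrib sum_distrib_left)

lemma tensor_act_mult:
  assumes X: "X \<in> carrier_mat d d" and Y: "Y \<in> carrier_mat d d"
  shows "tensor_act d ks X (tensor_act d ks Y T) = tensor_act d ks (X * Y) T"
proof (rule multi_indices_ext[where d = d and ks = ks])
  fix w assume w: "w \<in> words d ks"
  have XY: "(\<Prod>x\<in>positions ks. (X * Y) $$ (w x, w'' x))
     = (\<Sum>w'\<in>words d ks. \<Prod>x\<in>positions ks. X $$ (w x, w' x) * Y $$ (w' x, w'' x))"
    if w'': "w'' \<in> words d ks" for w''
  proof -
    have "(\<Prod>x\<in>positions ks. (X * Y) $$ (w x, w'' x))
       = (\<Prod>x\<in>positions ks. \<Sum>j<d. X $$ (w x, j) * Y $$ (j, w'' x))"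
    proof (intro prod.cong refl)
      fix x assume "x \<in> positions ks"
      then have "w x < d" "w'' x < d" using w w'' by (auto simp: words_D)
      then show "(X * Y) $$ (w x, w'' x) = (\<Sum>j<d. X $$ (w x, j) * Y $$ (j, w'' x))"
        using X Y by (auto simp: scalar_prod_def atLeast0LessThan)
    qed
    also have "\<dots> = (\<Sum>w'\<in>words d ks. \<Prod>x\<in>positions ks. X $$ (w x, w' x) * Y $$ (w' x, w'' x))"
      by (intro prod_sum_PiE) auto
    finally show ?thesis .
  qed
  have "tensor_act d ks X (tensor_act d ks Y T) (blocks ks w)
      = (\<Sum>w'\<in>words d ks. \<Sum>w''\<in>words d ks. (\<Prod>x\<in>positions ks. X $$ (w x, w' x) * Y $$ (w' x, w'' x)) * T (blocks ks w''))"
    using w by (simp add: tensor_act_blocks sum_distrib_left prod.distrib mult.assoc)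
  also have "\<dots> = (\<Sum>w''\<in>words d ks. \<Sum>w'\<in>words d ks. (\<Prod>x\<in>positions ks. X $$ (w x, w' x) * Y $$ (w' x, w'' x)) * T (blocks ks w''))"
    by (rule sum.swap)
  also have "\<dots> = tensor_act d ks (X * Y) T (blocks ks w)"
    using w by (simp add: tensor_act_blocks XY sum_distrib_right)
  finally show "tensor_act d ks X (tensor_act d ks Y T) (blocks ks w) = tensor_act d ks (X * Y) T (blocks ks w)" .
qed (simp add: tensor_act_outside)

lemma tensor_act_smult:
  assumes X: "X \<in> carrier_mat d d"
  shows "tensor_act d ks (c \<cdot>\<^sub>m X) T = (\<lambda>J. c ^ card (positions ks) * tensor_act d ks X T J)"
proof (rule multi_indices_ext[where d = d and ks = ks])
  fix w assume w: "w \<in> words d ks"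
  have "(\<Prod>x\<in>positions ks. (c \<cdot>\<^sub>m X) $$ (w x, w' x))
     = c ^ card (positions ks) * (\<Prod>x\<in>positions ks. X $$ (w x, w' x))" if "w' \<in> words d ks" for w'
  proof -
    have "(\<Prod>x\<in>positions ks. (c \<cdot>\<^sub>m X) $$ (w x, w' x)) = (\<Prod>x\<in>positions ks. c * X $$ (w x, w' x))"
      using X w that by (intro prod.cong refl) (simp add: words_D)
    then show ?thesis by (simp add: prod.distrib)
  qed
  then show "tensor_act d ks (c \<cdot>\<^sub>m X) T (blocks ks w) = c ^ card (positions ks) * tensor_act d ks X T (blocks ks w)"
    using w by (simp add: tensor_act_blocks sum_distrib_left mult.assoc)
qed (simp add: tensor_act_outside)

lemma poly_fun_tensor_act:
  assumes M: "poly_curve d M"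
  shows "poly_fun (\<lambda>t. tensor_act d ks (M t) T J)"
proof (cases "J \<in> multi_indices d ks")
  case True
  then obtain w where w: "w \<in> words d ks" "J = blocks ks w" by (rule multi_indices_cases)
  show ?thesis
    unfolding w(2) tensor_act_blocks[OF w(1)]
    using M w(1) by (intro poly_fun_sum poly_fun_mult poly_fun_prod poly_fun_const)
      (auto simp: poly_curve_def words_D)
qed (simp add: tensor_act_outside)

text \<open>A functional that kills \<open>V\<close>, composed with the action on \<open>v\<close>,
  is a homogeneous polynomial function of the matrix, of degree \<open>card (positions ks)\<close>,
  and vanishes on the unitary group; by density it vanishes everywhere. Singular matrices are
  included, which matters for projections and for curves.\<close>

lemma invariant_under_all_matrices:
  assumes V: "invariant_subspace (unitary_group d) (tensor_act d ks) V" and v: "v \<in> V"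
    and X: "X \<in> carrier_mat d d"
  shows "tensor_act d ks X v \<in> V"
proof (rule ccontr)
  have sub: "cfun.subspace V" using V by (simp add: invariant_subspace_def)
  assume "tensor_act d ks X v \<notin> V"
  then obtain g where g: "Vector_Spaces.linear (\<lambda>c f i. c * f i) (*) g"
    "\<And>w. w \<in> V \<Longrightarrow> g w = (0::complex)" "g (tensor_act d ks X v) = 1"
    using cfun_separating_functional[OF sub] by blast
  interpret g: Vector_Spaces.linear "\<lambda>c f i. c * f i" "(*)" g by (rule g)
  have gX: "g (tensor_act d ks Y v) = (\<Sum>z\<in>multi_indices d ks. tensor_act d ks Y v z * g (\<lambda>i. if i = z then 1 else 0))" for Y
    by (rule cfun_linear_expand[OF g(1)]) (auto simp: tensor_act_outside)
  have "g (tensor_act d ks X v) = 0"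
  proof (rule unitary_group_dense[OF _ _ _ X])
    show "poly_fun (\<lambda>t. g (tensor_act d ks (M t) v))" if "poly_curve d M" for M
      unfolding gX by (intro poly_fun_sum poly_fun_mult poly_fun_const poly_fun_tensor_act that)
    show "g (tensor_act d ks (c \<cdot>\<^sub>m Y) v) = c ^ card (positions ks) * g (tensor_act d ks Y v)"
      if "Y \<in> carrier_mat d d" for c Y
      by (simp only: tensor_act_smult[OF that] g.scale)
    show "g (tensor_act d ks h v) = 0" if "h \<in> unitary_group d" for h
      using V v that by (intro g(2)) (simp add: invariant_subspace_def)
  qed
  then show False using g(3) by simp
qed

section \<open>The standard Hermitian form and the action of diagonal matrices\<close>

definition tensor_inner :: "nat \<Rightarrow> nat list \<Rightarrow> (nat list list \<Rightarrow> complex) \<Rightarrow> (nat list list \<Rightarrow> complex) \<Rightarrow> complex" where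
  "tensor_inner d ks u v = (\<Sum>w\<in>words d ks. u (blocks ks w) * cnj (v (blocks ks w)))"

lemma tensor_inner_adjoint:
  assumes X: "X \<in> carrier_mat d d"
  shows "tensor_inner d ks (tensor_act d ks X u) v = tensor_inner d ks u (tensor_act d ks (mat_adjoint X) v)"
proof -
  have "tensor_inner d ks (tensor_act d ks X u) v
    = (\<Sum>w\<in>words d ks. \<Sum>w'\<in>words d ks. (\<Prod>x\<in>positions ks. X $$ (w x, w' x)) * u (blocks ks w') * cnj (v (blocks ks w)))"
    by (simp add: tensor_inner_def tensor_act_blocks sum_distrib_right)
  also have "\<dots> = (\<Sum>w'\<in>words d ks. \<Sum>w\<in>words d ks. (\<Prod>x\<in>positions ks. X $$ (w x, w' x)) * u (blocks ks w') * cnj (v (blocks ks w)))"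
    by (rule sum.swap)
  also have "\<dots> = tensor_inner d ks u (tensor_act d ks (mat_adjoint X) v)"
    unfolding tensor_inner_def
  proof (intro sum.cong refl)
    fix w' assume w': "w' \<in> words d ks"
    have "(\<Prod>x\<in>positions ks. X $$ (w x, w' x)) = cnj (\<Prod>x\<in>positions ks. mat_adjoint X $$ (w' x, w x))"
      if "w \<in> words d ks" for w
      using that w' X by (simp add: words_D mat_adjoint_index)
    then show "(\<Sum>w\<in>words d ks. (\<Prod>x\<in>positions ks. X $$ (w x, w' x)) * u (blocks ks w') * cnj (v (blocks ks w)))
       = u (blocks ks w') * cnj (tensor_act d ks (mat_adjoint X) v (blocks ks w'))"
      using w' by (simp add: tensor_act_blocks sum_distrib_left mult_ac)
  qed
  finally show ?thesis .
qed

lemma tensor_inner_self_zero: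
  assumes "tensor_inner d ks u u = 0" "w \<in> words d ks"
  shows "u (blocks ks w) = 0"
proof -
  have "tensor_inner d ks u u = complex_of_real (\<Sum>w\<in>words d ks. (cmod (u (blocks ks w)))\<^sup>2)"
    by (simp add: tensor_inner_def complex_norm_square del: of_real_power)
  then have "(\<Sum>w\<in>words d ks. (cmod (u (blocks ks w)))\<^sup>2) = 0"
    using assms(1) by (metis of_real_eq_0_iff)
  then have "(cmod (u (blocks ks w)))\<^sup>2 = 0"
    using assms(2) by (subst (asm) sum_nonneg_eq_0_iff) auto
  then show ?thesis by simp
qed

lemma tensor_act_diagonal:
  assumes X: "X \<in> carrier_mat d d" "diagonal_mat X" and w: "w \<in> words d ks"
  shows "tensor_act d ks X T (blocks ks w) = (\<Prod>x\<in>positions ks. X $$ (w x, w x)) * T (blocks ks w)"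
proof -
  have "(\<Prod>x\<in>positions ks. X $$ (w x, w' x)) = 0" if w': "w' \<in> words d ks" "w' \<noteq> w" for w'
  proof -
    obtain x where x: "x \<in> positions ks" "w' x \<noteq> w x" using w w' by (metis PiE_ext)
    then have "X $$ (w x, w' x) = 0"
      using X w w'(1) words_D[OF _ x(1)] unfolding diagonal_mat_def by (metis carrier_matD)
    then show ?thesis using x by (intro prod_zero) auto
  qed
  then have "tensor_act d ks X T (blocks ks w)
     = (\<Sum>w'\<in>{w}. (\<Prod>x\<in>positions ks. X $$ (w x, w' x)) * T (blocks ks w'))"
    unfolding tensor_act_blocks[OF w] using w by (intro sum.mono_neutral_right) auto
  then show ?thesis by simp
qed

section \<open>Weights read off from letter counts\<close>

definition letter_count :: "nat list \<Rightarrow> (nat \<times> nat \<Rightarrow> nat) \<Rightarrow> nat \<Rightarrow> nat" where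
  "letter_count ks w j = card {x \<in> positions ks. w x = j}"

lemma prod_by_letter:
  fixes f :: "nat \<Rightarrow> complex"
  assumes "w \<in> words d ks"
  shows "(\<Prod>x\<in>positions ks. f (w x)) = (\<Prod>j<d. f j ^ letter_count ks w j)"
proof -
  have "(\<Prod>x\<in>positions ks. f (w x)) = (\<Prod>j<d. \<Prod>x | x \<in> positions ks \<and> w x = j. f (w x))"
    using assms by (intro prod.group[symmetric]) auto
  also have "\<dots> = (\<Prod>j<d. f j ^ letter_count ks w j)"
    by (intro prod.cong refl) (simp add: letter_count_def)
  finally show ?thesis .
qed

lemma torus_element:
  assumes "cmod z = 1"
  shows "mat d d (\<lambda>(i, j). if i = j then if i = a then z else 1 else 0) \<in> unitary_torus d" (is "?t \<in> _")
proof -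
  have "?t * mat_adjoint ?t = 1\<^sub>m d"
  proof (rule eq_matI)
    have c: "?t \<in> carrier_mat d d" by simp
    note ca = mat_adjoint_carrier[OF c]
    fix i j assume ij: "i < dim_row (1\<^sub>m d :: complex mat)" "j < dim_col (1\<^sub>m d :: complex mat)"
    then have "(?t * mat_adjoint ?t) $$ (i, j) = (\<Sum>k = 0..<d. ?t $$ (i, k) * cnj (?t $$ (j, k)))"
      using ca by (simp add: scalar_prod_def mat_adjoint_index[OF c])
    also have "\<dots> = (\<Sum>k\<in>{i}. ?t $$ (i, k) * cnj (?t $$ (j, k)))"
      using ij by (intro sum.mono_neutral_right) auto
    also have "\<dots> = 1\<^sub>m d $$ (i, j)"
      using ij assms complex_norm_square[of z] by auto
    finally show "(?t * mat_adjoint ?t) $$ (i, j) = (1\<^sub>m d :: complex mat) $$ (i, j)" .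
  qed (auto simp: mat_adjoint_def)
  then show ?thesis by (auto simp: unitary_torus_def unitary_group_def diagonal_mat_def)
qed

lemma powi_unit_circle_inj:
  fixes a b :: int
  assumes "\<And>z. cmod z = 1 \<Longrightarrow> z powi a = z powi b"
  shows "a = b"
proof (rule ccontr)
  assume ab: "a \<noteq> b"
  \<comment> \<open>Chosen so that its power \<open>a - b\<close> is \<open>- 1\<close>, whereas
    equal powers would make it 1.\<close>
  define z where "z = cis (pi / real_of_int (a - b))"
  have z: "z \<noteq> 0" "cmod z = 1" by (auto simp: z_def)
  have "z powi (a - b) = cis (real_of_int (a - b) * (pi / real_of_int (a - b)))"
    unfolding z_def by (rule cis_power_int)
  also have "\<dots> = - 1" using ab by simp
  finally have "z powi a = - (z powi b)"
    using z by (simp add: power_int_diff field_simps)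
  then show False using assms[OF z(2)] z by simp
qed

lemma weight_character_letter_count:
  assumes t: "t \<in> unitary_torus d" and w: "w \<in> words d ks"
    and \<mu>: "\<And>i. i \<in> {1..d} \<Longrightarrow> \<mu> i = int (letter_count ks w (i - 1))"
  shows "(\<Prod>x\<in>positions ks. t $$ (w x, w x)) = weight_character d \<mu> t"
proof -
  have "(\<Prod>x\<in>positions ks. t $$ (w x, w x)) = (\<Prod>j<d. (t $$ (j, j)) ^ letter_count ks w j)"
    by (rule prod_by_letter[OF w, where f = "\<lambda>j. t $$ (j, j)"])
  also have "\<dots> = (\<Prod>i=1..d. (t $$ (i - 1, i - 1)) powi \<mu> i)"
    by (rule prod.reindex_bij_witness[where i = "\<lambda>i. i - 1" and j = Suc]) (auto simp: \<mu>)
  finally show ?thesis by (simp add: weight_character_def)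
qed

text \<open>A diagonal matrix multiplies the coordinate at a word by the monomial of its letter
  counts. Varying one torus entry over the unit circle separates integer exponents, so belonging to
  a weight space is a condition on the support.\<close>

lemma weight_space_iff:
  assumes V: "\<And>u J. u \<in> V \<Longrightarrow> J \<notin> multi_indices d ks \<Longrightarrow> u J = 0"
  shows "v \<in> weight_space d (tensor_act d ks) V \<mu> \<longleftrightarrow> v \<in> V \<and>
    (\<forall>w\<in>words d ks. v (blocks ks w) \<noteq> 0 \<longrightarrow> (\<forall>i\<in>{1..d}. \<mu> i = int (letter_count ks w (i - 1))))"
proof (intro iffI conjI ballI impI)
  assume v: "v \<in> weight_space d (tensor_act d ks) V \<mu>"
  then show "v \<in> V" by (simp add: weight_space_def)
  fix w i assume w: "w \<in> words d ks" "v (blocks ks w) \<noteq> 0" and i: "i \<in> {1..d}"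
  show "\<mu> i = int (letter_count ks w (i - 1))"
  proof (rule powi_unit_circle_inj)
    fix z assume z: "cmod z = 1"
    define t where "t = mat d d (\<lambda>(k, j). if k = j then if k = i - 1 then z else 1 else 0)"
    have t: "t \<in> unitary_torus d" unfolding t_def by (rule torus_element[OF z])
    have "tensor_act d ks t v (blocks ks w) = weight_character d \<mu> t * v (blocks ks w)"
      using v t unfolding weight_space_def by (auto dest: fun_cong)
    then have "weight_character d \<mu> t = (\<Prod>x\<in>positions ks. t $$ (w x, w x))"
      using t w by (simp add: tensor_act_diagonal unitary_torus_def unitary_group_def)
    also have "\<dots> = (\<Prod>j<d. (t $$ (j, j)) ^ letter_count ks w j)"
      by (rule prod_by_letter[OF w(1), where f = "\<lambda>j. t $$ (j, j)"])
    also have "\<dots> = (\<Prod>j\<in>{i - 1}. z ^ letter_count ks w j)"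
      using i by (intro prod.mono_neutral_cong_right) (auto simp: t_def)
    also have "weight_character d \<mu> t = (\<Prod>k\<in>{i}. z powi \<mu> k)"
      unfolding weight_character_def using i by (intro prod.mono_neutral_cong_right) (auto simp: t_def split: if_splits)
    finally show "z powi \<mu> i = z powi int (letter_count ks w (i - 1))" by simp
  qed
next
  assume *: "v \<in> V \<and> (\<forall>w\<in>words d ks. v (blocks ks w) \<noteq> 0 \<longrightarrow> (\<forall>i\<in>{1..d}. \<mu> i = int (letter_count ks w (i - 1))))"
  have "tensor_act d ks t v = (\<lambda>J. weight_character d \<mu> t * v J)" if t: "t \<in> unitary_torus d" for t
  proof (rule multi_indices_ext[where d = d and ks = ks])
    fix w assume w: "w \<in> words d ks"
    have "(\<Prod>x\<in>positions ks. t $$ (w x, w x)) = weight_character d \<mu> t" if "v (blocks ks w) \<noteq> 0"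
      using weight_character_letter_count[OF t w] * w that by blast
    then show "tensor_act d ks t v (blocks ks w) = weight_character d \<mu> t * v (blocks ks w)"
      using t w by (auto simp: tensor_act_diagonal unitary_torus_def unitary_group_def)
  qed (use V * in \<open>simp add: tensor_act_outside\<close>)
  then show "v \<in> weight_space d (tensor_act d ks) V \<mu>" using * by (simp add: weight_space_def)
qed

section \<open>Products of determinants; symmetric and alternating tensors\<close>

abbreviation boxes :: "nat \<Rightarrow> nat \<Rightarrow> (nat \<times> nat) set" where
  "boxes L k \<equiv> positions (replicate L k)"

lemma boxes_eq: "boxes L k = {..<L} \<times> {..<k}"
  by (auto simp: positions_def)

definition det_fun :: "nat \<Rightarrow> (nat \<Rightarrow> nat \<Rightarrow> 'a::comm_ring_1) \<Rightarrow> 'a" where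
  "det_fun k F = det (mat k k (\<lambda>(i, j). F i j))"

text \<open>The boxes form a rectangle with \<open>L\<close> columns of height \<open>k\<close>. A
  row vector sits in every box, and each column contributes one determinant.\<close>

definition det_prod :: "nat \<Rightarrow> nat \<Rightarrow> (nat \<times> nat \<Rightarrow> nat \<Rightarrow> 'a::comm_ring_1) \<Rightarrow> 'a" where
  "det_prod L k Z = (\<Prod>l<L. det_fun k (\<lambda>q. Z (l, q)))"

text \<open>The Levi-Civita symbol. As a determinant it needs no case distinction: a repeated letter
  gives equal rows and a letter outside \<open>{..<k}\<close> gives a zero row.\<close>

definition eps :: "nat \<Rightarrow> (nat \<Rightarrow> nat) \<Rightarrow> complex" where
  "eps k f = det_fun k (\<lambda>q j. if f q = j then 1 else 0)"

definition eps_prod :: "nat \<Rightarrow> nat \<Rightarrow> (nat \<times> nat \<Rightarrow> nat) \<Rightarrow> complex" where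
  "eps_prod L k w = (\<Prod>l<L. eps k (\<lambda>q. w (l, q)))"

definition perm_families :: "nat \<Rightarrow> nat \<Rightarrow> (nat \<Rightarrow> nat \<Rightarrow> nat) set" where
  "perm_families L k = {..<L} \<rightarrow>\<^sub>E {\<sigma>. \<sigma> permutes {0..<k}}"

definition sign_prod :: "nat \<Rightarrow> (nat \<Rightarrow> nat \<Rightarrow> nat) \<Rightarrow> 'a::comm_ring_1" where
  "sign_prod L s = (\<Prod>l<L. of_int (sign (s l)))"

lemma finite_perm_families [simp]: "finite (perm_families L k)"
  unfolding perm_families_def by (intro finite_PiE) (auto simp: finite_permutations)

lemma perm_families_less:
  assumes "s \<in> perm_families L k" "b \<in> boxes L k"
  shows "s (fst b) (snd b) < k"
proof -
  have "fst b < L" "snd b < k" using assms(2) by (auto simp: boxes_eq)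
  moreover have "s (fst b) permutes {0..<k}"
    using assms(1) \<open>fst b < L\<close> unfolding perm_families_def by blast
  ultimately show ?thesis using permutes_in_image[of "s (fst b)" "{0..<k}" "snd b"] by simp
qed

lemma det_fun_expand:
  "det_fun k F = (\<Sum>\<sigma> | \<sigma> permutes {0..<k}. of_int (sign \<sigma>) * (\<Prod>i<k. F i (\<sigma> i)))"
proof -
  have "(\<Prod>i = 0..<k. mat k k (\<lambda>(i, j). F i j) $$ (i, \<sigma> i)) = (\<Prod>i<k. F i (\<sigma> i))"
    if \<sigma>: "\<sigma> permutes {0..<k}" for \<sigma>
  proof (rule prod.cong)
    fix i assume "i \<in> {..<k}"
    moreover from this have "\<sigma> i < k" using permutes_in_image[OF \<sigma>, of i] by simp
    ultimately show "mat k k (\<lambda>(i, j). F i j) $$ (i, \<sigma> i) = F i (\<sigma> i)" by simp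
  qed auto
  then show ?thesis
    unfolding det_fun_def by (subst det_def'[of _ k]) (auto intro!: sum.cong)
qed

lemma det_prod_expand:
  "det_prod L k Z = (\<Sum>s\<in>perm_families L k. sign_prod L s * (\<Prod>b\<in>boxes L k. Z b (s (fst b) (snd b))))"
proof -
  have "det_prod L k Z = (\<Sum>s\<in>perm_families L k. \<Prod>l<L. of_int (sign (s l)) * (\<Prod>q<k. Z (l, q) (s l q)))"
    unfolding det_prod_def det_fun_expand perm_families_def
    by (rule prod_sum_PiE) (auto simp: finite_permutations)
  also have "\<dots> = (\<Sum>s\<in>perm_families L k. sign_prod L s * (\<Prod>b\<in>boxes L k. Z b (s (fst b) (snd b))))"
    unfolding prod.distrib sign_prod_def boxes_eq
    by (simp add: prod.cartesian_product case_prod_beta)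
  finally show ?thesis .
qed

lemma eps_prod_eq_det_prod: "eps_prod L k w = det_prod L k (\<lambda>b j. if w b = j then 1 else 0)"
  by (simp add: eps_prod_def eps_def det_prod_def)

lemma det_prod_cong:
  assumes "\<And>b j. b \<in> boxes L k \<Longrightarrow> j < k \<Longrightarrow> Z b j = Z' b j"
  shows "det_prod L k Z = det_prod L k Z'"
  unfolding det_prod_expand
  by (intro sum.cong prod.cong arg_cong2[where f = "(*)"] refl) (auto intro!: assms perm_families_less)

lemma eps_prod_cong:
  assumes "\<And>b. b \<in> boxes L k \<Longrightarrow> w b = w' b"
  shows "eps_prod L k w = eps_prod L k w'"
  unfolding eps_prod_eq_det_prod by (intro det_prod_cong) (simp add: assms)

lemma det_prod_eq_sum_eps_prod:
  assumes \<tau>: "bij_betw \<tau> (boxes L k) P" and P: "finite P" and kn: "k \<le> n"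
  shows "det_prod L k (\<lambda>b. Y (\<tau> b))
       = (\<Sum>w\<in>P \<rightarrow>\<^sub>E {..<n}. (\<Prod>x\<in>P. Y x (w x)) * eps_prod L k (\<lambda>b. w (\<tau> b)))"
proof -
  \<comment> \<open>The matrix column that the family \<open>s\<close> selects for the row
    \<open>x\<close>, read off at the box which \<tau> sends to \<open>x\<close>.\<close>
  define c where "c s x = (let b = inv_into (boxes L k) \<tau> x in s (fst b) (snd b))" for s :: "nat \<Rightarrow> nat \<Rightarrow> nat" and x
  have c\<tau>: "c s (\<tau> b) = s (fst b) (snd b)" if "b \<in> boxes L k" for s b
    using that \<tau> by (simp add: c_def bij_betw_inv_into_left)
  have cn: "c s x < n" if s: "s \<in> perm_families L k" and x: "x \<in> P" for s x
  proof -
    obtain b where "b \<in> boxes L k" "x = \<tau> b" using x \<tau> unfolding bij_betw_def by blast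
    then show ?thesis using c\<tau> perm_families_less[OF s] kn by fastforce
  qed
  have re: "(\<Prod>b\<in>boxes L k. F (\<tau> b) (s (fst b) (snd b))) = (\<Prod>x\<in>P. F x (c s x))"
    for F :: "_ \<Rightarrow> nat \<Rightarrow> complex" and s
    by (subst prod.reindex_bij_betw[OF \<tau>, symmetric]) (simp add: c\<tau>)
  have "(\<Sum>w\<in>P \<rightarrow>\<^sub>E {..<n}. (\<Prod>x\<in>P. Y x (w x)) * eps_prod L k (\<lambda>b. w (\<tau> b)))
      = (\<Sum>w\<in>P \<rightarrow>\<^sub>E {..<n}. \<Sum>s\<in>perm_families L k. sign_prod L s * (\<Prod>x\<in>P. Y x (w x) * (if w x = c s x then 1 else 0)))"
    unfolding eps_prod_eq_det_prod det_prod_expand sum_distrib_left prod.distrib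
    by (intro sum.cong refl) (subst re[of "\<lambda>x j. if _ x = j then 1 else 0"], simp add: mult_ac)
  also have "\<dots> = (\<Sum>s\<in>perm_families L k. sign_prod L s * (\<Sum>w\<in>P \<rightarrow>\<^sub>E {..<n}. \<Prod>x\<in>P. Y x (w x) * (if w x = c s x then 1 else 0)))"
    unfolding sum_distrib_left by (rule sum.swap)
  also have "\<dots> = (\<Sum>s\<in>perm_families L k. sign_prod L s * (\<Prod>x\<in>P. \<Sum>j<n. Y x j * (if j = c s x then 1 else 0)))"
    by (subst prod_sum_PiE) (use P in auto)
  also have "\<dots> = (\<Sum>s\<in>perm_families L k. sign_prod L s * (\<Prod>x\<in>P. Y x (c s x)))"
    by (intro sum.cong refl arg_cong2[where f = "(*)"] prod.cong)
       (use cn in \<open>simp_all add: if_distrib cong: if_cong\<close>)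
  also have "\<dots> = det_prod L k (\<lambda>b. Y (\<tau> b))"
    unfolding det_prod_expand by (simp add: re)
  finally show ?thesis ..
qed

lemma det_fun_permute:
  assumes "p permutes {..<k}"
  shows "det_fun k (\<lambda>q. F (p q)) = of_int (sign p) * det_fun k F"
proof -
  have p: "p permutes {0..<k}" using assms by (simp add: atLeast0LessThan)
  have "mat k k (\<lambda>(i, j). F (p i) j) = mat k k (\<lambda>(i, j). mat k k (\<lambda>(i, j). F i j) $$ (p i, j))"
    using permutes_in_image[OF p] by (intro eq_matI) auto
  then show ?thesis
    unfolding det_fun_def using det_permute_rows[OF _ p, of "mat k k (\<lambda>(i, j). F i j)"] by simp
qed

lemma eps_permutation:
  assumes p: "p permutes {..<k}" and f: "\<And>q. q < k \<Longrightarrow> f q = p q"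
  shows "eps k f = of_int (sign p)"
proof -
  have "eps k f = (\<Sum>\<sigma>\<in>{p}. of_int (sign \<sigma>) * (\<Prod>i<k. if f i = \<sigma> i then 1 else 0))"
    unfolding eps_def det_fun_expand
  proof (intro sum.mono_neutral_right ballI)
    fix \<sigma> assume \<sigma>: "\<sigma> \<in> {\<sigma>. \<sigma> permutes {0..<k}} - {p}"
    then have "\<exists>i<k. f i \<noteq> \<sigma> i"
      using p f by (intro ccontr[of "\<exists>i<k. f i \<noteq> \<sigma> i"])
        (auto simp: atLeast0LessThan permutes_def fun_eq_iff, metis)
    then show "of_int (sign \<sigma>) * (\<Prod>i<k. if f i = \<sigma> i then 1 else 0) = (0::complex)"
      by (auto intro!: prod_zero)
  qed (use p in \<open>auto simp: finite_permutations atLeast0LessThan\<close>)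
  then show ?thesis using f by simp
qed

lemma eps_not_inj:
  assumes "\<not> inj_on f {..<k}"
  shows "eps k f = 0"
  unfolding eps_def det_fun_expand
proof (intro sum.neutral ballI)
  fix \<sigma> assume \<sigma>: "\<sigma> \<in> {\<sigma>. \<sigma> permutes {0..<k}}"
  have "\<exists>i<k. f i \<noteq> \<sigma> i"
  proof (rule ccontr)
    assume "\<not> (\<exists>i<k. f i \<noteq> \<sigma> i)"
    then have "inj_on f {..<k} \<longleftrightarrow> inj_on \<sigma> {..<k}" by (intro inj_on_cong) auto
    then show False using assms \<sigma> by (auto dest: permutes_inj_on)
  qed
  then show "of_int (sign \<sigma>) * (\<Prod>i<k. if f i = \<sigma> i then 1 else 0) = (0::complex)"
    by (auto intro!: prod_zero)
qed

lemma mset_eq_iff_permute_list: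
  "mset I = mset I' \<longleftrightarrow> (\<exists>p. p permutes {..<length I'} \<and> permute_list p I' = I)"
  by (metis mset_eq_permutation mset_permute_list)

section \<open>Coordinates of products of symmetric or alternating tensors\<close>

lemma tensor_product_induct:
  assumes "T \<in> tensor_product Vs" "cfun.subspace {T. P T}"
    and "\<And>fs. length fs = length Vs \<Longrightarrow> (\<And>a. a < length Vs \<Longrightarrow> fs ! a \<in> Vs ! a) \<Longrightarrow> P (pure_tensor fs)"
  shows "P T"
  using assms(1) unfolding tensor_product_def
  by (rule cfun.span_induct) (use assms in \<open>auto simp: listset_iff\<close>)

lemma pure_tensor_eq: "length J = length fs \<Longrightarrow> pure_tensor fs J = (\<Prod>a<length fs. (fs ! a) (J ! a))"
  by (simp add: pure_tensor_def)

lemma tensor_product_outside: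
  assumes T: "T \<in> tensor_product (map V ks)"
    and V: "\<And>k f I. k \<in> set ks \<Longrightarrow> f \<in> V k \<Longrightarrow> I \<notin> multi_index d k \<Longrightarrow> f I = 0"
    and J: "J \<notin> multi_indices d ks"
  shows "T J = 0"
  using T
proof (rule tensor_product_induct)
  show "cfun.subspace {T. T J = 0}" by (auto simp: cfun.subspace_def)
  fix fs assume fs: "length fs = length (map V ks)" "\<And>a. a < length (map V ks) \<Longrightarrow> fs ! a \<in> map V ks ! a"
  show "pure_tensor fs J = 0"
  proof (cases "length J = length ks")
    case True
    then obtain a where a: "a < length ks" "J ! a \<notin> multi_index d (ks ! a)"
      using J by (auto simp: listset_iff)
    then have "(fs ! a) (J ! a) = 0" using fs(2)[of a] by (intro V[of "ks ! a"]) auto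
    then show ?thesis using a fs(1) True by (auto simp: pure_tensor_eq intro!: prod_zero)
  qed (use fs in \<open>simp add: pure_tensor_def\<close>)
qed

lemma sym_power_mset:
  assumes f: "f \<in> sym_power d k" and I: "I \<in> multi_index d k" and eq: "mset I' = mset I"
  shows "f I' = f I"
proof -
  obtain p where "p permutes {..<length I}" "permute_list p I = I'"
    using eq mset_eq_iff_permute_list by metis
  moreover have "length I = k" using I by (simp add: multi_index_iff)
  ultimately show ?thesis using f I by (auto simp: sym_power_def)
qed

text \<open>Forwards, rearranging a block does not change any product of symmetric tensors.
  Backwards, the indicator function of a multiset is a symmetric tensor, and a function that depends
  only on the multisets of the blocks is a combination of products of such indicators.\<close>

lemma tensor_product_sym_iff:
  "T \<in> tensor_product (map (sym_power d) ks) \<longleftrightarrow>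
     (\<forall>J. J \<notin> multi_indices d ks \<longrightarrow> T J = 0) \<and>
     (\<forall>J\<in>multi_indices d ks. \<forall>J'\<in>multi_indices d ks. map mset J = map mset J' \<longrightarrow> T J = T J')"
    (is "_ \<longleftrightarrow> ?R")
proof
  assume T: "T \<in> tensor_product (map (sym_power d) ks)"
  have "T J = T J'" if J: "J \<in> multi_indices d ks" "J' \<in> multi_indices d ks" "map mset J = map mset J'" for J J'
    using T
  proof (rule tensor_product_induct)
    show "cfun.subspace {T. T J = T J'}" by (auto simp: cfun.subspace_def)
    fix fs assume fs: "length fs = length (map (sym_power d) ks)"
      "\<And>a. a < length (map (sym_power d) ks) \<Longrightarrow> fs ! a \<in> map (sym_power d) ks ! a"
    have "(fs ! a) (J ! a) = (fs ! a) (J' ! a)" if a: "a < length ks" for a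
    proof (rule sym_power_mset)
      show "fs ! a \<in> sym_power d (ks ! a)" using fs(2)[of a] a by simp
      show "J' ! a \<in> multi_index d (ks ! a)" using J(2) a by (simp add: listset_iff)
      show "mset (J ! a) = mset (J' ! a)"
      proof -
        have "length J = length ks" "length J' = length ks" using J by (auto simp: listset_iff)
        then show ?thesis using J(3) a by (metis nth_map)
      qed
    qed
    then show "pure_tensor fs J = pure_tensor fs J'"
      using J fs(1) by (simp add: pure_tensor_eq listset_iff)
  qed
  moreover have "T J = 0" if "J \<notin> multi_indices d ks" for J
    by (rule tensor_product_outside[OF T _ that]) (auto simp: sym_power_def)
  ultimately show ?R by blast
next
  assume R: ?R
  define f where "f k M I = (if I \<in> multi_index d k \<and> mset I = M then 1 else 0 :: complex)" for k M I
  define pt where "pt Ms = pure_tensor (map2 f ks Ms)" for Ms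
  define rep where "rep Ms = (SOME J. J \<in> multi_indices d ks \<and> map mset J = Ms)" for Ms
  define MS where "MS = map mset ` multi_indices d ks"
  have rep: "rep (map mset J) \<in> multi_indices d ks \<and> map mset (rep (map mset J)) = map mset J"
    if "J \<in> multi_indices d ks" for J
    unfolding rep_def by (rule someI[of _ J]) (use that in simp)
  have len: "length Ms = length ks" if "Ms \<in> MS" for Ms
    using that by (auto simp: MS_def listset_iff)
  have "T = (\<Sum>Ms\<in>MS. (\<lambda>J. T (rep Ms) * pt Ms J))"
  proof
    fix J
    show "T J = (\<Sum>Ms\<in>MS. (\<lambda>J. T (rep Ms) * pt Ms J)) J"
    proof (cases "J \<in> multi_indices d ks")
      case True
      have "pt Ms J = (if Ms = map mset J then 1 else 0)" if Ms: "Ms \<in> MS" for Ms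
      proof -
        have "pt Ms J = (\<Prod>a<length ks. if mset (J ! a) = Ms ! a then 1 else 0)"
          using True len[OF that] unfolding pt_def
          by (subst pure_tensor_eq) (auto simp: listset_iff f_def intro!: prod.cong)
        also have "\<dots> = (if Ms = map mset J then 1 else 0)"
        proof (cases "Ms = map mset J")
          case False
          then obtain a where "a < length ks" "mset (J ! a) \<noteq> Ms ! a"
            using len[OF Ms] True by (metis (no_types, lifting) length_map listset_iff nth_equalityI nth_map)
          then show ?thesis using False by (auto intro!: prod_zero)
        qed (use True in \<open>auto simp: listset_iff intro!: prod.neutral\<close>)
        finally show ?thesis .
      qed
      then have "(\<Sum>Ms\<in>MS. (\<lambda>J. T (rep Ms) * pt Ms J)) J = (\<Sum>Ms\<in>MS. if Ms = map mset J then T (rep Ms) else 0)"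
        unfolding sum_apply by (intro sum.cong) auto
      also have "\<dots> = T (rep (map mset J))" using True by (simp add: MS_def)
      also have "\<dots> = T J" using R rep[OF True] True by blast
      finally show ?thesis by simp
    next
      case False
      have "pt Ms J = 0" if "Ms \<in> MS" for Ms
      proof (cases "length J = length ks")
        case True
        then obtain a where "a < length ks" "J ! a \<notin> multi_index d (ks ! a)"
          using False by (auto simp: listset_iff)
        then show ?thesis
          using len[OF that] True unfolding pt_def
          by (subst pure_tensor_eq) (auto simp: f_def intro!: prod_zero bexI[of _ a])
      qed (use len[OF that] in \<open>simp add: pt_def pure_tensor_def\<close>)
      then show ?thesis using False R by (simp add: sum_apply)
    qed
  qed
  also have "\<dots> \<in> tensor_product (map (sym_power d) ks)"
    unfolding tensor_product_def
  proof (intro cfun.span_sum cfun.span_scale cfun.span_base)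
    fix Ms assume Ms: "Ms \<in> MS"
    have "f k M \<in> sym_power d k" for k M
    proof -
      have "permute_list p I \<in> multi_index d k" if "I \<in> multi_index d k" "p permutes {..<k}" for I p
        using that permutes_in_image[OF that(2)] by (auto simp: multi_index_iff permute_list_nth)
      then show ?thesis
        by (auto simp: sym_power_def f_def multi_index_iff)
    qed
    then show "pt Ms \<in> pure_tensor ` listset (map (sym_power d) ks)"
      unfolding pt_def using len[OF Ms] by (intro imageI) (auto simp: listset_iff)
  qed
  finally show "T \<in> tensor_product (map (sym_power d) ks)" .
qed

lemma ext_power_repeated:
  assumes f: "f \<in> ext_power d k" and I: "I \<in> multi_index d k"
    and q: "q < k" "q' < k" "q \<noteq> q'" "I ! q = I ! q'"
  shows "f I = 0"
proof -
  define p where "p = Transposition.transpose q q'"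
  have p: "p permutes {..<k}" unfolding p_def using q by (intro permutes_swap_id) auto
  have "permute_list p I = I"
    using I q p by (intro nth_equalityI) (auto simp: multi_index_iff permute_list_nth p_def transpose_def)
  moreover have "f (permute_list p I) = of_int (sign p) * f I"
    using f I p by (auto simp: ext_power_def)
  moreover have "sign p = - 1" using q by (simp add: p_def sign_swap_id)
  ultimately show ?thesis by simp
qed

text \<open>An injective word in the letters \<open>< k\<close> is a permutation of
  \<open>[0..<k]\<close>; on all other such words both sides vanish.\<close>

lemma ext_power_eq_eps:
  assumes f: "f \<in> ext_power d k" and I: "I \<in> multi_index d k" and small: "\<And>q. q < k \<Longrightarrow> I ! q < k"
    and kd: "k \<le> d"
  shows "f I = eps k ((!) I) * f [0..<k]"
proof (cases "inj_on ((!) I) {..<k}")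
  case True
  define p where "p q = (if q < k then I ! q else q)" for q
  have "bij_betw ((!) I) {..<k} {..<k}"
    using True small endo_inj_surj[of "{..<k}" "(!) I"] by (auto simp: bij_betw_def)
  then have p: "p permutes {..<k}"
    using bij_betw_cong[of "{..<k}" p "(!) I"] by (intro bij_imp_permutes) (auto simp: p_def)
  have "permute_list p [0..<k] = I"
    using I p small by (intro nth_equalityI) (auto simp: multi_index_iff permute_list_nth p_def)
  moreover have "[0..<k] \<in> multi_index d k" using kd by (auto simp: multi_index_iff)
  ultimately have "f I = of_int (sign p) * f [0..<k]" using f p by (auto simp: ext_power_def)
  moreover have "eps k ((!) I) = of_int (sign p)" by (rule eps_permutation[OF p]) (simp add: p_def)
  ultimately show ?thesis by simp
next
  case False
  then have "f I = 0" using ext_power_repeated[OF f I] by (auto simp: inj_on_def)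
  then show ?thesis using eps_not_inj[OF False] by simp
qed

lemma tensor_product_ext_outside:
  assumes "u \<in> tensor_product (replicate L (ext_power d k))" "J \<notin> multi_indices d (replicate L k)"
  shows "u J = 0"
proof (rule tensor_product_outside[where V = "ext_power d" and ks = "replicate L k" and d = d])
  show "u \<in> tensor_product (map (ext_power d) (replicate L k))" using assms(1) by simp
  show "J \<notin> multi_indices d (replicate L k)" by (rule assms(2))
qed (auto simp: ext_power_def)

lemma tensor_product_ext_repeated:
  assumes u: "u \<in> tensor_product (replicate L (ext_power d k))" and w: "w \<in> words d (replicate L k)"
    and l: "l < L" and q: "q < k" "q' < k" "q \<noteq> q'" "w (l, q) = w (l, q')"
  shows "u (blocks (replicate L k) w) = 0"
  using u
proof (rule tensor_product_induct)
  let ?J = "blocks (replicate L k) w"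
  show "cfun.subspace {T. T ?J = 0}" by (auto simp: cfun.subspace_def)
  fix fs assume fs: "length fs = length (replicate L (ext_power d k))"
    "\<And>a. a < length (replicate L (ext_power d k)) \<Longrightarrow> fs ! a \<in> replicate L (ext_power d k) ! a"
  have "(fs ! l) (?J ! l) = 0"
  proof (rule ext_power_repeated[OF _ _ q(1-3)])
    show "fs ! l \<in> ext_power d k" using fs(2)[of l] l by simp
    show "?J ! l \<in> multi_index d k" using blocks_words[OF w] l by (auto simp: listset_iff)
    show "?J ! l ! q = ?J ! l ! q'" using l q by (simp add: blocks_nth)
  qed
  then show "pure_tensor fs ?J = 0" using fs(1) l by (auto simp: pure_tensor_eq intro!: prod_zero)
qed

text \<open>Among words in the first \<open>k\<close> letters there is only one free coordinate, the
  one at \<open>snd\<close>. In that word the box \<open>(l, q)\<close> carries the letter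
  \<open>q\<close>, so it belongs to the first \<open>k\<close> basis vectors wedged together in
  every factor.\<close>

lemma tensor_product_ext_eps:
  assumes u: "u \<in> tensor_product (replicate L (ext_power d k))" and w: "w \<in> words d (replicate L k)"
    and small: "\<And>b. b \<in> boxes L k \<Longrightarrow> w b < k" and kd: "k \<le> d"
  shows "u (blocks (replicate L k) w) = eps_prod L k w * u (blocks (replicate L k) snd)"
proof -
  let ?J = "blocks (replicate L k) w" and ?E = "blocks (replicate L k) snd"
  have sub: "cfun.subspace {T. T ?J = eps_prod L k w * T ?E}"
    by (auto simp: cfun.subspace_def algebra_simps)
  have pure: "pure_tensor fs ?J = eps_prod L k w * pure_tensor fs ?E"
    if fs: "length fs = L" "\<And>a. a < L \<Longrightarrow> fs ! a \<in> ext_power d k" for fs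
  proof -
  have "(fs ! l) (?J ! l) = eps k (\<lambda>q. w (l, q)) * (fs ! l) (?E ! l)" if l: "l < L" for l
  proof -
    have "(fs ! l) (?J ! l) = eps k ((!) (?J ! l)) * (fs ! l) [0..<k]"
    proof (rule ext_power_eq_eps[OF _ _ _ kd])
      show "fs ! l \<in> ext_power d k" using fs(2)[of l] l .
      show "?J ! l \<in> multi_index d k" using blocks_words[OF w] l by (auto simp: listset_iff)
      show "?J ! l ! q < k" if "q < k" for q using l that small[of "(l, q)"] by (simp add: blocks_nth)
    qed
    moreover have "eps k ((!) (?J ! l)) = eps k (\<lambda>q. w (l, q))"
      using permutes_in_image unfolding eps_def det_fun_expand
      by (intro sum.cong prod.cong arg_cong2[where f = "(*)"] refl) (simp add: blocks_nth l)
    moreover have "?E ! l = [0..<k]" using l by (intro nth_equalityI) (auto simp: blocks_nth)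
    ultimately show ?thesis by simp
  qed
    then show ?thesis using fs(1) by (simp add: pure_tensor_eq eps_prod_def prod.distrib)
  qed
  have "tensor_product (replicate L (ext_power d k)) \<subseteq> {T. T ?J = eps_prod L k w * T ?E}"
    unfolding tensor_product_def
    by (rule cfun.span_minimal[OF _ sub]) (auto simp: listset_iff intro!: pure)
  then show ?thesis using u by blast
qed

section \<open>Tensors on which the unitary group acts by a power of the determinant\<close>

text \<open>\<open>I\<close> fills the boxes with numbers of tensor factors. A member \<tau> hands
  out the individual slots of these factors, one to each box.\<close>

definition box_bijections :: "nat \<Rightarrow> nat \<Rightarrow> nat list \<Rightarrow> (nat \<times> nat \<Rightarrow> nat) \<Rightarrow> (nat \<times> nat \<Rightarrow> nat \<times> nat) set" where
  "box_bijections L k rs I = {\<tau> \<in> boxes L k \<rightarrow>\<^sub>E positions rs.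
     bij_betw \<tau> (boxes L k) (positions rs) \<and> (\<forall>b\<in>boxes L k. fst (\<tau> b) = I b)}"

text \<open>The polarization of the product of brackets prescribed by the filling \<open>I\<close>:
  summing over all distributions of slots makes it symmetric within each factor.\<close>

definition bracket_tensor :: "nat \<Rightarrow> nat \<Rightarrow> nat list \<Rightarrow> (nat \<times> nat \<Rightarrow> nat) \<Rightarrow> nat list list \<Rightarrow> complex" where
  "bracket_tensor L k rs I J = (if J \<in> multi_indices k rs
     then \<Sum>\<tau>\<in>box_bijections L k rs I. eps_prod L k (\<lambda>b. J ! fst (\<tau> b) ! snd (\<tau> b)) else 0)"

lemma finite_box_bijections [simp]: "finite (box_bijections L k rs I)"
  by (rule finite_subset[of _ "boxes L k \<rightarrow>\<^sub>E positions rs"]) (auto simp: box_bijections_def intro!: finite_PiE)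

lemma bracket_tensor_blocks:
  assumes "w \<in> words k rs"
  shows "bracket_tensor L k rs I (blocks rs w) = (\<Sum>\<tau>\<in>box_bijections L k rs I. eps_prod L k (\<lambda>b. w (\<tau> b)))"
proof -
  have "blocks rs w ! fst (\<tau> b) ! snd (\<tau> b) = w (\<tau> b)"
    if "\<tau> \<in> box_bijections L k rs I" "b \<in> boxes L k" for \<tau> b
  proof -
    have "\<tau> b \<in> positions rs" using that by (auto simp: box_bijections_def)
    then show ?thesis by (cases "\<tau> b") (simp add: blocks_nth)
  qed
  then show ?thesis
    using blocks_words[OF assms] by (auto simp: bracket_tensor_def intro!: sum.cong eps_prod_cong)
qed

text \<open>Permuting the slots within the factors permutes the bijections \<tau> and hence only
  reorders the sum.\<close>

lemma bracket_tensor_sym: "bracket_tensor L k rs I \<in> tensor_product (map (sym_power k) rs)"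
  unfolding tensor_product_sym_iff
proof (intro conjI allI impI ballI)
  fix J J' assume J: "J \<in> multi_indices k rs" "J' \<in> multi_indices k rs" and eq: "map mset J = map mset J'"
  have len: "length J = length rs" "length J' = length rs" using J by (auto simp: listset_iff)
  have "\<exists>p. p permutes {..<rs ! a} \<and> permute_list p (J ! a) = J' ! a" if a: "a < length rs" for a
  proof -
    have "mset (J' ! a) = mset (J ! a)" using eq len a by (metis nth_map)
    moreover have "length (J ! a) = rs ! a" using J a by (auto simp: listset_iff multi_index_iff)
    ultimately show ?thesis unfolding mset_eq_iff_permute_list by metis
  qed
  then obtain p where p: "\<And>a. a < length rs \<Longrightarrow> p a permutes {..<rs ! a}"
    "\<And>a. a < length rs \<Longrightarrow> permute_list (p a) (J ! a) = J' ! a" by metis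
  define \<pi> where "\<pi> x = (fst x, p (fst x) (snd x))" for x :: "nat \<times> nat"
  have pin: "p a y < rs ! a \<longleftrightarrow> y < rs ! a" if "a < length rs" for a y
    using permutes_in_image[OF p(1)[OF that], of y] by simp
  have \<pi>: "bij_betw \<pi> (positions rs) (positions rs)"
    unfolding bij_betw_def
  proof (intro conjI inj_onI)
    fix x y assume "x \<in> positions rs" "y \<in> positions rs" "\<pi> x = \<pi> y"
    then show "x = y" using permutes_inj[OF p(1)]
      by (cases x; cases y) (auto simp: \<pi>_def inj_def)
  next
    show "\<pi> ` positions rs = positions rs"
    proof (intro equalityI subsetI)
      fix y assume y: "y \<in> positions rs"
      then have a: "fst y < length rs" by (cases y) auto
      then obtain z where z: "p (fst y) z = snd y" using permutes_surj[OF p(1)] by (metis surjD)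
      then have "(fst y, z) \<in> positions rs" using y a pin[OF a, of z] by (cases y) auto
      moreover have "\<pi> (fst y, z) = y" using z by (simp add: \<pi>_def)
      ultimately show "y \<in> \<pi> ` positions rs" by (metis imageI)
    qed (auto simp: \<pi>_def pin)
  qed
  have J': "J' ! fst x ! snd x = J ! fst (\<pi> x) ! snd (\<pi> x)" if xP: "x \<in> positions rs" for x
  proof -
    obtain a y where x: "x = (a, y)" "a < length rs" "y < rs ! a" using xP by (cases x) auto
    have "length (J ! a) = rs ! a" using J x by (auto simp: listset_iff multi_index_iff)
    then show ?thesis using x p(2)[OF x(2)] p(1)[OF x(2)] by (metis \<pi>_def fst_conv snd_conv permute_list_nth)
  qed
  have \<tau>\<pi>: "restrict (\<lambda>b. \<phi> (\<tau> b)) (boxes L k) \<in> box_bijections L k rs I"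
    if \<tau>: "\<tau> \<in> box_bijections L k rs I" and \<phi>: "bij_betw \<phi> (positions rs) (positions rs)" "\<And>x. x \<in> positions rs \<Longrightarrow> fst (\<phi> x) = fst x" for \<tau> \<phi>
  proof -
    have t: "bij_betw \<tau> (boxes L k) (positions rs)" using \<tau> by (simp add: box_bijections_def)
    have b: "bij_betw (restrict (\<lambda>b. \<phi> (\<tau> b)) (boxes L k)) (boxes L k) (positions rs)"
      using bij_betw_trans[OF t \<phi>(1)] by (subst bij_betw_cong[where g = "\<phi> \<circ> \<tau>"]) auto
    have in1: "\<tau> b \<in> positions rs" if "b \<in> boxes L k" for b using bij_betwE[OF t] that by blast
    have in2: "\<phi> x \<in> positions rs" if "x \<in> positions rs" for x using bij_betwE[OF \<phi>(1)] that by blast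
    show ?thesis using \<tau> b in1 in2 \<phi>(2) unfolding box_bijections_def by simp
  qed
  define \<psi> where "\<psi> = inv_into (positions rs) \<pi>"
  have \<psi>: "bij_betw \<psi> (positions rs) (positions rs)" unfolding \<psi>_def by (rule bij_betw_inv_into[OF \<pi>])
  have \<psi>\<pi>: "\<psi> (\<pi> x) = x" "\<pi> (\<psi> x) = x" if "x \<in> positions rs" for x
    using that \<pi> by (auto simp: \<psi>_def bij_betw_inv_into_left bij_betw_inv_into_right)
  have f\<pi>: "fst (\<pi> x) = fst x" for x by (simp add: \<pi>_def)
  have f\<psi>: "fst (\<psi> x) = fst x" if "x \<in> positions rs" for x
    using f\<pi>[of "\<psi> x"] \<psi>\<pi>(2)[OF that] by simp
  have in\<tau>: "\<tau> b \<in> positions rs" if "\<tau> \<in> box_bijections L k rs I" "b \<in> boxes L k" for \<tau> b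
    using that by (auto simp: box_bijections_def)
  have ext: "restrict \<tau> (boxes L k) = \<tau>" if "\<tau> \<in> box_bijections L k rs I" for \<tau>
    using that by (auto simp: box_bijections_def)
  have "(\<Sum>\<tau>\<in>box_bijections L k rs I. eps_prod L k (\<lambda>b. J ! fst (\<tau> b) ! snd (\<tau> b)))
      = (\<Sum>\<tau>\<in>box_bijections L k rs I. eps_prod L k (\<lambda>b. J' ! fst (\<tau> b) ! snd (\<tau> b)))"
  proof (rule sum.reindex_bij_witness[where i = "\<lambda>\<tau>. restrict (\<lambda>b. \<pi> (\<tau> b)) (boxes L k)"
          and j = "\<lambda>\<tau>. restrict (\<lambda>b. \<psi> (\<tau> b)) (boxes L k)"])
    fix \<tau> assume \<tau>: "\<tau> \<in> box_bijections L k rs I"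
    show "restrict (\<lambda>b. \<psi> (\<tau> b)) (boxes L k) \<in> box_bijections L k rs I"
      by (rule \<tau>\<pi>[OF \<tau> \<psi> f\<psi>])
    show "restrict (\<lambda>b. \<pi> (\<tau> b)) (boxes L k) \<in> box_bijections L k rs I"
      by (rule \<tau>\<pi>[OF \<tau> \<pi> f\<pi>])
    have "restrict (\<lambda>b. \<pi> (restrict (\<lambda>b. \<psi> (\<tau> b)) (boxes L k) b)) (boxes L k) = restrict \<tau> (boxes L k)"
      using in\<tau>[OF \<tau>] \<psi>\<pi> by (intro restrict_ext) simp
    then show "restrict (\<lambda>b. \<pi> (restrict (\<lambda>b. \<psi> (\<tau> b)) (boxes L k) b)) (boxes L k) = \<tau>"
      using ext[OF \<tau>] by simp
    have "restrict (\<lambda>b. \<psi> (restrict (\<lambda>b. \<pi> (\<tau> b)) (boxes L k) b)) (boxes L k) = restrict \<tau> (boxes L k)"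
      using in\<tau>[OF \<tau>] \<psi>\<pi> by (intro restrict_ext) simp
    then show "restrict (\<lambda>b. \<psi> (restrict (\<lambda>b. \<pi> (\<tau> b)) (boxes L k) b)) (boxes L k) = \<tau>"
      using ext[OF \<tau>] by simp
    have "J' ! fst (\<psi> x) ! snd (\<psi> x) = J ! fst x ! snd x" if x: "x \<in> positions rs" for x
      using J'[of "\<psi> x"] \<psi>\<pi>(2)[OF x] bij_betwE[OF \<psi>] x by simp
    then show "eps_prod L k (\<lambda>b. J' ! fst (restrict (\<lambda>b. \<psi> (\<tau> b)) (boxes L k) b) ! snd (restrict (\<lambda>b. \<psi> (\<tau> b)) (boxes L k) b))
        = eps_prod L k (\<lambda>b. J ! fst (\<tau> b) ! snd (\<tau> b))"
      using in\<tau>[OF \<tau>] by (intro eps_prod_cong) simp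
  qed
  then show "bracket_tensor L k rs I J = bracket_tensor L k rs I J'"
    using J by (simp add: bracket_tensor_def)
qed (simp add: bracket_tensor_def)

lemma bracket_tensor_sum:
  "(\<Sum>w\<in>words k rs. (\<Prod>x\<in>positions rs. Y x (w x)) * bracket_tensor L k rs I (blocks rs w))
       = (\<Sum>\<tau>\<in>box_bijections L k rs I. det_prod L k (\<lambda>b. Y (\<tau> b)))"
proof -
  have "(\<Sum>w\<in>words k rs. (\<Prod>x\<in>positions rs. Y x (w x)) * bracket_tensor L k rs I (blocks rs w))
     = (\<Sum>w\<in>words k rs. \<Sum>\<tau>\<in>box_bijections L k rs I. (\<Prod>x\<in>positions rs. Y x (w x)) * eps_prod L k (\<lambda>b. w (\<tau> b)))"
    by (simp add: bracket_tensor_blocks sum_distrib_left)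
  also have "\<dots> = (\<Sum>\<tau>\<in>box_bijections L k rs I. \<Sum>w\<in>words k rs. (\<Prod>x\<in>positions rs. Y x (w x)) * eps_prod L k (\<lambda>b. w (\<tau> b)))"
    by (rule sum.swap)
  also have "\<dots> = (\<Sum>\<tau>\<in>box_bijections L k rs I. det_prod L k (\<lambda>b. Y (\<tau> b)))"
    by (intro sum.cong refl det_prod_eq_sum_eps_prod[symmetric]) (auto simp: box_bijections_def)
  finally show ?thesis .
qed

text \<open>Restitution, the inverse of polarization: with the same vector in all slots of a factor
  every bijection gives the same product of determinants. The factor is their number, nonzero
  whenever a bijection exists, so relations can be moved between tensors and polynomials.\<close>

lemma bracket_tensor_polynomial:
  "(\<Sum>w\<in>words k rs. (\<Prod>x\<in>positions rs. Y (fst x) (w x)) * bracket_tensor L k rs I (blocks rs w))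
    = of_nat (card (box_bijections L k rs I)) * det_prod L k (\<lambda>b. Y (I b))"
proof -
  have "det_prod L k (\<lambda>b. Y (fst (\<tau> b))) = det_prod L k (\<lambda>b. Y (I b))"
    if "\<tau> \<in> box_bijections L k rs I" for \<tau>
    using that by (intro det_prod_cong) (auto simp: box_bijections_def)
  then show ?thesis
    by (subst bracket_tensor_sum[where Y = "\<lambda>x. Y (fst x)"]) simp
qed

lemma det_prod_mult_mat:
  assumes X: "X \<in> carrier_mat k k"
  shows "det_prod L k (\<lambda>b j. \<Sum>i<k. Z b i * X $$ (i, j)) = det_prod L k Z * det X ^ L"
proof -
  have "det_fun k (\<lambda>q j. \<Sum>i<k. Z (l, q) i * X $$ (i, j)) = det_fun k (\<lambda>q. Z (l, q)) * det X" for l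
  proof -
    have "mat k k (\<lambda>(q, j). \<Sum>i<k. Z (l, q) i * X $$ (i, j)) = mat k k (\<lambda>(q, j). Z (l, q) j) * X"
      using X by (intro eq_matI) (auto simp: scalar_prod_def atLeast0LessThan)
    then show ?thesis unfolding det_fun_def using X by (simp add: det_mult[of _ k])
  qed
  then show ?thesis by (simp add: det_prod_def prod.distrib)
qed

lemma bracket_tensor_act:
  assumes X: "X \<in> carrier_mat k k"
  shows "tensor_act k rs X (bracket_tensor L k rs I) = (\<lambda>J. det X ^ L * bracket_tensor L k rs I J)"
proof (rule multi_indices_ext[where d = k and ks = rs])
  fix w assume w: "w \<in> words k rs"
  have "det_prod L k (\<lambda>b j. X $$ (w (\<tau> b), j)) = eps_prod L k (\<lambda>b. w (\<tau> b)) * det X ^ L"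
    if \<tau>: "\<tau> \<in> box_bijections L k rs I" for \<tau>
  proof -
    have "w (\<tau> b) < k" if "b \<in> boxes L k" for b
      using \<tau> that w by (intro words_D[OF w]) (auto simp: box_bijections_def)
    then have "det_prod L k (\<lambda>b j. X $$ (w (\<tau> b), j))
        = det_prod L k (\<lambda>b j. \<Sum>i<k. (if w (\<tau> b) = i then 1 else 0) * X $$ (i, j))"
      by (intro det_prod_cong) (simp add: if_distrib[of "\<lambda>x. x * _"] cong: if_cong)
    then show ?thesis by (simp add: det_prod_mult_mat[OF X] eps_prod_eq_det_prod)
  qed
  moreover have "tensor_act k rs X (bracket_tensor L k rs I) (blocks rs w)
      = (\<Sum>\<tau>\<in>box_bijections L k rs I. det_prod L k (\<lambda>b j. X $$ (w (\<tau> b), j)))"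
    unfolding tensor_act_blocks[OF w]
    by (rule bracket_tensor_sum[where Y = "\<lambda>x j. X $$ (w x, j)"])
  ultimately show "tensor_act k rs X (bracket_tensor L k rs I) (blocks rs w)
      = det X ^ L * bracket_tensor L k rs I (blocks rs w)"
    by (simp add: bracket_tensor_blocks[OF w] sum_distrib_left mult.commute)
qed (simp add: tensor_act_outside bracket_tensor_def)

lemma box_bijections_nonempty:
  assumes I: "\<And>b. b \<in> boxes L k \<Longrightarrow> I b < length rs"
    and cnt: "\<And>a. a < length rs \<Longrightarrow> letter_count (replicate L k) I a = rs ! a"
  shows "box_bijections L k rs I \<noteq> {}"
proof -
  have "\<exists>h. bij_betw h {b \<in> boxes L k. I b = a} {..<rs ! a}" if "a < length rs" for a
    using cnt[OF that] by (intro finite_same_card_bij) (auto simp: letter_count_def)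
  then obtain h where h: "\<And>a. a < length rs \<Longrightarrow> bij_betw (h a) {b \<in> boxes L k. I b = a} {..<rs ! a}"
    by metis
  define \<tau> where "\<tau> = restrict (\<lambda>b. (I b, h (I b) b)) (boxes L k)"
  have hin: "h (I b) b < rs ! I b" if "b \<in> boxes L k" for b
    using bij_betw_apply[OF h[OF I[OF that]], of b] that by simp
  have "bij_betw \<tau> (boxes L k) (positions rs)"
    unfolding bij_betw_def
  proof (intro conjI inj_onI equalityI subsetI)
    fix b b' assume b: "b \<in> boxes L k" "b' \<in> boxes L k" "\<tau> b = \<tau> b'"
    then have "I b = I b'" "h (I b) b = h (I b) b'" by (auto simp: \<tau>_def)
    show "b = b'"
      by (rule inj_onD[OF bij_betw_imp_inj_on[OF h[OF I[OF b(1)]]]])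
        (use b(1,2) \<open>I b = I b'\<close> \<open>h (I b) b = h (I b) b'\<close> in simp_all)
  next
    fix x assume "x \<in> \<tau> ` boxes L k"
    then show "x \<in> positions rs" using I hin by (auto simp: \<tau>_def)
  next
    fix x assume x: "x \<in> positions rs"
    then obtain a y where ay: "x = (a, y)" "a < length rs" "y < rs ! a" by (cases x) auto
    then have "y \<in> h a ` {b \<in> boxes L k. I b = a}" using h[OF ay(2)] by (simp add: bij_betw_def)
    then obtain b where b: "b \<in> boxes L k" "I b = a" "h a b = y" by blast
    then have "\<tau> b = x" using ay by (simp add: \<tau>_def)
    then show "x \<in> \<tau> ` boxes L k" using b by blast
  qed
  moreover have "\<tau> \<in> boxes L k \<rightarrow>\<^sub>E positions rs" using I hin by (auto simp: \<tau>_def)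
  ultimately have "\<tau> \<in> box_bijections L k rs I" by (simp add: box_bijections_def) (simp add: \<tau>_def)
  then show ?thesis by blast
qed

section \<open>The space of invariants and its infinitesimal relations\<close>

definition det_isotypic :: "nat \<Rightarrow> nat \<Rightarrow> nat list \<Rightarrow> (nat list list \<Rightarrow> complex) set" where
  "det_isotypic L k rs = {T \<in> tensor_product (map (sym_power k) rs).
     \<forall>g\<in>unitary_group k. tensor_act k rs g T = (\<lambda>J. det g ^ L * T J)}"

lemma subspace_det_isotypic: "cfun.subspace (det_isotypic L k rs)"
proof -
  have "cfun.subspace (tensor_product (map (sym_power k) rs))"
    unfolding tensor_product_def by (rule cfun.subspace_span)
  moreover have "tensor_act k rs g (T + T') = tensor_act k rs g T + tensor_act k rs g T'"
    "tensor_act k rs g (\<lambda>i. c * T i) = (\<lambda>i. c * tensor_act k rs g T i)" "tensor_act k rs g 0 = 0" for g T T' c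
    by (auto simp: fun_eq_iff tensor_act_def matrix_act_def algebra_simps sum.distrib sum_distrib_left)
  ultimately show ?thesis
    unfolding cfun.subspace_def det_isotypic_def by (auto simp: fun_eq_iff algebra_simps)
qed

text \<open>By \<open>N\<close> both sides are homogeneous of the same degree \<open>L * k\<close>
  in \<open>X\<close>, as the density statement demands.\<close>

lemma det_isotypic_all:
  assumes T: "T \<in> det_isotypic L k rs" and N: "card (positions rs) = L * k" and X: "X \<in> carrier_mat k k"
  shows "tensor_act k rs X T J = det X ^ L * T J"
proof -
  let ?p = "\<lambda>X. tensor_act k rs X T J - det X ^ L * T J"
  have "?p X = 0"
  proof (rule unitary_group_dense[OF _ _ _ X, where p = ?p])
    show "poly_fun (\<lambda>t. ?p (M t))" if "poly_curve k M" for M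
      by (intro poly_fun_diff poly_fun_mult poly_fun_power poly_fun_const poly_fun_tensor_act[OF that] poly_fun_det[OF that])
    show "?p (c \<cdot>\<^sub>m Y) = c ^ (L * k) * ?p Y" if "Y \<in> carrier_mat k k" for c Y
      using that N by (simp add: tensor_act_smult det_smult algebra_simps power_mult_distrib power_mult[symmetric] mult.commute[of k L])
    show "?p g = 0" if "g \<in> unitary_group k" for g
      using T that by (simp add: det_isotypic_def)
  qed
  then show ?thesis by simp
qed

lemma det_isotypic_letter_count:
  assumes T: "T \<in> det_isotypic L k rs" and N: "card (positions rs) = L * k"
    and w: "w \<in> words k rs" and nz: "T (blocks rs w) \<noteq> 0" and i: "i < k"
  shows "letter_count rs w i = L"
proof -
  \<comment> \<open>A diagonal matrix of determinant 2 with its single entry 2 in place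
    \<open>i\<close>; comparing powers of 2 reads off the count of the letter
    \<open>i\<close>.\<close>
  define X where "X = mat k k (\<lambda>(a, b). if a = b then if a = i then 2 else 1 else 0 :: complex)"
  have X: "X \<in> carrier_mat k k" "diagonal_mat X" by (auto simp: X_def diagonal_mat_def)
  have "det X = (\<Prod>j<k. if j = i then 2 else 1)"
  proof -
    have "upper_triangular X" by (auto simp: X_def upper_triangular_def)
    then have "det X = (\<Prod>j<k. X $$ (j, j))"
      using det_upper_triangular[OF _ X(1)] X(1) by (simp add: prod_list_diag_prod atLeast0LessThan)
    then show ?thesis by (simp add: X_def)
  qed
  also have "\<dots> = 2" using i by simp
  finally have "det X = 2" .
  have "(\<Prod>x\<in>positions rs. X $$ (w x, w x)) = (\<Prod>j<k. (X $$ (j, j)) ^ letter_count rs w j)"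
    by (rule prod_by_letter[OF w, where f = "\<lambda>j. X $$ (j, j)"])
  also have "\<dots> = (\<Prod>j\<in>{i}. 2 ^ letter_count rs w j)"
    using i by (intro prod.mono_neutral_cong_right) (auto simp: X_def split: if_splits)
  finally have "2 ^ letter_count rs w i * T (blocks rs w) = 2 ^ L * T (blocks rs w)"
    using det_isotypic_all[OF T N X(1), of "blocks rs w"] tensor_act_diagonal[OF X w, of T] \<open>det X = 2\<close> by simp
  then have "(2::complex) ^ letter_count rs w i = 2 ^ L" using nz by simp
  then have "complex_of_nat (2 ^ letter_count rs w i) = complex_of_nat (2 ^ L)" by simp
  then show ?thesis by (simp only: of_nat_eq_iff) simp
qed

text \<open>Infinitesimal invariance under the root vector of the letters \<open>i\<close> and
  \<open>Suc i\<close>: the shear \<open>addrow_mat\<close> has determinant 1, so the coordinate at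
  \<open>w\<close> is constant in \<open>t\<close>, and the sum is its linear coefficient.\<close>

lemma det_isotypic_raising:
  assumes T: "T \<in> det_isotypic L k rs" and N: "card (positions rs) = L * k"
    and w: "w \<in> words k rs" and i: "Suc i < k"
  shows "(\<Sum>x | x \<in> positions rs \<and> w x = i. T (blocks rs (w(x := Suc i)))) = 0"
proof -
  define c where "c x w' = [:if w x = w' x then 1 else 0, if w x = i \<and> w' x = Suc i then 1 else (0::complex):]" for x w'
  define P where "P = (\<Sum>w'\<in>words k rs. smult (T (blocks rs w')) (\<Prod>x\<in>positions rs. c x w'))"
  have "poly P t = T (blocks rs w)" for t
  proof -
    let ?X = "addrow_mat k t i (Suc i)"
    have "(\<Prod>x\<in>positions rs. ?X $$ (w x, w' x)) = (\<Prod>x\<in>positions rs. poly (c x w') t)" if "w' \<in> words k rs" for w'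
      using w that by (intro prod.cong refl) (auto simp: words_D c_def)
    then have "poly P t = tensor_act k rs ?X T (blocks rs w)"
      by (simp add: P_def poly_sum poly_prod tensor_act_blocks[OF w] mult.commute)
    also have "\<dots> = T (blocks rs w)"
      using det_isotypic_all[OF T N, of ?X] i by (simp add: det_addrow_mat)
    finally show ?thesis .
  qed
  then have "P = [:T (blocks rs w):]" by (intro poly_eq_poly_eq_iff[THEN iffD1] ext) simp
  \<comment> \<open>The product rule at 0 leaves only the words that differ from \<open>w\<close> in
    one slot, where \<open>i\<close> has become \<open>Suc i\<close>.\<close>
  then have "poly (pderiv P) 0 = 0" by simp
  moreover have "poly (pderiv P) 0 = (\<Sum>w'\<in>words k rs. T (blocks rs w') *
      (\<Sum>x\<in>positions rs. (\<Prod>y\<in>positions rs - {x}. if w y = w' y then 1 else 0) * (if w x = i \<and> w' x = Suc i then 1 else 0)))"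
    unfolding P_def pderiv_sum pderiv_smult pderiv_prod
    by (simp add: poly_sum poly_prod c_def pderiv_pCons) (simp add: mult.commute)
  moreover have "\<dots> = (\<Sum>x\<in>positions rs. \<Sum>w'\<in>words k rs. T (blocks rs w') *
      ((\<Prod>y\<in>positions rs - {x}. if w y = w' y then 1 else 0) * (if w x = i \<and> w' x = Suc i then 1 else 0)))"
    unfolding sum_distrib_left by (rule sum.swap)
  moreover have "(\<Sum>w'\<in>words k rs. T (blocks rs w') *
      ((\<Prod>y\<in>positions rs - {x}. if w y = w' y then 1 else 0) * (if w x = i \<and> w' x = Suc i then 1 else 0)))
      = (if w x = i then T (blocks rs (w(x := Suc i))) else 0)" if x: "x \<in> positions rs" for x
  proof (cases "w x = i")
    case True
    have w1: "w(x := Suc i) \<in> words k rs" using w x i by (auto simp: PiE_iff extensional_def)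
    have "(\<Prod>y\<in>positions rs - {x}. if w y = w' y then 1 else (0::complex)) * (if w x = i \<and> w' x = Suc i then 1 else 0)
        = (if w' = w(x := Suc i) then 1 else 0)" if w': "w' \<in> words k rs" for w'
    proof (cases "w' = w(x := Suc i)")
      case False
      then obtain y where y: "y \<in> positions rs" "w' y \<noteq> (w(x := Suc i)) y"
        using w1 w' by (metis PiE_ext)
      show ?thesis
      proof (cases "y = x")
        case False
        then have "(\<Prod>y\<in>positions rs - {x}. if w y = w' y then 1 else (0::complex)) = 0"
          using y by (intro prod_zero) (auto intro!: bexI[of _ y])
        then show ?thesis using \<open>w' \<noteq> _\<close> by simp
      qed (use y \<open>w' \<noteq> _\<close> in simp)
    qed (use True in \<open>auto intro!: prod.neutral\<close>)
    then have "(\<Sum>w'\<in>words k rs. T (blocks rs w') *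
      ((\<Prod>y\<in>positions rs - {x}. if w y = w' y then 1 else 0) * (if w x = i \<and> w' x = Suc i then 1 else 0)))
      = (\<Sum>w'\<in>words k rs. if w' = w(x := Suc i) then T (blocks rs w') else 0)"
      by (intro sum.cong) auto
    then show ?thesis using w1 True by simp
  qed simp
  ultimately have "(\<Sum>x\<in>positions rs. if w x = i then T (blocks rs (w(x := Suc i))) else 0) = 0"
    by simp
  then show ?thesis by (simp add: sum.inter_filter)
qed

section \<open>Standard words in the support of an invariant\<close>

definition letter_matrix :: "nat list \<Rightarrow> (nat \<times> nat \<Rightarrow> nat) \<Rightarrow> nat \<Rightarrow> nat \<Rightarrow> nat" where
  "letter_matrix rs w q a = card {x \<in> positions rs. w x = q \<and> fst x = a}"

lemma det_isotypic_letter_matrix: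
  assumes T: "T \<in> det_isotypic L k rs" and w: "w \<in> words k rs" "w' \<in> words k rs"
    and eq: "\<And>q a. q < k \<Longrightarrow> a < length rs \<Longrightarrow> letter_matrix rs w q a = letter_matrix rs w' q a"
  shows "T (blocks rs w) = T (blocks rs w')"
proof -
  have cnt: "count (mset (blocks rs v ! a)) q = letter_matrix rs v q a" if a: "a < length rs" for v a q
  proof -
    have "count (mset (blocks rs v ! a)) q = card {p. p < length (blocks rs v ! a) \<and> q = blocks rs v ! a ! p}"
      by (simp only: count_mset count_list_eq_length_filter length_filter_conv_card)
    also have "\<dots> = card {p. p < rs ! a \<and> v (a, p) = q}"
      using a by (intro arg_cong[where f = card]) (auto simp: blocks_nth)
    also have "\<dots> = letter_matrix rs v q a"
      unfolding letter_matrix_def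
      by (rule bij_betw_same_card[of "\<lambda>p. (a, p)"]) (use a in \<open>auto simp: bij_betw_def inj_on_def\<close>)
    finally show ?thesis .
  qed
  have zero: "letter_matrix rs v q a = 0" if "v \<in> words k rs" "\<not> q < k" for v q a
    unfolding letter_matrix_def using words_D[OF that(1)] that(2) by auto
  have "mset (blocks rs w ! a) = mset (blocks rs w' ! a)" if "a < length rs" for a
    using eq zero w that by (intro multiset_eqI) (metis cnt)
  then have "map mset (blocks rs w) = map mset (blocks rs w')"
    by (intro nth_equalityI) auto
  moreover have "T \<in> tensor_product (map (sym_power k) rs)" using T by (simp add: det_isotypic_def)
  ultimately show ?thesis using blocks_words w unfolding tensor_product_sym_iff by blast
qed

lemma sum_Un_disjoint3:
  assumes "finite A" "finite B" "finite D" "A \<inter> B = {}" "(A \<union> B) \<inter> D = {}"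
  shows "sum f (A \<union> B \<union> D) = sum f A + sum f B + sum f D"
  using assms by (simp add: sum.union_disjoint)

definition column_weight :: "nat list \<Rightarrow> nat \<Rightarrow> (nat \<times> nat \<Rightarrow> nat) \<Rightarrow> nat" where
  "column_weight rs C w = (\<Sum>x\<in>positions rs. w x * C ^ fst x)"

text \<open>In this base-\<open>C\<close> size later factors dominate. A loss of 1 in every slot
  before factor \<open>c\<close> costs less than \<open>C ^ c\<close> because \<open>C\<close>
  exceeds the number of slots, while a gain in factor \<open>c\<close> is worth at least
  \<open>C ^ c\<close>.\<close>

lemma column_weight_less:
  assumes C: "C > card (positions rs)"
    and hi: "\<And>x. x \<in> positions rs \<Longrightarrow> fst x > c \<Longrightarrow> w x \<le> w' x"
    and lo: "\<And>x. x \<in> positions rs \<Longrightarrow> fst x < c \<Longrightarrow> w x \<le> Suc (w' x)"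
    and mid: "(\<Sum>x | x \<in> positions rs \<and> fst x = c. w x) < (\<Sum>x | x \<in> positions rs \<and> fst x = c. w' x)"
  shows "column_weight rs C w < column_weight rs C w'"
proof -
  let ?A = "{x \<in> positions rs. fst x < c}" and ?B = "{x \<in> positions rs. fst x = c}"
    and ?D = "{x \<in> positions rs. fst x > c}"
  have split: "column_weight rs C v = (\<Sum>x\<in>?A. v x * C ^ fst x) + (\<Sum>x\<in>?B. v x) * C ^ c + (\<Sum>x\<in>?D. v x * C ^ fst x)" for v
  proof -
    have "positions rs = (?A \<union> ?B) \<union> ?D" by auto
    then have "column_weight rs C v = (\<Sum>x\<in>(?A \<union> ?B) \<union> ?D. v x * C ^ fst x)"
      unfolding column_weight_def by simp
    also have "\<dots> = (\<Sum>x\<in>?A. v x * C ^ fst x) + (\<Sum>x\<in>?B. v x * C ^ fst x) + (\<Sum>x\<in>?D. v x * C ^ fst x)"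
      by (rule sum_Un_disjoint3) auto
    also have "(\<Sum>x\<in>?B. v x * C ^ fst x) = (\<Sum>x\<in>?B. v x) * C ^ c"
      unfolding sum_distrib_right by (intro sum.cong) auto
    finally show ?thesis .
  qed
  have small: "(\<Sum>x\<in>?A. C ^ fst x) < C ^ c"
  proof (cases c)
    case (Suc c')
    have "(\<Sum>x\<in>?A. C ^ fst x) \<le> (\<Sum>x\<in>?A. C ^ c')"
      using C Suc by (intro sum_mono power_increasing) auto
    also have "\<dots> = card ?A * C ^ c'" by simp
    also have "\<dots> \<le> card (positions rs) * C ^ c'"
      by (intro mult_right_mono card_mono) auto
    also have "\<dots> < C * C ^ c'" using C by (intro mult_strict_right_mono) auto
    finally show ?thesis using Suc by simp
  qed simp
  have "(\<Sum>x\<in>?A. w x * C ^ fst x) \<le> (\<Sum>x\<in>?A. w' x * C ^ fst x + C ^ fst x)"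
  proof (rule sum_mono)
    fix x assume "x \<in> ?A"
    then have "w x * C ^ fst x \<le> Suc (w' x) * C ^ fst x" using lo by (intro mult_right_mono) auto
    then show "w x * C ^ fst x \<le> w' x * C ^ fst x + C ^ fst x" by simp
  qed
  then have 1: "(\<Sum>x\<in>?A. w x * C ^ fst x) \<le> (\<Sum>x\<in>?A. w' x * C ^ fst x) + (\<Sum>x\<in>?A. C ^ fst x)"
    by (simp add: sum.distrib)
  have 2: "(\<Sum>x\<in>?D. w x * C ^ fst x) \<le> (\<Sum>x\<in>?D. w' x * C ^ fst x)"
    using hi by (intro sum_mono mult_right_mono) auto
  have "Suc (\<Sum>x\<in>?B. w x) * C ^ c \<le> (\<Sum>x\<in>?B. w' x) * C ^ c"
    using mid by (intro mult_right_mono) auto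
  then have 3: "(\<Sum>x\<in>?B. w x) * C ^ c + C ^ c \<le> (\<Sum>x\<in>?B. w' x) * C ^ c" by simp
  show ?thesis unfolding split using 1 2 3 small by linarith
qed

text \<open>Semistandardness of the tableau whose row \<open>q\<close> lists in increasing order the
  factors containing the letter \<open>q\<close>: comparing entries \<open><= a\<close> in row
  \<open>Suc i\<close> with entries \<open>< a\<close> in row \<open>i\<close> says that columns
  increase strictly.\<close>

definition standard_word :: "nat \<Rightarrow> nat list \<Rightarrow> (nat \<times> nat \<Rightarrow> nat) \<Rightarrow> bool" where
  "standard_word k rs w \<longleftrightarrow> (\<forall>i a. Suc i < k \<longrightarrow> a < length rs \<longrightarrow>
     card {x \<in> positions rs. w x = Suc i \<and> fst x \<le> a} \<le> card {x \<in> positions rs. w x = i \<and> fst x < a})"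

text \<open>A word of maximal weight in the support of an invariant is standard: otherwise the raising
  relations for a pair of adjacent letters would form a ladder of subset sums that kills it.\<close>

lemma det_isotypic_standard_support:
  assumes T: "T \<in> det_isotypic L k rs" and N: "card (positions rs) = L * k" and T0: "T \<noteq> 0"
  obtains w where "w \<in> words k rs" "standard_word k rs w" "T (blocks rs w) \<noteq> 0"
proof -
  define C where "C = Suc (card (positions rs))"
  let ?S = "{w \<in> words k rs. T (blocks rs w) \<noteq> 0}"
  have "?S \<noteq> {}"
  proof
    assume e: "?S = {}"
    have "T = 0"
    proof (rule multi_indices_ext[where d = k and ks = rs])
      fix J assume "J \<notin> multi_indices k rs"
      then show "T J = 0 J" using T unfolding det_isotypic_def tensor_product_sym_iff by simp
    qed (use e in auto)
    then show False using T0 by simp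
  qed
  moreover have "finite ?S" by simp
  ultimately obtain w0 where w0: "w0 \<in> ?S" and "column_weight rs C w0 = Max (column_weight rs C ` ?S)"
    by (metis (no_types, lifting) Max_in finite_imageI image_iff image_is_empty)
  then have max: "column_weight rs C w \<le> column_weight rs C w0" if "w \<in> ?S" for w
    using that \<open>finite ?S\<close> by simp
  have vanish: "T (blocks rs w) = 0" if "w \<in> words k rs" "column_weight rs C w0 < column_weight rs C w" for w
    using max[of w] that by auto
  have w0w: "w0 \<in> words k rs" and nz: "T (blocks rs w0) \<noteq> 0" using w0 by auto
  have "card {x \<in> positions rs. w0 x = Suc i \<and> fst x \<le> a} \<le> card {x \<in> positions rs. w0 x = i \<and> fst x < a}"
    if i: "Suc i < k" and a: "a < length rs" for i a
  proof (rule ccontr)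
    assume viol: "\<not> card {x \<in> positions rs. w0 x = Suc i \<and> fst x \<le> a} \<le> card {x \<in> positions rs. w0 x = i \<and> fst x < a}"
    \<comment> \<open>Only the letters \<open>i\<close> and \<open>Suc i\<close> in factors up to
      \<open>a\<close> are varied: \<open>W S R\<close> writes \<open>Suc i\<close> on
      \<open>S\<close> within \<open>Pre\<close> and on \<open>R\<close> within \<open>All\<close>.
      The word \<open>w0\<close> itself is \<open>W Y0 Mid\<close>. By symmetry within factor
      \<open>a\<close> only \<open>card R\<close> matters, which leaves functions \<open>h j\<close>
      of the subset \<open>S\<close>.\<close>
    define Pre where "Pre = {x \<in> positions rs. fst x < a \<and> (w0 x = i \<or> w0 x = Suc i)}"
    define All where "All = {x \<in> positions rs. fst x = a \<and> (w0 x = i \<or> w0 x = Suc i)}"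
    define Mid where "Mid = {x \<in> positions rs. fst x = a \<and> w0 x = Suc i}"
    define Y0 where "Y0 = {x \<in> positions rs. fst x < a \<and> w0 x = Suc i}"
    define W where "W S R x = (if x \<in> Pre then if x \<in> S then Suc i else i
       else if x \<in> All then if x \<in> R then Suc i else i else w0 x)" for S R x
    have fin: "finite Pre" "finite All" "finite Mid" by (auto simp: Pre_def All_def Mid_def)
    have sub: "Mid \<subseteq> All" "Y0 \<subseteq> Pre" by (auto simp: Mid_def All_def Y0_def Pre_def)
    have Ww: "W S R \<in> words k rs" for S R
      using w0w i by (auto simp: W_def PiE_iff extensional_def Pre_def All_def)
    have W0: "W Y0 Mid = w0"
      by (auto simp: fun_eq_iff W_def Y0_def Mid_def Pre_def All_def)
    have sym: "T (blocks rs (W S R)) = T (blocks rs (W S R'))"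
      if R: "R \<subseteq> All" "R' \<subseteq> All" "card R = card R'" for S R R'
    proof (rule det_isotypic_letter_matrix[OF T Ww Ww])
      fix q c assume "q < k" "c < length rs"
      have lm: "letter_matrix rs (W S R) q a = (if q = Suc i then card R else if q = i then card All - card R
          else letter_matrix rs w0 q a)" if "R \<subseteq> All" for R
      proof -
        have "{x \<in> positions rs. W S R x = q \<and> fst x = a}
            = (if q = Suc i then R else if q = i then All - R else {x \<in> positions rs. w0 x = q \<and> fst x = a})"
          using that by (auto simp: W_def Pre_def All_def split: if_splits)
        then show ?thesis
          using that fin finite_subset[of R All] by (auto simp: letter_matrix_def card_Diff_subset)
      qed
      show "letter_matrix rs (W S R) q c = letter_matrix rs (W S R') q c"
      proof (cases "c = a")
        case True
        then show ?thesis using lm R by simp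
      next
        case False
        then have "{x \<in> positions rs. W S R x = q \<and> fst x = c} = {x \<in> positions rs. W S R' x = q \<and> fst x = c}"
          by (auto simp: W_def Pre_def All_def)
        then show ?thesis by (simp add: letter_matrix_def)
      qed
    qed
    define Rj where "Rj j = (SOME R. R \<subseteq> All \<and> card R = j)" for j
    have Rj: "Rj j \<subseteq> All \<and> card (Rj j) = j" if "j \<le> card All" for j
      unfolding Rj_def by (rule someI_ex) (use obtain_subset_with_card_n[OF that] in blast)
    define h where "h j S = T (blocks rs (W S (Rj j)))" for j S
    have heq: "T (blocks rs (W S R)) = h j S" if "R \<subseteq> All" "card R = j" for S R j
    proof -
      have "j \<le> card All" using that fin card_mono by blast
      then show ?thesis unfolding h_def using Rj that by (intro sym) auto
    qed
    define b where "b = card Mid"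
    have b: "b \<le> card All" unfolding b_def using sub fin by (intro card_mono)
    have lowW: "w0 x \<le> Suc (W S R x)" for S R x by (auto simp: W_def Pre_def All_def)
    \<comment> \<open>Raising a letter in a factor beyond \<open>a\<close> pushes the column weight
      past its maximum, whatever the changes by one in earlier factors, so these terms drop out of
      the relation.\<close>
    have tail: "T (blocks rs ((W S R)(x := Suc i))) = 0"
      if x: "x \<in> positions rs" "fst x > a" "w0 x = i" for S R x
    proof (rule vanish)
      show "(W S R)(x := Suc i) \<in> words k rs"
        using Ww[of S R] x i by (auto simp: PiE_iff extensional_def)
      have Wx: "W S R y = w0 y" if "fst y > a" for y using that by (auto simp: W_def Pre_def All_def)
      show "column_weight rs C w0 < column_weight rs C ((W S R)(x := Suc i))"
      proof (rule column_weight_less[where c = "fst x"])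
        show "(\<Sum>y | y \<in> positions rs \<and> fst y = fst x. w0 y) < (\<Sum>y | y \<in> positions rs \<and> fst y = fst x. ((W S R)(x := Suc i)) y)"
        proof (rule sum_strict_mono_ex1)
          show "\<exists>y\<in>{y \<in> positions rs. fst y = fst x}. w0 y < ((W S R)(x := Suc i)) y"
            using x by (intro bexI[of _ x]) auto
        qed (use x Wx in auto)
      qed (use x Wx lowW[of _ S R] in \<open>auto simp: C_def\<close>)
    qed
    \<comment> \<open>The raising relation sorted by the place of the raised slot: before factor
      \<open>a\<close>, in it, or after it. Each of the \<open>card All - j\<close> slots available
      in factor \<open>a\<close> contributes the same value.\<close>
    have raise: "(\<Sum>x\<in>Pre - S. h j (insert x S)) + of_nat (card All - j) * h (Suc j) S = 0"
      if S: "S \<subseteq> Pre" and j: "j \<le> card All" for S j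
    proof -
      let ?R = "Rj j"
      have R: "?R \<subseteq> All" "card ?R = j" using Rj[OF j] by auto
      have fR: "finite ?R" using R fin finite_subset by blast
      let ?Tl = "{x \<in> positions rs. fst x > a \<and> w0 x = i}"
      have "{x. x \<in> positions rs \<and> W S ?R x = i} = (Pre - S) \<union> (All - ?R) \<union> ?Tl"
        using S R by (auto simp: W_def Pre_def All_def split: if_splits)
      then have "0 = (\<Sum>x\<in>(Pre - S) \<union> (All - ?R) \<union> ?Tl. T (blocks rs ((W S ?R)(x := Suc i))))"
        using det_isotypic_raising[OF T N Ww i, of S ?R] by simp
      also have "\<dots> = (\<Sum>x\<in>Pre - S. T (blocks rs ((W S ?R)(x := Suc i))))
          + (\<Sum>x\<in>All - ?R. T (blocks rs ((W S ?R)(x := Suc i)))) + (\<Sum>x\<in>?Tl. T (blocks rs ((W S ?R)(x := Suc i))))"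
        using fin by (intro sum_Un_disjoint3) (auto simp: Pre_def All_def)
      also have "(\<Sum>x\<in>Pre - S. T (blocks rs ((W S ?R)(x := Suc i)))) = (\<Sum>x\<in>Pre - S. h j (insert x S))"
      proof (intro sum.cong refl)
        fix x assume "x \<in> Pre - S"
        then have "(W S ?R)(x := Suc i) = W (insert x S) ?R" by (intro ext) (simp add: W_def)
        then show "T (blocks rs ((W S ?R)(x := Suc i))) = h j (insert x S)" by (simp add: h_def)
      qed
      also have "(\<Sum>x\<in>All - ?R. T (blocks rs ((W S ?R)(x := Suc i)))) = (\<Sum>x\<in>All - ?R. h (Suc j) S)"
      proof (intro sum.cong refl)
        fix x assume x: "x \<in> All - ?R"
        have "x \<notin> Pre" using x by (auto simp: Pre_def All_def)
        then have "(W S ?R)(x := Suc i) = W S (insert x ?R)"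
          using x by (intro ext) (simp add: W_def)
        then show "T (blocks rs ((W S ?R)(x := Suc i))) = h (Suc j) S"
          using x R fR by (simp add: heq)
      qed
      also have "\<dots> = of_nat (card All - j) * h (Suc j) S"
        using R fR fin by (simp add: card_Diff_subset)
      also have "(\<Sum>x\<in>?Tl. T (blocks rs ((W S ?R)(x := Suc i)))) = 0"
        by (intro sum.neutral ballI tail) simp_all
      finally show ?thesis by simp
    qed
    \<comment> \<open>One more letter \<open>Suc i\<close> in factor \<open>a\<close> already
      exceeds the maximal weight; hence the ladder stops at level \<open>b\<close>.\<close>
    have over: "h (Suc b) S = 0" if "b < card All" for S
    proof -
      let ?R = "Rj (Suc b)"
      have R: "?R \<subseteq> All" "card ?R = Suc b" using Rj[of "Suc b"] that by auto
      show ?thesis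
        unfolding h_def
      proof (rule vanish[OF Ww], rule column_weight_less[where c = a])
        have val: "(\<Sum>x | x \<in> positions rs \<and> fst x = a. W S R x)
            = card R + (i * card All + (\<Sum>x\<in>{x \<in> positions rs. fst x = a} - All. w0 x))"
          if R: "R \<subseteq> All" for R
        proof -
          have AP: "All \<subseteq> {x \<in> positions rs. fst x = a}" by (auto simp: All_def)
          have "(\<Sum>x | x \<in> positions rs \<and> fst x = a. W S R x)
              = (\<Sum>x\<in>{x \<in> positions rs. fst x = a} - All. W S R x) + (\<Sum>x\<in>All. W S R x)"
            by (rule sum.subset_diff[OF AP]) simp
          also have "(\<Sum>x\<in>{x \<in> positions rs. fst x = a} - All. W S R x) = (\<Sum>x\<in>{x \<in> positions rs. fst x = a} - All. w0 x)"
            by (intro sum.cong) (auto simp: W_def Pre_def)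
          also have "(\<Sum>x\<in>All. W S R x) = (\<Sum>x\<in>All. i + (if x \<in> R then 1 else 0))"
            by (intro sum.cong) (auto simp: W_def Pre_def All_def)
          also have "\<dots> = i * card All + card R"
            using R fin by (simp add: sum.distrib sum.If_cases Int_absorb1)
          finally show ?thesis by simp
        qed
        have "(\<Sum>x | x \<in> positions rs \<and> fst x = a. w0 x) = (\<Sum>x | x \<in> positions rs \<and> fst x = a. W S Mid x)"
          by (intro sum.cong) (auto simp: W_def Mid_def Pre_def All_def)
        then show "(\<Sum>x | x \<in> positions rs \<and> fst x = a. w0 x) < (\<Sum>x | x \<in> positions rs \<and> fst x = a. W S ?R x)"
          unfolding val[OF R(1)] using val[OF sub(1)] R(2) by (simp add: b_def)
      qed (use lowW in \<open>auto simp: C_def W_def Pre_def All_def\<close>)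
    qed
    have "h b Y0 = 0"
    proof (rule subset_ladder_zero[where h = h and P = Pre and b = b and q = "card Y0"
          and c = "\<lambda>j. of_nat (card All - j)"])
      show "finite Pre" by (rule fin)
      show "(\<Sum>x\<in>Pre - S. h j (insert x S)) = - of_nat (card All - j) * h (Suc j) S"
        if "j < b" "S \<subseteq> Pre" for j S
      proof -
        have "j \<le> card All" using that(1) b by simp
        from raise[OF that(2) this] show ?thesis
          by (simp only: mult_minus_left eq_neg_iff_add_eq_0)
      qed
      show "of_nat (card All - j) \<noteq> (0::complex)" if "j < b" for j using that b by simp
      show "(\<Sum>x\<in>Pre - S. h b (insert x S)) = 0" if "S \<subseteq> Pre" for S
        using raise[OF that b] over[of S] by (cases "b < card All") auto
      \<comment> \<open>The violated standardness inequality: \<open>card Y0 + b\<close> exceeds the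
        number of letters \<open>i\<close> before factor \<open>a\<close>, and that number is
        \<open>card Pre - card Y0\<close>.\<close>
      show "card Pre < 2 * card Y0 + b"
      proof -
        have "Pre = Y0 \<union> {x \<in> positions rs. w0 x = i \<and> fst x < a}"
          by (auto simp: Pre_def Y0_def)
        then have 1: "card Pre = card Y0 + card {x \<in> positions rs. w0 x = i \<and> fst x < a}"
          by (simp add: card_Un_disjoint Y0_def disjoint_iff)
        have "{x \<in> positions rs. w0 x = Suc i \<and> fst x \<le> a} = Y0 \<union> Mid"
          by (auto simp: Y0_def Mid_def)
        then have "card {x \<in> positions rs. w0 x = Suc i \<and> fst x \<le> a} = card Y0 + b"
          by (simp add: card_Un_disjoint Y0_def Mid_def b_def disjoint_iff)
        then show ?thesis using 1 viol by simp
      qed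
    qed (use sub in auto)
    moreover have "h b Y0 = T (blocks rs w0)"
      using heq[OF sub(1), of b Y0] W0 by (simp add: b_def)
    ultimately show False using nz by simp
  qed
  then have "standard_word k rs w0" by (simp add: standard_word_def)
  then show ?thesis using that w0w nz by blast
qed

section \<open>Standard matrices, lattice points and tableaux\<close>

text \<open>Semistandard tableaux with \<open>k\<close> rows of length \<open>L\<close> and content
  \<open>rs\<close>, encoded by the multiplicity \<open>A q a\<close> of the entry \<open>a\<close>
  in row \<open>q\<close>. Extension by zero makes equality of functions the equality of
  tableaux.\<close>

definition standard_matrices :: "nat \<Rightarrow> nat \<Rightarrow> nat list \<Rightarrow> (nat \<Rightarrow> nat \<Rightarrow> nat) set" where
  "standard_matrices L k rs = {A.
     (\<forall>q a. \<not> (q < k \<and> a < length rs) \<longrightarrow> A q a = 0) \<and>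
     (\<forall>a<length rs. (\<Sum>q<k. A q a) = rs ! a) \<and>
     (\<forall>q<k. (\<Sum>a<length rs. A q a) = L) \<and>
     (\<forall>q a. Suc q < k \<longrightarrow> a < length rs \<longrightarrow> (\<Sum>c<Suc a. A (Suc q) c) \<le> (\<Sum>c<a. A q c))}"

lemma standard_matrices_le:
  assumes "A \<in> standard_matrices L k rs"
  shows "A q a \<le> L"
proof (cases "q < k \<and> a < length rs")
  case True
  then have "A q a \<le> (\<Sum>a<length rs. A q a)" by (intro member_le_sum) auto
  then show ?thesis using assms True by (simp add: standard_matrices_def)
qed (use assms in \<open>simp add: standard_matrices_def\<close>)

lemma finite_standard_matrices [simp]: "finite (standard_matrices L k rs)"
proof (rule inj_on_finite[where f = "\<lambda>A. restrict (\<lambda>(q, a). A q a) ({..<k} \<times> {..<length rs})"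
      and B = "{..<k} \<times> {..<length rs} \<rightarrow>\<^sub>E {..L}"])
  show "inj_on (\<lambda>A. restrict (\<lambda>(q, a). A q a) ({..<k} \<times> {..<length rs})) (standard_matrices L k rs)"
  proof (intro inj_onI ext)
    fix A A' q a assume A: "A \<in> standard_matrices L k rs" "A' \<in> standard_matrices L k rs"
      and eq: "restrict (\<lambda>(q, a). A q a) ({..<k} \<times> {..<length rs}) = restrict (\<lambda>(q, a). A' q a) ({..<k} \<times> {..<length rs})"
    show "A q a = A' q a"
    proof (cases "q < k \<and> a < length rs")
      case True
      then show ?thesis using fun_cong[OF eq, of "(q, a)"] by simp
    qed (use A in \<open>auto simp: standard_matrices_def\<close>)
  qed
  show "(\<lambda>A. restrict (\<lambda>(q, a). A q a) ({..<k} \<times> {..<length rs})) ` standard_matrices L k rs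
      \<subseteq> {..<k} \<times> {..<length rs} \<rightarrow>\<^sub>E {..L}"
    by (intro image_subsetI) (auto simp: restrict_PiE_iff standard_matrices_le)
qed (auto intro!: finite_PiE)

text \<open>The pattern entry \<open>x i j\<close> is the number of entries \<open><= i\<close> in
  row \<open>j - 1\<close> of the tableau. Growth of these counts with \<open>i\<close> is one
  interlacing inequality, strictness of the columns is the other.\<close>

lemma card_lattice_points:
  assumes nk: "m + 1 \<le> n"
  shows "card (lattice_points (gt_polytope m n r L)) = card (standard_matrices L (m + 1) (map r [1..<n + 1]))"
proof -
  define k where "k = m + 1"
  define rs where "rs = map r [1..<n + 1]"
  have len [simp]: "length rs = n" by (simp add: rs_def)
  have rsn: "rs ! a = r (Suc a)" if "a < n" for a using that unfolding rs_def by (simp del: upt_Suc)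
  have kn: "k \<le> n" "k \<ge> 1" "n \<ge> 1" using nk by (auto simp: k_def)
  define f where "f A = (\<lambda>i j. if i < n \<and> 1 \<le> j \<and> j \<le> i + 1 \<and> j \<le> k then real (\<Sum>c<Suc i. A (j - 1) c) else 0)"
    for A :: "nat \<Rightarrow> nat \<Rightarrow> nat"
  \<comment> \<open>Row \<open>q\<close> of the tableau has no entry below \<open>q\<close>, so the
    partial sums vanish where the triangle has no cell.\<close>
  have Sz: "(\<Sum>c<i. A q c) = 0" if A: "A \<in> standard_matrices L k rs" and "i \<le> q" "i \<le> n" "q < k" for A i q
    using that(2-)
  proof (induction q arbitrary: i)
    case (Suc q)
    show ?case
    proof (cases i)
      case (Suc a)
      have "(\<Sum>c<Suc a. A (Suc q) c) \<le> (\<Sum>c<a. A q c)"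
        using A Suc.prems Suc by (auto simp: standard_matrices_def)
      then show ?thesis using Suc.IH[of a] Suc.prems Suc by simp
    qed simp
  qed simp
  have colsum: "(\<Sum>q<k. \<Sum>c<i. A q c) = (\<Sum>j=1..i. r j)" if A: "A \<in> standard_matrices L k rs" and i: "i \<le> n" for A i
  proof -
    have "(\<Sum>q<k. \<Sum>c<i. A q c) = (\<Sum>c<i. \<Sum>q<k. A q c)" by (rule sum.swap)
    also have "\<dots> = (\<Sum>c<i. r (Suc c))"
      using A i rsn by (intro sum.cong) (auto simp: standard_matrices_def)
    also have "\<dots> = (\<Sum>j=1..i. r j)"
      by (rule sum.reindex_bij_witness[where i = "\<lambda>j. j - 1" and j = Suc]) auto
    finally show ?thesis .
  qed
  have rowf: "(\<Sum>j=1..i + 1. x j) = (\<Sum>q<k. x (Suc q))" if "\<And>j. j > i + 1 \<or> j > k \<Longrightarrow> x j = 0" for i and x :: "nat \<Rightarrow> real"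
  proof -
    have "(\<Sum>j=1..i + 1. x j) = (\<Sum>j=1..max (i + 1) k. x j)"
      using that by (intro sum.mono_neutral_left) auto
    also have "\<dots> = (\<Sum>j=1..k. x j)" using that by (intro sum.mono_neutral_right) auto
    also have "\<dots> = (\<Sum>q<k. x (Suc q))"
      by (rule sum.reindex_bij_witness[where j = "\<lambda>j. j - 1" and i = Suc]) auto
    finally show ?thesis .
  qed
  have "bij_betw f (standard_matrices L k rs) (lattice_points (gt_polytope m n r L))"
    unfolding bij_betw_def
  proof (intro conjI inj_onI equalityI subsetI)
    fix A A' assume A: "A \<in> standard_matrices L k rs" "A' \<in> standard_matrices L k rs" and eq: "f A = f A'"
    have S: "(\<Sum>c<i. A q c) = (\<Sum>c<i. A' q c)" if "q < k" "i \<le> n" for q i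
    proof (cases "i \<le> q")
      case True
      show ?thesis using Sz[OF A(1) True that(2,1)] Sz[OF A(2) True that(2,1)] by simp
    next
      case False
      then obtain i' where i': "i = Suc i'" by (cases i) auto
      have "f A i' (Suc q) = f A' i' (Suc q)" using eq by simp
      then have "real (\<Sum>c<i. A q c) = real (\<Sum>c<i. A' q c)"
        using False that i' by (simp add: f_def del: sum.lessThan_Suc of_nat_sum)
      then show ?thesis by (simp only: of_nat_eq_iff)
    qed
    show "A = A'"
    proof (intro ext)
      fix q a
      show "A q a = A' q a"
      proof (cases "q < k \<and> a < n")
        case True
        then show ?thesis using S[of q "Suc a"] S[of q a] by simp
      qed (use A in \<open>auto simp: standard_matrices_def\<close>)
    qed
  next
    fix x assume "x \<in> f ` standard_matrices L k rs"
    then obtain A where A: "A \<in> standard_matrices L k rs" and x: "x = f A" by blast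
    have fS: "f A i j = real (\<Sum>c<Suc i. A (j - 1) c)" if "i < n" "1 \<le> j" "j \<le> k" for i j
      using that Sz[OF A, of "Suc i" "j - 1"] by (auto simp: f_def simp del: sum.lessThan_Suc)
    have "x i j \<in> \<int>" for i j by (auto simp: x f_def)
    moreover have "x i j = 0" if "\<not> (i \<le> n - 1 \<and> 1 \<le> j \<and> j \<le> i + 1)" for i j
      using that kn by (auto simp: x f_def)
    moreover have "x (n - 1) j = real L" if "j \<in> {1..m + 1}" for j
    proof -
      have "j - 1 < k" using that by (auto simp: k_def)
      then have "(\<Sum>c<n. A (j - 1) c) = L" using A by (simp add: standard_matrices_def)
      then show ?thesis using that fS[of "n - 1" j] kn by (simp add: x k_def del: sum.lessThan_Suc of_nat_sum)
    qed
    moreover have "x (n - 1) j = 0" if "j \<in> {m + 2..n}" for j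
      using that by (auto simp: x f_def k_def)
    moreover have "(\<Sum>j=1..i + 1. x i j) = real (\<Sum>j=1..i + 1. r j)" if "i \<in> {0..n - 1}" for i
    proof -
      have i: "i < n" using that kn by auto
      have "(\<Sum>j=1..i + 1. x i j) = (\<Sum>q<k. x i (Suc q))"
        by (rule rowf) (auto simp: x f_def)
      also have "\<dots> = real (\<Sum>q<k. \<Sum>c<Suc i. A q c)"
        unfolding of_nat_sum[of _ "{..<k}"] x using i by (intro sum.cong refl) (subst fS, auto)
      also have "\<dots> = real (\<Sum>j=1..i + 1. r j)" using colsum[OF A, of "Suc i"] i by simp
      finally show ?thesis .
    qed
    moreover have "x (i - 1) j \<le> x i j \<and> x i (j + 1) \<le> x (i - 1) j" if i: "i \<in> {1..n - 1}" and j: "j \<in> {1..i}" for i j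
    proof
      have i': "Suc (i - 1) = i" "i < n" "i - 1 < n" using i by auto
      show "x (i - 1) j \<le> x i j"
      proof (cases "j \<le> k")
        case True
        have "(\<Sum>c<i. A (j - 1) c) \<le> (\<Sum>c<Suc i. A (j - 1) c)" by simp
        then show ?thesis using fS[of i j] fS[of "i - 1" j] i' j True unfolding x
          by (simp del: sum.lessThan_Suc of_nat_sum)
      qed (simp add: x f_def)
      show "x i (j + 1) \<le> x (i - 1) j"
      proof (cases "j + 1 \<le> k")
        case True
        have j1: "Suc (j - 1) = j" using j by simp
        have "\<forall>q a. Suc q < k \<longrightarrow> a < n \<longrightarrow> (\<Sum>c<Suc a. A (Suc q) c) \<le> (\<Sum>c<a. A q c)"
          using A unfolding standard_matrices_def len by blast
        then have "(\<Sum>c<Suc i. A (Suc (j - 1)) c) \<le> (\<Sum>c<i. A (j - 1) c)"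
          using True i'(2) j1 by (metis Suc_eq_plus1 Suc_le_lessD)
        then have "(\<Sum>c<Suc i. A j c) \<le> (\<Sum>c<i. A (j - 1) c)" by (simp only: j1)
        then show ?thesis using fS[of i "j + 1"] fS[of "i - 1" j] i' j True unfolding x
          by (simp del: sum.lessThan_Suc of_nat_sum)
      qed (simp add: x f_def sum_nonneg del: sum.lessThan_Suc of_nat_sum)
    qed
    ultimately show "x \<in> lattice_points (gt_polytope m n r L)"
      unfolding lattice_points_def gt_polytope_def by blast
  next
    fix x assume "x \<in> lattice_points (gt_polytope m n r L)"
    then have int: "\<And>i j. x i j \<in> \<int>"
      and out: "\<And>i j. \<not> (i \<le> n - 1 \<and> 1 \<le> j \<and> j \<le> i + 1) \<Longrightarrow> x i j = 0"
      and top: "\<And>j. j \<in> {1..m + 1} \<Longrightarrow> x (n - 1) j = real L"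
      and top0: "\<And>j. j \<in> {m + 2..n} \<Longrightarrow> x (n - 1) j = 0"
      and rows: "\<And>i. i \<in> {0..n - 1} \<Longrightarrow> (\<Sum>j=1..i + 1. x i j) = real (\<Sum>j=1..i + 1. r j)"
      and inter1: "\<And>i j. i \<in> {1..n - 1} \<Longrightarrow> j \<in> {1..i} \<Longrightarrow> x (i - 1) j \<le> x i j"
      and inter2: "\<And>i j. i \<in> {1..n - 1} \<Longrightarrow> j \<in> {1..i} \<Longrightarrow> x i (j + 1) \<le> x (i - 1) j"
      unfolding lattice_points_def gt_polytope_def by blast+
    \<comment> \<open>Downwards from the prescribed row \<open>n - 1\<close>: interlacing squeezes
      an entry between two entries of row \<open>Suc i\<close>, so nonnegativity and vanishing
      beyond column \<open>k\<close> are inherited.\<close>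
    have nn: "0 \<le> x i j \<and> (j > k \<longrightarrow> x i j = 0)" for i j
    proof (cases "i \<le> n - 1 \<and> 1 \<le> j \<and> j \<le> i + 1")
      case True
      then have "i \<le> n - 1" by simp
      then show ?thesis using True
      proof (induction arbitrary: j rule: inc_induct)
        case base
        show ?case
        proof (cases "j \<le> k")
          case True
          then show ?thesis using top[of j] base by (simp add: k_def)
        next
          case False
          then show ?thesis using top0[of j] base kn by (simp add: k_def)
        qed
      next
        case (step i)
        have *: "Suc i \<in> {1..n - 1}" "j \<in> {1..Suc i}" using step by auto
        have "0 \<le> x (Suc i) (j + 1)" "j > k \<longrightarrow> x (Suc i) j = 0"
          using step.IH[of "j + 1"] step.IH[of j] step.prems step.hyps by auto
        then show ?case using inter1[OF *] inter2[OF *] by (auto intro: antisym order_trans)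
      qed
    qed (use out in simp)
    \<comment> \<open>Indices are shifted so that \<open>y q i\<close> is the partial sum over
      \<open>c < i\<close>; the case \<open>i = 0\<close> supplies the empty row that the array does
      not contain. The floor is harmless since the entries are integers.\<close>
    define y where "y q i = (case i of 0 \<Rightarrow> 0 | Suc i' \<Rightarrow> nat \<lfloor>x i' (Suc q)\<rfloor>)" for q i
    have y: "real (y q i) = (case i of 0 \<Rightarrow> 0 | Suc i' \<Rightarrow> x i' (Suc q))" for q i
      using nn int by (cases i) (auto simp: y_def)
    have ymono: "y q i \<le> y q (Suc i)" if "i < n" for q i
    proof -
      have "real (y q i) \<le> real (y q (Suc i))"
      proof (cases i)
        case (Suc i')
        show ?thesis
        proof (cases "Suc q \<le> i")
          case True
          then show ?thesis using inter1[of i "Suc q"] that Suc by (simp add: y)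
        next
          case False
          then have "x i' (Suc q) = 0" using Suc by (intro out) auto
          then show ?thesis using Suc nn by (simp add: y)
        qed
      qed (simp add: y nn)
      then show ?thesis by simp
    qed
    have ystd: "y (Suc q) (Suc a) \<le> y q a" if "a < n" for q a
    proof -
      have "real (y (Suc q) (Suc a)) \<le> real (y q a)"
      proof (cases "1 \<le> a \<and> Suc q \<le> a")
        case True
        then obtain a' where a': "a = Suc a'" by (cases a) auto
        show ?thesis using inter2[of a "Suc q"] True that a' by (simp add: y)
      next
        case False
        then have "x a (Suc (Suc q)) = 0" by (intro out) auto
        then show ?thesis by (simp add: y nn split: nat.split)
      qed
      then show ?thesis by simp
    qed
    define A where "A q a = (if q < k \<and> a < n then y q (Suc a) - y q a else 0)" for q a
    have S: "(\<Sum>c<i. A q c) = y q i" if "q < k" "i \<le> n" for q i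
      using that(2)
    proof (induction i)
      case (Suc i)
      then show ?case using ymono[of i q] that(1) by (simp add: A_def)
    qed (simp add: y_def)
    have yr: "(\<Sum>q<k. y q i) = (\<Sum>j=1..i. r j)" if "i \<le> n" for i
    proof (cases i)
      case (Suc i')
      have "real (\<Sum>q<k. y q i) = (\<Sum>q<k. x i' (Suc q))" using Suc by (simp add: y)
      also have "\<dots> = (\<Sum>j=1..i' + 1. x i' j)"
        by (rule rowf[symmetric]) (use nn out in auto)
      also have "\<dots> = real (\<Sum>j=1..i. r j)" using rows[of i'] that Suc by simp
      finally show ?thesis by (simp only: of_nat_eq_iff)
    qed (simp add: y_def)
    have "A \<in> standard_matrices L k rs"
      unfolding standard_matrices_def
    proof (intro CollectI conjI allI impI)
      fix a assume a: "a < length rs"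
      have "(\<Sum>q<k. A q a) + (\<Sum>q<k. y q a) = (\<Sum>q<k. y q (Suc a))"
        unfolding sum.distrib[symmetric] using ymono a by (intro sum.cong) (auto simp: A_def)
      then show "(\<Sum>q<k. A q a) = rs ! a" using yr[of a] yr[of "Suc a"] a rsn[of a] by simp
    next
      fix q assume q: "q < k"
      have "real (y q n) = real L" using kn top[of "Suc q"] q by (cases n) (auto simp: y k_def)
      then show "(\<Sum>a<length rs. A q a) = L" using S[OF q, of n] by simp
    next
      fix q a assume "Suc q < k" "a < length rs"
      then show "(\<Sum>c<Suc a. A (Suc q) c) \<le> (\<Sum>c<a. A q c)"
        using S[of "Suc q" "Suc a"] S[of q a] ystd[of a q] by (simp del: sum.lessThan_Suc)
    qed (auto simp: A_def)
    moreover have "f A = x"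
    proof (intro ext)
      fix i j
      show "f A i j = x i j"
      proof (cases "i < n \<and> 1 \<le> j \<and> j \<le> i + 1 \<and> j \<le> k")
        case True
        then have "j - 1 < k" "Suc (j - 1) = j" by auto
        then have "real (\<Sum>c<Suc i. A (j - 1) c) = x i j"
          using S[of "j - 1" "Suc i"] True by (simp add: y del: sum.lessThan_Suc of_nat_sum)
        then show ?thesis using True by (simp add: f_def del: sum.lessThan_Suc of_nat_sum)
      next
        case False
        have "x i j = 0"
        proof (cases "j > k")
          case False
          then show ?thesis using \<open>\<not> (i < n \<and> _)\<close> kn by (intro out) auto
        qed (use nn in blast)
        then show ?thesis using False by (auto simp: f_def)
      qed
    qed
    ultimately show "x \<in> f ` standard_matrices L k rs" by blast
  qed
  then show ?thesis unfolding k_def rs_def by (simp add: bij_betw_same_card)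
qed

text \<open>Row \<open>snd b\<close> is the weakly increasing sequence with multiplicities
  \<open>A (snd b)\<close>, and \<open>fst b\<close> is the place in it; the least \<open>a\<close>
  inverts the partial sums.\<close>

definition tableau :: "(nat \<Rightarrow> nat \<Rightarrow> nat) \<Rightarrow> nat \<times> nat \<Rightarrow> nat" where
  "tableau A b = (LEAST a. fst b < (\<Sum>c<Suc a. A (snd b) c))"

lemma tableau_eq_iff:
  "tableau A (l, q) = a \<longleftrightarrow> (\<Sum>c<a. A q c) \<le> l \<and> l < (\<Sum>c<Suc a. A q c)"
  if "\<exists>a. l < (\<Sum>c<Suc a. A q c)"
proof -
  have mono: "(\<Sum>c<a. A q c) \<le> (\<Sum>c<a'. A q c)" if "a \<le> a'" for a a'
    using that by (intro sum_mono2) auto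
  let ?P = "\<lambda>a. l < (\<Sum>c<Suc a. A q c)"
  have eq: "tableau A (l, q) = Least ?P" by (simp add: tableau_def)
  have 1: "?P (Least ?P)" using that by (rule LeastI_ex)
  have 2: "(\<Sum>c<Least ?P. A q c) \<le> l"
  proof (cases "Least ?P")
    case (Suc a)
    then have "\<not> ?P a" using not_less_Least[of a ?P] by simp
    then show ?thesis using Suc by simp
  qed simp
  show ?thesis
  proof
    assume "(\<Sum>c<a. A q c) \<le> l \<and> l < (\<Sum>c<Suc a. A q c)"
    then have "Least ?P \<le> a" "\<not> Least ?P < a"
      using mono[of "Suc (Least ?P)" a] 1 by (auto intro: Least_le simp del: sum.lessThan_Suc)
    then show "tableau A (l, q) = a" unfolding eq by simp
  qed (use 1 2 eq in auto)
qed

lemma tableau_exists: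
  assumes A: "A \<in> standard_matrices L k rs" and "l < L" "q < k"
  shows "\<exists>a<length rs. l < (\<Sum>c<Suc a. A q c)"
proof -
  have "(\<Sum>c<length rs. A q c) = L" using A assms by (simp add: standard_matrices_def)
  then have "length rs \<noteq> 0" using assms by (metis lessThan_0 not_less0 sum.empty)
  then have "Suc (length rs - 1) = length rs" by simp
  then show ?thesis using \<open>_ = L\<close> \<open>l < L\<close> \<open>length rs \<noteq> 0\<close> by (metis Suc_n_not_le_n not_less)
qed

lemma tableau_less_length:
  assumes A: "A \<in> standard_matrices L k rs" and "l < L" "q < k"
  shows "tableau A (l, q) < length rs"
proof -
  obtain a where a: "a < length rs" "l < (\<Sum>c<Suc a. A q c)" using tableau_exists[OF assms] by blast
  have "tableau A (l, q) \<le> a" unfolding tableau_def using a(2) by (intro Least_le) simp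
  then show ?thesis using a by simp
qed

text \<open>If the entry below is \<open>a\<close>, then more than \<open>l\<close> entries of row
  \<open>Suc q\<close> are \<open><= a\<close>; standardness gives more than \<open>l\<close>
  entries \<open>< a\<close> in row \<open>q\<close>.\<close>

lemma tableau_strict:
  assumes A: "A \<in> standard_matrices L k rs" and l: "l < L" and q: "Suc q < k"
  shows "tableau A (l, q) < tableau A (l, Suc q)"
proof -
  let ?a = "tableau A (l, Suc q)"
  have ex: "\<exists>a. l < (\<Sum>c<Suc a. A (Suc q) c)" using tableau_exists[OF A l q] by blast
  have a: "?a < length rs" by (rule tableau_less_length[OF A l q])
  have "l < (\<Sum>c<Suc ?a. A (Suc q) c)" using tableau_eq_iff[where l = l and A = A and q = "Suc q" and a = ?a, OF ex] by simp
  also have "\<dots> \<le> (\<Sum>c<?a. A q c)"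
    using A q a by (auto simp: standard_matrices_def simp del: sum.lessThan_Suc)
  finally have lt: "l < (\<Sum>c<?a. A q c)" .
  then obtain a' where a': "?a = Suc a'" by (cases ?a) auto
  then have "tableau A (l, q) \<le> a'" unfolding tableau_def[of A "(l, q)"] using lt by (intro Least_le) simp
  then show ?thesis using a' by simp
qed

lemma tableau_mono:
  assumes A: "A \<in> standard_matrices L k rs" and l: "l < L" and q: "q < q'" "q' < k"
  shows "tableau A (l, q) < tableau A (l, q')"
  using q
proof (induction q')
  case (Suc q')
  then show ?case using tableau_strict[OF A l Suc.prems(2)] by (cases "q = q'") auto
qed simp

lemma card_tableau:
  assumes A: "A \<in> standard_matrices L k rs" and q: "q < k" and a: "a < length rs"
  shows "card {b \<in> boxes L k. tableau A b = a \<and> snd b = q} = A q a"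
proof -
  have le: "(\<Sum>c<Suc a. A q c) \<le> L"
  proof -
    have "(\<Sum>c<Suc a. A q c) \<le> (\<Sum>c<length rs. A q c)" using a by (intro sum_mono2) auto
    then show ?thesis using A q by (simp add: standard_matrices_def)
  qed
  have "{b \<in> boxes L k. tableau A b = a \<and> snd b = q} = (\<lambda>l. (l, q)) ` {(\<Sum>c<a. A q c)..<(\<Sum>c<Suc a. A q c)}"
  proof (intro equalityI subsetI)
    fix b assume "b \<in> {b \<in> boxes L k. tableau A b = a \<and> snd b = q}"
    then obtain l where b: "b = (l, q)" "l < L" "tableau A (l, q) = a" by (cases b) (auto simp: boxes_eq)
    have "\<exists>a. l < (\<Sum>c<Suc a. A q c)" using tableau_exists[OF A b(2) q] by blast
    from tableau_eq_iff[where l = l and A = A and q = q and a = a, OF this] show "b \<in> (\<lambda>l. (l, q)) ` {(\<Sum>c<a. A q c)..<(\<Sum>c<Suc a. A q c)}"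
      using b by auto
  next
    fix b assume "b \<in> (\<lambda>l. (l, q)) ` {(\<Sum>c<a. A q c)..<(\<Sum>c<Suc a. A q c)}"
    then obtain l where b: "b = (l, q)" "(\<Sum>c<a. A q c) \<le> l" "l < (\<Sum>c<Suc a. A q c)" by auto
    have "\<exists>a. l < (\<Sum>c<Suc a. A q c)" using b by blast
    from tableau_eq_iff[where l = l and A = A and q = q and a = a, OF this] show "b \<in> {b \<in> boxes L k. tableau A b = a \<and> snd b = q}"
      using b le q by (auto simp: boxes_eq)
  qed
  then show ?thesis by (simp add: card_image inj_on_def)
qed

lemma letter_count_tableau:
  assumes A: "A \<in> standard_matrices L k rs" and a: "a < length rs"
  shows "letter_count (replicate L k) (tableau A) a = rs ! a"
proof -
  have "letter_count (replicate L k) (tableau A) a = card (\<Union>q<k. {b \<in> boxes L k. tableau A b = a \<and> snd b = q})"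
    unfolding letter_count_def by (intro arg_cong[where f = card]) (auto simp: boxes_eq)
  also have "\<dots> = (\<Sum>q<k. card {b \<in> boxes L k. tableau A b = a \<and> snd b = q})"
    by (intro card_UN_disjoint) auto
  also have "\<dots> = rs ! a" using A a by (simp add: card_tableau[OF A] standard_matrices_def)
  finally show ?thesis .
qed

section \<open>Leading exponents of products of minors\<close>

lemma digits_unique:
  fixes d d' :: "nat \<Rightarrow> nat"
  assumes "(\<Sum>j<m. d j * B ^ j) = (\<Sum>j<m. d' j * B ^ j)"
    and "\<And>j. j < m \<Longrightarrow> d j < B" "\<And>j. j < m \<Longrightarrow> d' j < B" "j < m"
  shows "d j = d' j"
  using assms
proof (induction m arbitrary: d d' j)
  case (Suc m)
  have s: "(\<Sum>j<Suc m. e j * B ^ j) = e 0 + B * (\<Sum>j<m. e (Suc j) * B ^ j)" for e :: "nat \<Rightarrow> nat"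
    unfolding sum.lessThan_Suc_shift by (simp add: sum_distrib_left mult_ac)
  have lt: "d 0 < B" "d' 0 < B" using Suc.prems by auto
  have eq: "d 0 + B * (\<Sum>j<m. d (Suc j) * B ^ j) = d' 0 + B * (\<Sum>j<m. d' (Suc j) * B ^ j)"
    using Suc.prems(1) unfolding s .
  from arg_cong[OF eq, of "\<lambda>x. x mod B"] have 0: "d 0 = d' 0" using lt by simp
  with eq lt have "(\<Sum>j<m. d (Suc j) * B ^ j) = (\<Sum>j<m. d' (Suc j) * B ^ j)" by simp
  then have "d (Suc i) = d' (Suc i)" if "i < m" for i
    using Suc.IH[of "\<lambda>j. d (Suc j)" "\<lambda>j. d' (Suc j)" i] Suc.prems that by simp
  then show ?case using 0 Suc.prems by (cases j) auto
qed simp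

text \<open>The exponent of \<open>t\<close> substituted for the matrix entry \<open>(a, q)\<close>.
  The letter \<open>a\<close> dominates the digit position, so a larger letter outweighs any change
  of column index.\<close>

definition place :: "nat \<Rightarrow> nat \<Rightarrow> nat \<Rightarrow> nat \<Rightarrow> nat" where
  "place B k a q = B ^ (a * k + q)"

definition matrix_exponent :: "nat \<Rightarrow> nat \<Rightarrow> nat \<Rightarrow> (nat \<Rightarrow> nat \<Rightarrow> nat) \<Rightarrow> nat" where
  "matrix_exponent B k n A = (\<Sum>j<n * k. A (j mod k) (j div k) * B ^ j)"

lemma less_mult_index: "a < n \<Longrightarrow> q < k \<Longrightarrow> a * k + q < n * (k::nat)"
proof -
  assume "a < n" "q < k"
  then have "a * k + q < Suc a * k" by simp
  also have "\<dots> \<le> n * k" using \<open>a < n\<close> by (intro mult_le_mono1) simp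
  finally show ?thesis .
qed

lemma matrix_exponent_inj:
  assumes A: "A \<in> standard_matrices L k rs" and A': "A' \<in> standard_matrices L k rs" and B: "L < B"
    and eq: "matrix_exponent B k (length rs) A = matrix_exponent B k (length rs) A'"
  shows "A = A'"
proof (intro ext)
  fix q a
  have lt: "A q a < B" "A' q a < B" for q a
    using standard_matrices_le[OF A, of q a] standard_matrices_le[OF A', of q a] B by auto
  show "A q a = A' q a"
  proof (cases "q < k \<and> a < length rs")
    case True
    then have j: "a * k + q < length rs * k" by (simp add: less_mult_index)
    have "A ((a * k + q) mod k) ((a * k + q) div k) = A' ((a * k + q) mod k) ((a * k + q) div k)"
      by (rule digits_unique[OF eq[unfolded matrix_exponent_def] lt j])
    then show ?thesis using True by simp
  qed (use A A' in \<open>auto simp: standard_matrices_def\<close>)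
qed

lemma sum_place:
  assumes "\<And>b. b \<in> boxes L k \<Longrightarrow> w b < n" "\<And>b. b \<in> boxes L k \<Longrightarrow> v b < k"
  shows "(\<Sum>b\<in>boxes L k. place B k (w b) (v b)) = matrix_exponent B k n (\<lambda>q a. card {b \<in> boxes L k. w b = a \<and> v b = q})"
proof -
  have "(\<Sum>b\<in>boxes L k. place B k (w b) (v b)) = (\<Sum>j<n * k. \<Sum>b | b \<in> boxes L k \<and> w b * k + v b = j. place B k (w b) (v b))"
    using assms by (intro sum.group[symmetric]) (auto simp: less_mult_index)
  also have "\<dots> = (\<Sum>j<n * k. card {b \<in> boxes L k. w b = j div k \<and> v b = j mod k} * B ^ j)"
  proof (intro sum.cong refl)
    fix j
    have "{b \<in> boxes L k. w b * k + v b = j} = {b \<in> boxes L k. w b = j div k \<and> v b = j mod k}"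
      using assms(2) by auto
    then show "(\<Sum>b | b \<in> boxes L k \<and> w b * k + v b = j. place B k (w b) (v b))
        = card {b \<in> boxes L k. w b = j div k \<and> v b = j mod k} * B ^ j"
      by (subst sum.cong[OF refl, where h = "\<lambda>_. B ^ j"]) (auto simp: place_def)
  qed
  finally show ?thesis unfolding matrix_exponent_def .
qed

text \<open>The largest moved index \<open>m\<close> is sent below itself. All indices up to
  \<open>m\<close> then give powers smaller than the diagonal one at \<open>m\<close>, and being at
  most \<open>k < B\<close> in number they cannot add up to it; above \<open>m\<close> nothing
  changes.\<close>

lemma place_rearrangement:
  assumes \<sigma>: "\<sigma> permutes {0..<k}" "\<sigma> \<noteq> id" and inc: "\<And>q q'. q < q' \<Longrightarrow> q' < k \<Longrightarrow> I q < I q'" and B: "k < B"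
  shows "(\<Sum>q<k. place B k (I q) (\<sigma> q)) < (\<Sum>q<k. place B k (I q) q)"
proof -
  let ?M = "{q. \<sigma> q \<noteq> q}"
  have Mk: "?M \<subseteq> {..<k}" using \<sigma>(1) by (auto simp: permutes_def)
  then have finM: "finite ?M" by (rule finite_subset) simp
  have Mne: "?M \<noteq> {}" using \<sigma>(2) by (auto simp: fun_eq_iff)
  define m where "m = Max ?M"
  have m: "m \<in> ?M" unfolding m_def by (rule Max_in[OF finM Mne])
  have above: "\<sigma> q = q" if "m < q" for q
    using that Max_ge[OF finM, of q] unfolding m_def by auto
  have mk: "m < k" using m Mk by auto
  have bound: "\<sigma> q \<le> m" if "q \<le> m" for q
  proof (rule ccontr)
    assume "\<not> \<sigma> q \<le> m"
    then have "\<sigma> (\<sigma> q) = \<sigma> q" by (intro above) simp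
    then have "\<sigma> q = q" using permutes_inj[OF \<sigma>(1)] by (auto dest: injD)
    then show False using \<open>\<not> \<sigma> q \<le> m\<close> that by simp
  qed
  have sm: "\<sigma> m < m" using bound[of m] m by auto
  let ?E = "I m * k + m"
  have term_le: "place B k (I q) (\<sigma> q) \<le> B ^ (?E - 1)" if q: "q < Suc m" for q
  proof -
    have "I q * k + \<sigma> q \<le> ?E - 1"
    proof (cases "q = m")
      case False
      then have "Suc (I q) \<le> I m" using inc[of q m] q mk by simp
      then have "Suc (I q) * k \<le> I m * k" by (rule mult_le_mono1)
      moreover have "\<sigma> q < k" using bound[of q] q mk by simp
      ultimately show ?thesis using sm by simp
    qed (use sm in simp)
    then show ?thesis unfolding place_def using B by (intro power_increasing) auto
  qed
  have "(\<Sum>q<Suc m. place B k (I q) (\<sigma> q)) \<le> Suc m * B ^ (?E - 1)"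
    using sum_bounded_above[of "{..<Suc m}" "\<lambda>q. place B k (I q) (\<sigma> q)" "B ^ (?E - 1)"] term_le by simp
  also have "\<dots> < B * B ^ (?E - 1)"
    using mk B by (intro mult_strict_right_mono) auto
  also have "\<dots> = place B k (I m) m"
  proof -
    have "?E = Suc (?E - 1)" using sm by simp
    then have "B ^ ?E = B * B ^ (?E - 1)" by (metis power_Suc)
    then show ?thesis by (simp add: place_def)
  qed
  also have "\<dots> \<le> (\<Sum>q<Suc m. place B k (I q) q)" by (intro member_le_sum) auto
  finally have low: "(\<Sum>q<Suc m. place B k (I q) (\<sigma> q)) < (\<Sum>q<Suc m. place B k (I q) q)" .
  have split: "(\<Sum>q<k. g q) = (\<Sum>q<Suc m. g q) + (\<Sum>q\<in>{Suc m..<k}. g q)" for g :: "nat \<Rightarrow> nat"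
    using mk sum.atLeastLessThan_concat[of 0 "Suc m" k g] by (simp add: atLeast0LessThan)
  have "(\<Sum>q\<in>{Suc m..<k}. place B k (I q) (\<sigma> q)) = (\<Sum>q\<in>{Suc m..<k}. place B k (I q) q)"
    using above by (intro sum.cong) auto
  then show ?thesis unfolding split[of "\<lambda>q. place B k (I q) (\<sigma> q)"] split[of "\<lambda>q. place B k (I q) q"]
    using low by simp
qed

section \<open>Products of minors as polynomials in one variable\<close>

definition bracket_poly :: "nat \<Rightarrow> nat \<Rightarrow> nat \<Rightarrow> (nat \<times> nat \<Rightarrow> nat) \<Rightarrow> complex poly" where
  "bracket_poly B L k w = det_prod L k (\<lambda>b j. monom 1 (place B k (w b) j))"

lemma bracket_poly_expand:
  "bracket_poly B L k w = (\<Sum>s\<in>perm_families L k. smult (sign_prod L s)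
     (monom 1 (\<Sum>b\<in>boxes L k. place B k (w b) (s (fst b) (snd b)))))"
proof -
  have 1: "(\<Prod>b\<in>S. monom 1 (f b)) = monom (1::complex) (\<Sum>b\<in>S. f b)" if "finite S"
    for S :: "(nat \<times> nat) set" and f
    using that by (induction S rule: finite_induct) (auto simp: mult_monom)
  have 2: "(sign_prod L s :: complex poly) = [:sign_prod L s:]" for s
  proof -
    have "(\<Prod>l<n. of_int (sign (s l))) = [:\<Prod>l<n. of_int (sign (s l)) :: complex:]" for n
      by (induction n) (auto simp: of_int_poly)
    then show ?thesis by (simp add: sign_prod_def)
  qed
  show ?thesis unfolding bracket_poly_def det_prod_expand
    by (intro sum.cong refl) (simp add: 1 2)
qed

lemma poly_bracket_poly:
  "poly (bracket_poly B L k w) t = det_prod L k (\<lambda>b j. t ^ place B k (w b) j)"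
proof -
  have "poly (sign_prod L s) t = sign_prod L s" for s
    by (simp add: sign_prod_def poly_prod)
  then show ?thesis
    unfolding bracket_poly_def det_prod_expand by (simp add: poly_sum poly_prod poly_monom)
qed

lemma coeff_bracket_poly:
  "coeff (bracket_poly B L k w) e = (\<Sum>s | s \<in> perm_families L k \<and>
     (\<Sum>b\<in>boxes L k. place B k (w b) (s (fst b) (snd b))) = e. sign_prod L s)"
  unfolding bracket_poly_expand
  by (simp add: coeff_sum coeff_monom sum.inter_filter if_distrib cong: if_cong)

text \<open>Columns of the tableau increase strictly, so by rearrangement only the identity in every
  column attains the top exponent, and its sign is 1. The digits of that exponent are the
  multiplicities \<open>A\<close>.\<close>

lemma bracket_poly_tableau:
  assumes A: "A \<in> standard_matrices L k rs" and B: "k < B"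
  shows "coeff (bracket_poly B L k (tableau A)) (matrix_exponent B k (length rs) A) = 1"
    and "matrix_exponent B k (length rs) A < e \<Longrightarrow> coeff (bracket_poly B L k (tableau A)) e = 0"
proof -
  let ?ex = "\<lambda>s. \<Sum>b\<in>boxes L k. place B k (tableau A b) (s (fst b) (snd b))"
  have tl: "tableau A b < length rs" if "b \<in> boxes L k" for b
    using that tableau_less_length[OF A] by (cases b) (auto simp: boxes_eq)
  define s0 where "s0 = (restrict (\<lambda>_. id) {..<L} :: nat \<Rightarrow> nat \<Rightarrow> nat)"
  have s0: "s0 \<in> perm_families L k" by (auto simp: s0_def perm_families_def permutes_id)
  have "?ex s0 = (\<Sum>b\<in>boxes L k. place B k (tableau A b) (snd b))"
    by (intro sum.cong) (auto simp: s0_def boxes_eq)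
  also have "\<dots> = matrix_exponent B k (length rs) (\<lambda>q a. card {b \<in> boxes L k. tableau A b = a \<and> snd b = q})"
    by (rule sum_place) (auto simp: tl boxes_eq)
  also have "\<dots> = matrix_exponent B k (length rs) A"
    unfolding matrix_exponent_def
  proof (intro sum.cong refl)
    fix j assume "j \<in> {..<length rs * k}"
    then have "j < length rs * k" by simp
    moreover from this have "0 < k" by (cases k) auto
    ultimately have "j mod k < k" "j div k < length rs" by (auto simp: less_mult_imp_div_less)
    then show "card {b \<in> boxes L k. tableau A b = j div k \<and> snd b = j mod k} * B ^ j = A (j mod k) (j div k) * B ^ j"
      using card_tableau[OF A] by simp
  qed
  finally have ex0: "?ex s0 = matrix_exponent B k (length rs) A" .
  have inc: "tableau A (l, q) < tableau A (l, q')" if "l < L" "q < q'" "q' < k" for l q q'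
    using tableau_mono[OF A that] .
  have ex: "?ex s < ?ex s0" if s: "s \<in> perm_families L k" "s \<noteq> s0" for s
  proof -
    have sum: "?ex s = (\<Sum>l<L. \<Sum>q<k. place B k (tableau A (l, q)) (s l q))" for s
      by (simp add: boxes_eq sum.cartesian_product case_prod_beta)
    have sl: "s l permutes {0..<k}" if "l < L" for l using s that by (auto simp: perm_families_def)
    have less: "(\<Sum>q<k. place B k (tableau A (l, q)) (s l q)) < (\<Sum>q<k. place B k (tableau A (l, q)) (s0 l q))"
      if l: "l < L" "s l \<noteq> id" for l
      using place_rearrangement[OF sl[OF l(1)] l(2) inc[OF l(1)] B] l by (simp add: s0_def)
    have "\<exists>l<L. s l \<noteq> id"
    proof (rule ccontr)
      assume "\<not> (\<exists>l<L. s l \<noteq> id)"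
      then have "s = s0" using s(1) by (intro ext) (auto simp: s0_def perm_families_def PiE_iff extensional_def)
      then show False using s by simp
    qed
    moreover have "(\<Sum>q<k. place B k (tableau A (l, q)) (s l q)) \<le> (\<Sum>q<k. place B k (tableau A (l, q)) (s0 l q))"
      if "l < L" for l
    proof (cases "s l = id")
      case False
      then show ?thesis using less[OF that] by simp
    qed (use that in \<open>simp add: s0_def\<close>)
    ultimately show ?thesis unfolding sum using less by (intro sum_strict_mono_ex1) auto
  qed
  have "{s \<in> perm_families L k. ?ex s = matrix_exponent B k (length rs) A} = {s0}"
    using s0 ex ex0 by fastforce
  then show "coeff (bracket_poly B L k (tableau A)) (matrix_exponent B k (length rs) A) = 1"
    unfolding coeff_bracket_poly by (simp add: sign_prod_def s0_def sign_id)
  show "coeff (bracket_poly B L k (tableau A)) e = 0" if "matrix_exponent B k (length rs) A < e"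
  proof -
    have "?ex s \<noteq> e" if "s \<in> perm_families L k" for s
      using ex[OF that] ex0 \<open>_ < e\<close> by (cases "s = s0") auto
    then have "{s \<in> perm_families L k. ?ex s = e} = {}" by blast
    then show ?thesis unfolding coeff_bracket_poly by (simp only: sum.empty)
  qed
qed

text \<open>The exponent of every expanded term counts boxes by letter and chosen column in base
  \<open>B\<close>; \<open>L * k < B\<close> excludes carries. Hence a term meeting the exponent of
  \<open>A\<close> has the multiplicities of \<open>A\<close>, and in particular the content
  \<open>rs\<close>. This later places coefficient vectors in a single weight space.\<close>

lemma bracket_poly_content:
  assumes A: "A \<in> standard_matrices L k rs" and B: "L * k < B" and w: "\<And>b. b \<in> boxes L k \<Longrightarrow> w b < length rs"
    and nz: "coeff (bracket_poly B L k w) (matrix_exponent B k (length rs) A) \<noteq> 0" and a: "a < length rs"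
  shows "letter_count (replicate L k) w a = rs ! a"
proof -
  let ?ex = "\<lambda>s. \<Sum>b\<in>boxes L k. place B k (w b) (s (fst b) (snd b))"
  have "\<exists>s\<in>perm_families L k. ?ex s = matrix_exponent B k (length rs) A"
  proof (rule ccontr)
    assume "\<not> ?thesis"
    then have "{s \<in> perm_families L k. ?ex s = matrix_exponent B k (length rs) A} = {}" by blast
    then show False using nz unfolding coeff_bracket_poly by (simp only: sum.empty)
  qed
  then obtain s where s: "s \<in> perm_families L k" "?ex s = matrix_exponent B k (length rs) A" by blast
  define v where "v b = s (fst b) (snd b)" for b
  have v: "v b < k" if "b \<in> boxes L k" for b using perm_families_less[OF s(1) that] by (simp add: v_def)
  have cardB: "card {b \<in> boxes L k. P b} \<le> L * k" for P
  proof -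
    have "card {b \<in> boxes L k. P b} \<le> card (boxes L k)" by (intro card_mono) auto
    then show ?thesis by (simp add: boxes_eq)
  qed
  have eq: "matrix_exponent B k (length rs) (\<lambda>q a. card {b \<in> boxes L k. w b = a \<and> v b = q}) = matrix_exponent B k (length rs) A"
    using s(2) sum_place[OF w v] by (simp add: v_def)
  have cnt: "card {b \<in> boxes L k. w b = a \<and> v b = q} = A q a" if q: "q < k" for q
  proof -
    have lt2: "A q' a' < B" for q' a'
    proof -
      have "A q' a' \<le> L * k"
      proof (cases "k = 0")
        case False
        then have "L * 1 \<le> L * k" by (intro mult_le_mono2) simp
        then show ?thesis using standard_matrices_le[OF A, of q' a'] by linarith
      qed (use q in simp)
      then show ?thesis using B by simp
    qed
    have lt1: "card {b \<in> boxes L k. P b} < B" for P using cardB[of P] B by simp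
    have "card {b \<in> boxes L k. w b = (a * k + q) div k \<and> v b = (a * k + q) mod k} = A ((a * k + q) mod k) ((a * k + q) div k)"
      by (rule digits_unique[OF eq[unfolded matrix_exponent_def] lt1 lt2 less_mult_index[OF a q]])
    then show ?thesis using q by simp
  qed
  have "letter_count (replicate L k) w a = card (\<Union>q<k. {b \<in> boxes L k. w b = a \<and> v b = q})"
    unfolding letter_count_def using v by (intro arg_cong[where f = card]) auto
  also have "\<dots> = (\<Sum>q<k. card {b \<in> boxes L k. w b = a \<and> v b = q})"
    by (intro card_UN_disjoint) auto
  also have "\<dots> = rs ! a" using A a by (simp add: cnt standard_matrices_def)
  finally show ?thesis .
qed

lemma standard_bracket_polys_independent:
  assumes B: "k < B" "L < B"
    and zero: "(\<Sum>A\<in>standard_matrices L k rs. smult (c A) (bracket_poly B L k (tableau A))) = 0"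
  shows "\<forall>A\<in>standard_matrices L k rs. c A = 0"
proof (rule ccontr)
  let ?e = "matrix_exponent B k (length rs)"
  let ?S = "{A \<in> standard_matrices L k rs. c A \<noteq> 0}"
  assume "\<not> ?thesis"
  then have ne: "?S \<noteq> {}" and fin: "finite ?S" by auto
  then obtain A where A: "A \<in> ?S" "?e A = Max (?e ` ?S)"
    by (metis (no_types, lifting) Max_in finite_imageI image_iff image_is_empty)
  have "c A' * coeff (bracket_poly B L k (tableau A')) (?e A) = (if A' = A then c A else 0)"
    if A': "A' \<in> standard_matrices L k rs" for A'
  proof (cases "A' = A \<or> c A' = 0")
    case True
    then show ?thesis using bracket_poly_tableau(1)[OF A' B(1)] A by auto
  next
    case False
    then have "?e A' \<le> ?e A" using A(2) A' fin by simp
    moreover have "?e A' \<noteq> ?e A" using matrix_exponent_inj[OF A' _ B(2)] A(1) False by blast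
    ultimately show ?thesis using bracket_poly_tableau(2)[OF A' B(1), of "?e A"] False by simp
  qed
  then have "coeff (\<Sum>A\<in>standard_matrices L k rs. smult (c A) (bracket_poly B L k (tableau A))) (?e A)
      = (\<Sum>A'\<in>standard_matrices L k rs. if A' = A then c A else 0)"
    unfolding coeff_sum by (intro sum.cong) auto
  then show False using zero A(1) by simp
qed

section \<open>The invariants and the straightening law\<close>

text \<open>The column sums are the numbers of slots in the factors; the row sums come from
  invariance, which makes every letter occur \<open>L\<close> times.\<close>

lemma letter_matrix_standard:
  assumes T: "T \<in> det_isotypic L k rs" and N: "card (positions rs) = L * k"
    and w: "w \<in> words k rs" "standard_word k rs w" "T (blocks rs w) \<noteq> 0"
  shows "(\<lambda>q a. if q < k \<and> a < length rs then letter_matrix rs w q a else 0) \<in> standard_matrices L k rs"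
proof -
  have part: "(\<Sum>c<i. if q < k \<and> c < length rs then letter_matrix rs w q c else 0)
      = card {x \<in> positions rs. w x = q \<and> fst x < i}" if "q < k" "i \<le> length rs" for q i
  proof -
    have "card {x \<in> positions rs. w x = q \<and> fst x < i} = card (\<Union>c<i. {x \<in> positions rs. w x = q \<and> fst x = c})"
      by (intro arg_cong[where f = card]) auto
    also have "\<dots> = (\<Sum>c<i. letter_matrix rs w q c)"
      unfolding letter_matrix_def by (intro card_UN_disjoint) auto
    also have "\<dots> = (\<Sum>c<i. if q < k \<and> c < length rs then letter_matrix rs w q c else 0)"
      using that by (intro sum.cong) auto
    finally show ?thesis ..
  qed
  show ?thesis
    unfolding standard_matrices_def
  proof (intro CollectI conjI allI impI)
    fix a assume a: "a < length rs"
    have "(\<Sum>q<k. if q < k \<and> a < length rs then letter_matrix rs w q a else 0) = (\<Sum>q<k. letter_matrix rs w q a)"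
      using a by (intro sum.cong) auto
    also have "\<dots> = card (\<Union>q<k. {x \<in> positions rs. w x = q \<and> fst x = a})"
      unfolding letter_matrix_def by (intro card_UN_disjoint[symmetric]) auto
    also have "(\<Union>q<k. {x \<in> positions rs. w x = q \<and> fst x = a}) = Pair a ` {..<rs ! a}"
      using a words_D[OF w(1)] by auto
    also have "card \<dots> = rs ! a" by (simp add: card_image inj_on_def)
    finally show "(\<Sum>q<k. if q < k \<and> a < length rs then letter_matrix rs w q a else 0) = rs ! a" .
  next
    fix q assume q: "q < k"
    have "{x \<in> positions rs. w x = q \<and> fst x < length rs} = {x \<in> positions rs. w x = q}"
      by auto
    then show "(\<Sum>a<length rs. if q < k \<and> a < length rs then letter_matrix rs w q a else 0) = L"
      using part[OF q order_refl] det_isotypic_letter_count[OF T N w(1,3) q] by (simp add: letter_count_def)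
  next
    fix q a assume q: "Suc q < k" and a: "a < length rs"
    have "{x \<in> positions rs. w x = Suc q \<and> fst x < Suc a} = {x \<in> positions rs. w x = Suc q \<and> fst x \<le> a}"
      by auto
    then have "(\<Sum>c<Suc a. if Suc q < k \<and> c < length rs then letter_matrix rs w (Suc q) c else 0)
        = card {x \<in> positions rs. w x = Suc q \<and> fst x \<le> a}"
      using part[OF q, of "Suc a"] a by simp
    also have "\<dots> \<le> card {x \<in> positions rs. w x = q \<and> fst x < a}"
      using w(2) q a by (simp add: standard_word_def)
    also have "\<dots> = (\<Sum>c<a. if q < k \<and> c < length rs then letter_matrix rs w q c else 0)"
      using part[of q a] q a by simp
    finally show "(\<Sum>c<Suc a. if Suc q < k \<and> c < length rs then letter_matrix rs w (Suc q) c else 0)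
        \<le> (\<Sum>c<a. if q < k \<and> c < length rs then letter_matrix rs w q c else 0)" .
  qed auto
qed

text \<open>The choice matters only for matrices read off from some word; elsewhere its arbitrary
  value does no harm.\<close>

definition matrix_word :: "nat \<Rightarrow> nat list \<Rightarrow> (nat \<Rightarrow> nat \<Rightarrow> nat) \<Rightarrow> nat \<times> nat \<Rightarrow> nat" where
  "matrix_word k rs A = (SOME w. w \<in> words k rs \<and> (\<forall>q<k. \<forall>a<length rs. letter_matrix rs w q a = A q a))"

lemma det_isotypic_eq_0:
  assumes T: "T \<in> det_isotypic L k rs" and N: "card (positions rs) = L * k"
    and zero: "\<And>A. A \<in> standard_matrices L k rs \<Longrightarrow> T (blocks rs (matrix_word k rs A)) = 0"
  shows "T = 0"
proof (rule ccontr)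
  assume "T \<noteq> 0"
  then obtain w where w: "w \<in> words k rs" "standard_word k rs w" "T (blocks rs w) \<noteq> 0"
    using det_isotypic_standard_support[OF T N] by blast
  define A where "A = (\<lambda>q a. if q < k \<and> a < length rs then letter_matrix rs w q a else 0)"
  have A: "A \<in> standard_matrices L k rs" unfolding A_def by (rule letter_matrix_standard[OF T N w])
  have "matrix_word k rs A \<in> words k rs \<and> (\<forall>q<k. \<forall>a<length rs. letter_matrix rs (matrix_word k rs A) q a = A q a)"
    unfolding matrix_word_def by (rule someI[of _ w]) (use w in \<open>simp add: A_def\<close>)
  then have "T (blocks rs (matrix_word k rs A)) = T (blocks rs w)"
    by (intro det_isotypic_letter_matrix[OF T _ w(1)]) (auto simp: A_def)
  then show False using zero[OF A] w(3) by simp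
qed

lemma bracket_tensor_in_det_isotypic: "bracket_tensor L k rs I \<in> det_isotypic L k rs"
  unfolding det_isotypic_def using bracket_tensor_sym bracket_tensor_act
  by (auto simp: unitary_group_def)

lemma tableau_box_bijections:
  assumes A: "A \<in> standard_matrices L k rs"
  shows "box_bijections L k rs (tableau A) \<noteq> {}"
proof (rule box_bijections_nonempty)
  fix b assume "b \<in> boxes L k"
  then show "tableau A b < length rs" using tableau_less_length[OF A] by (cases b) (auto simp: boxes_eq)
qed (rule letter_count_tableau[OF A])

text \<open>Restitution along the substitution \<open>place\<close> turns a relation between tensors
  into one between one-variable polynomials with distinct leading exponents; the coefficients change
  only by nonzero counts of bijections.\<close>

lemma bracket_tensors_independent:
  assumes zero: "\<And>J. (\<Sum>A\<in>standard_matrices L k rs. c A * bracket_tensor L k rs (tableau A) J) = 0"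
  shows "\<forall>A\<in>standard_matrices L k rs. c A = 0"
proof -
  define B where "B = Suc (L + k)"
  let ?n = "\<lambda>A. of_nat (card (box_bijections L k rs (tableau A))) :: complex"
  have "poly (\<Sum>A\<in>standard_matrices L k rs. smult (c A * ?n A) (bracket_poly B L k (tableau A))) t = 0" for t
  proof -
    let ?Y = "\<lambda>a q. t ^ place B k a q"
    have "poly (\<Sum>A\<in>standard_matrices L k rs. smult (c A * ?n A) (bracket_poly B L k (tableau A))) t
      = (\<Sum>A\<in>standard_matrices L k rs. c A * (?n A * det_prod L k (\<lambda>b. ?Y (tableau A b))))"
      by (simp add: poly_sum poly_bracket_poly mult.assoc)
    also have "\<dots> = (\<Sum>A\<in>standard_matrices L k rs. \<Sum>w\<in>words k rs.
        (\<Prod>x\<in>positions rs. ?Y (fst x) (w x)) * (c A * bracket_tensor L k rs (tableau A) (blocks rs w)))"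
      unfolding bracket_tensor_polynomial[where Y = ?Y and L = L and k = k and rs = rs, symmetric] sum_distrib_left by (simp add: mult_ac)
    also have "\<dots> = (\<Sum>w\<in>words k rs. (\<Prod>x\<in>positions rs. ?Y (fst x) (w x)) *
        (\<Sum>A\<in>standard_matrices L k rs. c A * bracket_tensor L k rs (tableau A) (blocks rs w)))"
      unfolding sum_distrib_left by (rule sum.swap)
    finally show ?thesis by (simp add: zero)
  qed
  then have "(\<Sum>A\<in>standard_matrices L k rs. smult (c A * ?n A) (bracket_poly B L k (tableau A))) = 0"
    by (intro poly_eq_poly_eq_iff[THEN iffD1] ext) simp
  then have "\<forall>A\<in>standard_matrices L k rs. c A * ?n A = 0"
    by (intro standard_bracket_polys_independent[where B = B]) (auto simp: B_def)
  moreover have "?n A \<noteq> 0" if "A \<in> standard_matrices L k rs" for A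
    using tableau_box_bijections[OF that] by simp
  ultimately show ?thesis by auto
qed

text \<open>The bracket tensor of \<open>I\<close> is an invariant and therefore a combination of
  the standard ones, which form a basis; restitution translates this into determinants. The
  coefficients are chosen before \<open>Y\<close>, so one relation holds for all matrices at
  once.\<close>

lemma straightening:
  assumes N: "card (positions rs) = L * k"
    and I: "\<And>b. b \<in> boxes L k \<Longrightarrow> I b < length rs"
    and cnt: "\<And>a. a < length rs \<Longrightarrow> letter_count (replicate L k) I a = rs ! a"
  shows "\<exists>c. \<forall>Y :: nat \<Rightarrow> nat \<Rightarrow> complex. det_prod L k (\<lambda>b. Y (I b)) =
    (\<Sum>A\<in>standard_matrices L k rs. c A * det_prod L k (\<lambda>b. Y (tableau A b)))"
proof -
  let ?n = "\<lambda>I. of_nat (card (box_bijections L k rs I)) :: complex"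
  have "?n I \<noteq> 0" using box_bijections_nonempty[OF I cnt] by simp
  obtain c where c: "\<And>J. bracket_tensor L k rs I J = (\<Sum>A\<in>standard_matrices L k rs. c A * bracket_tensor L k rs (tableau A) J)"
    using cfun_dim_eq_card(2)[where S = "det_isotypic L k rs" and Z = "standard_matrices L k rs"
        and pt = "\<lambda>A. blocks rs (matrix_word k rs A)" and b = "\<lambda>A. bracket_tensor L k rs (tableau A)"
        and v = "bracket_tensor L k rs I", OF subspace_det_isotypic finite_standard_matrices
        det_isotypic_eq_0[OF _ N] bracket_tensor_in_det_isotypic bracket_tensors_independent bracket_tensor_in_det_isotypic]
    by blast
  have "?n I * det_prod L k (\<lambda>b. Y (I b)) = (\<Sum>A\<in>standard_matrices L k rs. c A * (?n (tableau A) * det_prod L k (\<lambda>b. Y (tableau A b))))" for Y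
  proof -
    have "?n I * det_prod L k (\<lambda>b. Y (I b)) = (\<Sum>w\<in>words k rs. \<Sum>A\<in>standard_matrices L k rs.
        (\<Prod>x\<in>positions rs. Y (fst x) (w x)) * (c A * bracket_tensor L k rs (tableau A) (blocks rs w)))"
      unfolding bracket_tensor_polynomial[symmetric] c sum_distrib_left ..
    also have "\<dots> = (\<Sum>A\<in>standard_matrices L k rs. \<Sum>w\<in>words k rs.
        (\<Prod>x\<in>positions rs. Y (fst x) (w x)) * (c A * bracket_tensor L k rs (tableau A) (blocks rs w)))"
      by (rule sum.swap)
    finally show ?thesis unfolding bracket_tensor_polynomial[symmetric] sum_distrib_left
      by (simp add: mult_ac)
  qed
  then have "det_prod L k (\<lambda>b. Y (I b)) = (\<Sum>A\<in>standard_matrices L k rs. c A * ?n (tableau A) / ?n I * det_prod L k (\<lambda>b. Y (tableau A b)))" for Y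
    using \<open>?n I \<noteq> 0\<close> by (simp add: field_simps sum_divide_distrib[symmetric] eq_divide_eq)
  then show ?thesis by (intro exI[of _ "\<lambda>A. c A * ?n (tableau A) / ?n I"]) blast
qed

text \<open>An intertwiner is determined by its value at 1, which may be any element of
  \<open>det_isotypic\<close>.\<close>

lemma character_multiplicity_det:
  assumes N: "card (positions rs) = L * k"
  shows "character_multiplicity (unitary_group k) (\<lambda>g. det g ^ L) (tensor_act k rs)
    (tensor_product (map (sym_power k) rs)) = card (standard_matrices L k rs)"
proof -
  let ?V = "tensor_product (map (sym_power k) rs)"
  have V: "cfun.subspace ?V" unfolding tensor_product_def by (rule cfun.subspace_span)
  have act: "tensor_act k rs g (\<lambda>i. z * T i) = (\<lambda>i. z * tensor_act k rs g T i)" for g z T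
    by (auto simp: fun_eq_iff tensor_act_def matrix_act_def sum_distrib_left mult_ac)
  have "{\<phi>. Vector_Spaces.linear (*) (\<lambda>c f i. c * f i) \<phi> \<and> range \<phi> \<subseteq> ?V \<and>
         (\<forall>g\<in>unitary_group k. \<forall>z. \<phi> (det g ^ L * z) = tensor_act k rs g (\<phi> z))}
      = {\<phi>. Vector_Spaces.linear (*) (\<lambda>c f i. c * f i) \<phi> \<and> \<phi> 1 \<in> det_isotypic L k rs}" (is "?A = ?B")
  proof (intro equalityI subsetI)
    fix \<phi> assume \<phi>: "\<phi> \<in> ?A"
    then interpret l: Vector_Spaces.linear "(*)" "\<lambda>c f i. c * f i" \<phi> by blast
    have "tensor_act k rs g (\<phi> 1) = (\<lambda>J. det g ^ L * \<phi> 1 J)" if "g \<in> unitary_group k" for g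
    proof -
      have "\<phi> (det g ^ L * 1) = tensor_act k rs g (\<phi> 1)" using \<phi> that by blast
      then show ?thesis by (simp only: l.scale)
    qed
    then show "\<phi> \<in> ?B" using \<phi> by (auto simp: det_isotypic_def)
  next
    fix \<phi> assume \<phi>: "\<phi> \<in> ?B"
    then interpret l: Vector_Spaces.linear "(*)" "\<lambda>c f i. c * f i" \<phi> by blast
    have eval: "\<phi> z = (\<lambda>i. z * \<phi> 1 i)" for z using l.scale[of z 1] by simp
    have iso: "\<phi> 1 \<in> det_isotypic L k rs" using \<phi> by blast
    have "range \<phi> \<subseteq> ?V"
    proof
      fix u assume "u \<in> range \<phi>"
      then obtain z where "u = \<phi> z" by blast
      then have "u = (\<lambda>i. z * \<phi> 1 i)" by (simp only: eval[of z])
      moreover have "\<phi> 1 \<in> ?V" using iso by (simp add: det_isotypic_def)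
      ultimately show "u \<in> ?V" using V by (simp add: cfun.subspace_def)
    qed
    moreover have "\<phi> (det g ^ L * z) = tensor_act k rs g (\<phi> z)" if "g \<in> unitary_group k" for g z
    proof -
      have "tensor_act k rs g (\<phi> z) = (\<lambda>i. z * tensor_act k rs g (\<phi> 1) i)"
        unfolding eval[of z] by (rule act)
      also have "\<dots> = (\<lambda>i. det g ^ L * z * \<phi> 1 i)"
        using iso that by (auto simp: det_isotypic_def fun_eq_iff)
      also have "\<dots> = \<phi> (det g ^ L * z)" by (rule eval[symmetric])
      finally show ?thesis ..
    qed
    ultimately show "\<phi> \<in> ?A" using \<phi> by blast
  qed
  then show ?thesis
    unfolding character_multiplicity_def
    using chom_dim_eq_card[where S = "det_isotypic L k rs" and Z = "standard_matrices L k rs"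
        and pt = "\<lambda>A. blocks rs (matrix_word k rs A)" and b = "\<lambda>A. bracket_tensor L k rs (tableau A)",
        OF subspace_det_isotypic finite_standard_matrices
        det_isotypic_eq_0[OF _ N] bracket_tensor_in_det_isotypic bracket_tensors_independent]
    by simp
qed

section \<open>The Cartan power\<close>

text \<open>The image under \<open>X\<close> of the highest weight vector: its coordinates are
  products of maximal minors of the first \<open>k\<close> columns of \<open>X\<close>. No unitarity
  is required of \<open>X\<close>, so polynomial curves fit in.\<close>

definition plucker_tensor :: "nat \<Rightarrow> nat \<Rightarrow> nat \<Rightarrow> complex mat \<Rightarrow> nat list list \<Rightarrow> complex" where
  "plucker_tensor n k L X J = (if J \<in> multi_indices n (replicate L k)
     then det_prod L k (\<lambda>b j. X $$ (J ! fst b ! snd b, j)) else 0)"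

definition cartan_module :: "nat \<Rightarrow> nat \<Rightarrow> nat \<Rightarrow> (nat list list \<Rightarrow> complex) set" where
  "cartan_module n k L = cfun.span (plucker_tensor n k L ` unitary_group n)"

abbreviation ext_tensors :: "nat \<Rightarrow> nat \<Rightarrow> nat \<Rightarrow> (nat list list \<Rightarrow> complex) set" where
  "ext_tensors n k L \<equiv> tensor_product (replicate L (ext_power n k))"

lemma blocks_box: "b \<in> boxes L k \<Longrightarrow> blocks (replicate L k) w ! fst b ! snd b = w b"
  by (cases b) (auto simp: boxes_eq blocks_nth)

lemma plucker_tensor_blocks:
  assumes "w \<in> words n (replicate L k)"
  shows "plucker_tensor n k L X (blocks (replicate L k) w) = det_prod L k (\<lambda>b j. X $$ (w b, j))"
proof -
  have "det_prod L k (\<lambda>b j. X $$ (blocks (replicate L k) w ! fst b ! snd b, j)) = det_prod L k (\<lambda>b j. X $$ (w b, j))"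
    by (rule det_prod_cong) (simp only: blocks_box)
  then show ?thesis using blocks_words[OF assms] by (simp add: plucker_tensor_def)
qed

lemma plucker_tensor_outside: "J \<notin> multi_indices n (replicate L k) \<Longrightarrow> plucker_tensor n k L X J = 0"
  by (simp add: plucker_tensor_def)

lemma unitary_one: "1\<^sub>m n \<in> unitary_group n"
  by (simp add: unitary_group_def mat_adjoint_one)

lemma unitary_adjoint:
  assumes g: "g \<in> unitary_group n"
  shows "mat_adjoint g \<in> unitary_group n" "mat_adjoint (mat_adjoint g) = g"
proof -
  have c: "g \<in> carrier_mat n n" using g by (simp add: unitary_group_def)
  note ca = mat_adjoint_carrier[OF c]
  show aa: "mat_adjoint (mat_adjoint g) = g"
    by (rule eq_matI) (use c ca mat_adjoint_carrier[OF ca] in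
      \<open>auto simp: mat_adjoint_index[OF ca] mat_adjoint_index[OF c]\<close>)
  have "g * mat_adjoint g = 1\<^sub>m n" using g by (simp add: unitary_group_def)
  then have "mat_adjoint g * g = 1\<^sub>m n" by (rule mat_mult_left_right_inverse[OF c ca])
  then show "mat_adjoint g \<in> unitary_group n" using ca aa by (simp add: unitary_group_def)
qed

lemma unitary_mult:
  assumes g: "g \<in> unitary_group n" and h: "h \<in> unitary_group n"
  shows "g * h \<in> unitary_group n"
proof -
  have c: "g \<in> carrier_mat n n" "h \<in> carrier_mat n n" using g h by (auto simp: unitary_group_def)
  note ca = mat_adjoint_carrier[OF c(1)] mat_adjoint_carrier[OF c(2)]
  have "g * h * mat_adjoint (g * h) = g * h * (mat_adjoint h * mat_adjoint g)"
    by (simp add: mat_adjoint_mult[OF c])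
  also have "\<dots> = g * (h * (mat_adjoint h * mat_adjoint g))"
    by (rule assoc_mult_mat[OF c mult_carrier_mat[OF ca(2,1)]])
  also have "h * (mat_adjoint h * mat_adjoint g) = h * mat_adjoint h * mat_adjoint g"
    by (rule assoc_mult_mat[OF c(2) ca(2,1), symmetric])
  also have "\<dots> = mat_adjoint g" using h ca by (simp add: unitary_group_def)
  also have "g * mat_adjoint g = 1\<^sub>m n" using g by (simp add: unitary_group_def)
  finally show ?thesis using c by (simp add: unitary_group_def)
qed

context
  fixes n k L :: nat
  assumes kn: "k \<le> n"
begin

private abbreviation (input) "ks \<equiv> replicate L k"
private abbreviation (input) "hw \<equiv> plucker_tensor n k L (1\<^sub>m n)"
private abbreviation (input) "V \<equiv> cartan_module n k L"

lemma hw_blocks: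
  assumes "w \<in> words n ks"
  shows "hw (blocks ks w) = eps_prod L k w"
  unfolding plucker_tensor_blocks[OF assms] eps_prod_eq_det_prod
  using words_D[OF assms] kn by (intro det_prod_cong) auto

lemma eps_prod_big:
  assumes "b \<in> boxes L k" "\<not> w b < k"
  shows "eps_prod L k w = 0"
  unfolding eps_prod_eq_det_prod det_prod_expand
proof (intro sum.neutral ballI)
  fix s assume s: "s \<in> perm_families L k"
  have "w b \<noteq> s (fst b) (snd b)" using perm_families_less[OF s assms(1)] assms(2) by auto
  then have "(\<Prod>b\<in>boxes L k. if w b = s (fst b) (snd b) then 1 else 0) = (0::complex)"
    using assms(1) by (intro prod_zero) (auto intro!: bexI[of _ b])
  then show "sign_prod L s * (\<Prod>b\<in>boxes L k. if w b = s (fst b) (snd b) then 1 else 0) = (0::complex)"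
    by simp
qed

text \<open>The multilinear expansion of the determinants, read with boxes themselves as
  slots.\<close>

lemma tensor_act_hw:
  assumes X: "X \<in> carrier_mat n n"
  shows "tensor_act n ks X hw = plucker_tensor n k L X"
proof (rule multi_indices_ext[where d = n and ks = ks])
  fix w assume w: "w \<in> words n ks"
  have "tensor_act n ks X hw (blocks ks w)
      = (\<Sum>w'\<in>boxes L k \<rightarrow>\<^sub>E {..<n}. (\<Prod>b\<in>boxes L k. X $$ (w b, w' b)) * eps_prod L k (\<lambda>b. w' (id b)))"
    by (simp add: tensor_act_blocks[OF w] hw_blocks)
  also have "\<dots> = det_prod L k (\<lambda>b j. X $$ (w (id b), j))"
    by (rule det_prod_eq_sum_eps_prod[symmetric, where Y = "\<lambda>b j. X $$ (w b, j)"]) (use kn in \<open>auto simp: bij_betw_def\<close>)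
  finally show "tensor_act n ks X hw (blocks ks w) = plucker_tensor n k L X (blocks ks w)"
    by (simp add: plucker_tensor_blocks[OF w])
qed (simp add: tensor_act_outside plucker_tensor_outside)

lemma tensor_act_plucker:
  assumes X: "X \<in> carrier_mat n n" and Y: "Y \<in> carrier_mat n n"
  shows "tensor_act n ks X (plucker_tensor n k L Y) = plucker_tensor n k L (X * Y)"
  using tensor_act_mult[OF X Y, of ks hw] tensor_act_hw[OF Y] tensor_act_hw[OF mult_carrier_mat[OF X Y]] by simp

lemma plucker_tensor_ext: "plucker_tensor n k L X \<in> ext_tensors n k L"
proof -
  define f where "f I = (if I \<in> multi_index n k then det_fun k (\<lambda>q j. X $$ (I ! q, j)) else 0)" for I
  have "f \<in> ext_power n k"
    unfolding ext_power_def
  proof (intro CollectI conjI allI impI ballI)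
    fix I p assume I: "I \<in> multi_index n k" and p: "p permutes {..<k}"
    have len: "length I = k" using I by (simp add: multi_index_iff)
    have "permute_list p I \<in> multi_index n k"
      using I p permutes_in_image[OF p] by (auto simp: multi_index_iff permute_list_nth)
    moreover have "det_fun k (\<lambda>q j. X $$ (permute_list p I ! q, j)) = det_fun k (\<lambda>q j. X $$ (I ! p q, j))"
      unfolding det_fun_expand
      by (intro sum.cong prod.cong arg_cong2[where f = "(*)"] refl) (use p len in \<open>simp add: permute_list_nth\<close>)
    ultimately show "f (permute_list p I) = of_int (sign p) * f I"
      using I det_fun_permute[OF p, of "\<lambda>i j. X $$ (I ! i, j)"] by (simp add: f_def)
  qed (simp add: f_def)
  have "plucker_tensor n k L X = pure_tensor (replicate L f)"
  proof (rule multi_indices_ext[where d = n and ks = ks])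
    fix J assume J: "J \<notin> multi_indices n ks"
    show "plucker_tensor n k L X J = pure_tensor (replicate L f) J"
    proof (cases "length J = L")
      case True
      then obtain a where "a < L" "J ! a \<notin> multi_index n k" using J by (auto simp: listset_iff)
      then show ?thesis using J True
        by (auto simp: plucker_tensor_outside pure_tensor_eq f_def intro!: prod_zero[symmetric] bexI[of _ a])
    qed (use J in \<open>simp add: plucker_tensor_outside pure_tensor_def\<close>)
  next
    fix w assume w: "w \<in> words n ks"
    have "(\<lambda>I. f I) (blocks ks w ! l) = det_fun k (\<lambda>q j. X $$ (w (l, q), j))" if l: "l < L" for l
    proof -
      have "blocks ks w ! l \<in> multi_index n k" using blocks_words[OF w] l by (auto simp: listset_iff)
      moreover have "det_fun k (\<lambda>q j. X $$ (blocks ks w ! l ! q, j)) = det_fun k (\<lambda>q j. X $$ (w (l, q), j))"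
        unfolding det_fun_expand
        by (intro sum.cong prod.cong arg_cong2[where f = "(*)"] refl) (use l in \<open>simp add: blocks_nth\<close>)
      ultimately show ?thesis by (simp add: f_def)
    qed
    then show "plucker_tensor n k L X (blocks ks w) = pure_tensor (replicate L f) (blocks ks w)"
      by (simp add: plucker_tensor_blocks[OF w] pure_tensor_eq det_prod_def)
  qed
  also have "\<dots> \<in> ext_tensors n k L"
    unfolding tensor_product_def using \<open>f \<in> _\<close>
    by (intro cfun.span_base imageI) (auto simp: listset_iff)
  finally show ?thesis .
qed

lemma cartan_module_ext: "V \<subseteq> ext_tensors n k L"
proof -
  have "cfun.subspace (ext_tensors n k L)" unfolding tensor_product_def by (rule cfun.subspace_span)
  then show ?thesis unfolding cartan_module_def
    by (intro cfun.span_minimal) (auto simp: plucker_tensor_ext)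
qed

lemma hw_in_module: "hw \<in> V"
  unfolding cartan_module_def using unitary_one by (intro cfun.span_base) blast

lemma subspace_tensor_act_vimage:
  assumes "cfun.subspace W"
  shows "cfun.subspace {u. tensor_act n ks g u \<in> W}"
proof -
  interpret l: Vector_Spaces.linear "\<lambda>c f i. c * f i" "\<lambda>c f i. c * f i" "tensor_act n ks g"
    by (rule tensor_act_linear)
  show ?thesis
    using assms unfolding cfun.subspace_def mem_Collect_eq l.zero l.add l.scale by blast
qed

lemma invariant_cartan_module: "invariant_subspace (unitary_group n) (tensor_act n ks) V"
proof -
  have sub: "cfun.subspace V" unfolding cartan_module_def by (rule cfun.subspace_span)
  have "V \<subseteq> {u. tensor_act n ks g u \<in> V}" if g: "g \<in> unitary_group n" for g
    unfolding cartan_module_def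
  proof (rule cfun.span_minimal)
    show "cfun.subspace {u. tensor_act n ks g u \<in> cfun.span (plucker_tensor n k L ` unitary_group n)}"
      by (intro subspace_tensor_act_vimage cfun.subspace_span)
    show "plucker_tensor n k L ` unitary_group n \<subseteq> {u. tensor_act n ks g u \<in> cfun.span (plucker_tensor n k L ` unitary_group n)}"
    proof (intro image_subsetI CollectI)
      fix h assume h: "h \<in> unitary_group n"
      have "tensor_act n ks g (plucker_tensor n k L h) = plucker_tensor n k L (g * h)"
        using g h by (intro tensor_act_plucker) (auto simp: unitary_group_def)
      then show "tensor_act n ks g (plucker_tensor n k L h) \<in> cfun.span (plucker_tensor n k L ` unitary_group n)"
        using unitary_mult[OF g h] by (auto intro: cfun.span_base)
    qed
  qed
  then show ?thesis using sub unfolding invariant_subspace_def by blast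
qed

section \<open>Highest weight, irreducibility and uniqueness of the Cartan module\<close>

lemma ext_tensors_outside: "u \<in> ext_tensors n k L \<Longrightarrow> J \<notin> multi_indices n ks \<Longrightarrow> u J = 0"
  by (rule tensor_product_ext_outside)

text \<open>On words in the first \<open>k\<close> letters both sides are \<open>eps_prod\<close>
  times the one free coordinate, and elsewhere both vanish. Irreducibility and uniqueness both
  recover \<open>hw\<close> through this.\<close>

lemma ext_tensors_small:
  assumes u: "u \<in> ext_tensors n k L"
    and supp: "\<And>w b. w \<in> words n ks \<Longrightarrow> u (blocks ks w) \<noteq> 0 \<Longrightarrow> b \<in> boxes L k \<Longrightarrow> w b < k"
  shows "u = (\<lambda>J. u (blocks ks snd) * hw J)"
proof (rule multi_indices_ext[where d = n and ks = ks])
  fix w assume w: "w \<in> words n ks"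
  show "u (blocks ks w) = u (blocks ks snd) * hw (blocks ks w)"
  proof (cases "\<forall>b\<in>boxes L k. w b < k")
    case True
    then show ?thesis using tensor_product_ext_eps[OF u w _ kn] hw_blocks[OF w] by simp
  next
    case False
    then obtain b where "b \<in> boxes L k" "\<not> w b < k" by blast
    then show ?thesis using supp[OF w] eps_prod_big[of b w] hw_blocks[OF w] by fastforce
  qed
qed (use ext_tensors_outside[OF u] in \<open>simp add: plucker_tensor_outside\<close>)

lemma snd_word: "restrict snd (boxes L k) \<in> words n ks"
  using kn by (auto simp: boxes_eq)

lemma hw_snd: "hw (blocks ks snd) = 1"
proof -
  have "hw (blocks ks snd) = hw (blocks ks (restrict snd (boxes L k)))"
    by (intro arg_cong[where f = hw] blocks_cong) simp
  also have "\<dots> = eps_prod L k snd"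
    unfolding hw_blocks[OF snd_word] by (rule eps_prod_cong) simp
  also have "\<dots> = 1"
    unfolding eps_prod_def using eps_permutation[OF permutes_id, of k id] by (simp add: sign_id id_def)
  finally show ?thesis .
qed

lemma weight_space_ext_iff:
  assumes "U \<subseteq> ext_tensors n k L"
  shows "u \<in> weight_space n (tensor_act n ks) U \<mu> \<longleftrightarrow> u \<in> U \<and>
    (\<forall>w\<in>words n ks. u (blocks ks w) \<noteq> 0 \<longrightarrow> (\<forall>i\<in>{1..n}. \<mu> i = int (letter_count ks w (i - 1))))"
  using assms ext_tensors_outside by (intro weight_space_iff) blast

private abbreviation (input) "top_weight \<equiv> (\<lambda>i. if i \<le> k then int L else 0)"

text \<open>Within one exterior factor the letters of a word in the support are distinct, so that
  factor has at most \<open>card (P \<inter> {..<n})\<close> of its letters in \<open>P\<close>. For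
  initial segments \<open>P\<close> this is dominance of weights.\<close>

lemma ext_tensors_partial_count:
  assumes u: "u \<in> ext_tensors n k L" and w: "w \<in> words n ks" and nz: "u (blocks ks w) \<noteq> 0"
  shows "card {b \<in> boxes L k. w b \<in> P} \<le> L * card (P \<inter> {..<n})"
proof -
  have "{b \<in> boxes L k. w b \<in> P} = (SIGMA l:{..<L}. {q. q < k \<and> w (l, q) \<in> P})" by (auto simp: boxes_eq)
  then have "card {b \<in> boxes L k. w b \<in> P} = (\<Sum>l<L. card {q. q < k \<and> w (l, q) \<in> P})" by simp
  also have "\<dots> \<le> (\<Sum>l<L. card (P \<inter> {..<n}))"
  proof (rule sum_mono)
    fix l assume l: "l \<in> {..<L}"
    have "inj_on (\<lambda>q. w (l, q)) {q. q < k \<and> w (l, q) \<in> P}"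
      using tensor_product_ext_repeated[OF u w] nz l by (auto intro!: inj_onI)
    moreover have "(\<lambda>q. w (l, q)) ` {q. q < k \<and> w (l, q) \<in> P} \<subseteq> P \<inter> {..<n}"
      using words_D[OF w] l by (auto simp: boxes_eq)
    ultimately show "card {q. q < k \<and> w (l, q) \<in> P} \<le> card (P \<inter> {..<n})"
      by (intro card_inj_on_le) auto
  qed
  finally show ?thesis by simp
qed

lemma sum_letter_count: "(\<Sum>j<p. letter_count ks w j) = card {b \<in> boxes L k. w b < p}"
proof -
  have "{b \<in> boxes L k. w b < p} = (\<Union>j<p. {b \<in> boxes L k. w b = j})" by auto
  then have "card {b \<in> boxes L k. w b < p} = (\<Sum>j<p. card {b \<in> boxes L k. w b = j})"
    by (simp only:) (intro card_UN_disjoint, auto)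
  then show ?thesis by (simp add: letter_count_def)
qed

text \<open>In a word of the support all letters are \<open>< k\<close> and each occurs at most
  \<open>L\<close> times; as there are \<open>L * k\<close> boxes, each occurs exactly
  \<open>L\<close> times.\<close>

lemma hw_weight: "hw \<in> weight_space n (tensor_act n ks) V top_weight"
  unfolding weight_space_ext_iff[OF cartan_module_ext]
proof (intro conjI hw_in_module ballI impI)
  fix w i assume w: "w \<in> words n ks" and nz: "hw (blocks ks w) \<noteq> 0" and i: "i \<in> {1..n}"
  have small: "w b < k" if "b \<in> boxes L k" for b
    using eps_prod_big[OF that] nz hw_blocks[OF w] by auto
  have le: "letter_count ks w j \<le> L" if "j < n" for j
    using ext_tensors_partial_count[OF plucker_tensor_ext w nz, of "{j}"] that by (simp add: letter_count_def Int_absorb2)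
  have "{b \<in> boxes L k. w b < k} = boxes L k" using small by blast
  then have "(\<Sum>j<k. letter_count ks w j) = card (boxes L k)" using sum_letter_count[where p = k and w = w] by simp
  also have "\<dots> = (\<Sum>j<k. L)" by (simp add: boxes_eq)
  finally have tot: "(\<Sum>j<k. letter_count ks w j) = (\<Sum>j<k. L)" .
  show "top_weight i = int (letter_count ks w (i - 1))"
  proof (cases "i \<le> k")
    case True
    have "letter_count ks w (i - 1) = L"
    proof (rule ccontr)
      assume "letter_count ks w (i - 1) \<noteq> L"
      moreover have "i - 1 < k" "i - 1 < n" using i True by auto
      ultimately have "\<exists>j\<in>{..<k}. letter_count ks w j < L"
        using le[of "i - 1"] by (intro bexI[of _ "i - 1"]) auto
      then have "(\<Sum>j<k. letter_count ks w j) < (\<Sum>j<k. L)"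
        using le kn by (intro sum_strict_mono_ex1) auto
      then show False using tot by simp
    qed
    then show ?thesis using True by simp
  next
    case False
    then have "{b \<in> boxes L k. w b = i - 1} = {}" using small by fastforce
    then show ?thesis using False by (simp add: letter_count_def)
  qed
qed

lemma hw_nonzero: "hw \<noteq> 0"
proof
  assume "hw = 0"
  then have "hw (blocks ks snd) = 0" by simp
  then show False using hw_snd by simp
qed

lemma has_highest_weight_cartan_module: "has_highest_weight n (tensor_act n ks) V top_weight"
  unfolding has_highest_weight_def
proof (intro conjI allI impI)
  show "weight_space n (tensor_act n ks) V top_weight \<noteq> {0}"
    using hw_weight hw_nonzero by blast
next
  fix \<mu> assume ne: "weight_space n (tensor_act n ks) V \<mu> \<noteq> {0}"
  have sub: "cfun.subspace V" unfolding cartan_module_def by (rule cfun.subspace_span)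
  have "0 \<in> weight_space n (tensor_act n ks) V \<mu>"
    unfolding weight_space_ext_iff[OF cartan_module_ext] using sub by (simp add: cfun.subspace_def)
  then obtain u where u: "u \<in> weight_space n (tensor_act n ks) V \<mu>" "u \<noteq> 0" using ne by blast
  then have uV: "u \<in> V" and wt: "\<And>w i. w \<in> words n ks \<Longrightarrow> u (blocks ks w) \<noteq> 0 \<Longrightarrow> i \<in> {1..n} \<Longrightarrow> \<mu> i = int (letter_count ks w (i - 1))"
    unfolding weight_space_ext_iff[OF cartan_module_ext] by auto
  have uE: "u \<in> ext_tensors n k L" using uV cartan_module_ext by blast
  have "\<exists>w\<in>words n ks. u (blocks ks w) \<noteq> 0"
  proof (rule ccontr)
    assume "\<not> ?thesis"
    then have "u = 0" using ext_tensors_outside[OF uE] by (intro multi_indices_ext[where d = n and ks = ks]) auto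
    then show False using u by simp
  qed
  then obtain w where w: "w \<in> words n ks" and nz: "u (blocks ks w) \<noteq> 0" by blast
  define S where "S p = (\<Sum>j<p. letter_count ks w j)" for p
  \<comment> \<open>Summation by parts: the coefficient of the simple root \<open>p\<close> is the
    difference of the partial sums up to \<open>p\<close> of the two weights. Dominance makes the
    subtraction of naturals exact.\<close>
  define c where "c p = L * min p k - S p" for p
  have Sle: "S p \<le> L * min p k" if "p \<le> n" for p
  proof -
    have "{..<p} \<inter> {..<n} = {..<p}" using that by auto
    then have "S p \<le> L * p"
      using ext_tensors_partial_count[OF uE w nz, of "{..<p}"] by (simp add: S_def sum_letter_count)
    moreover have "S p \<le> card (boxes L k)"
      unfolding S_def sum_letter_count by (intro card_mono) auto
    ultimately show ?thesis by (auto simp: boxes_eq min_def)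
  qed
  have Sn: "S n = L * k"
  proof -
    have "{b \<in> boxes L k. w b < n} = boxes L k" using words_D[OF w] by blast
    then show ?thesis unfolding S_def sum_letter_count by (simp add: boxes_eq)
  qed
  have c: "int (c p) = int (L * min p k) - int (S p)" if "p \<le> n" for p
    using Sle[OF that] by (simp add: c_def of_nat_diff)
  show "\<exists>c :: nat \<Rightarrow> nat. \<forall>i\<in>{1..n}. top_weight i - \<mu> i = (\<Sum>p = 1..<n. int (c p) * simple_root p i)"
  proof (intro exI[of _ c] ballI)
    fix i assume i: "i \<in> {1..n}"
    then obtain i' where i': "i = Suc i'" by (cases i) auto
    have "(\<Sum>p = 1..<n. int (c p) * simple_root p i)
       = (\<Sum>p = 1..<n. (if p = i then int (c p) else 0) - (if p = i' then int (c p) else 0))"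
      by (intro sum.cong refl) (auto simp: simple_root_def i')
    also have "\<dots> = (if i < n then int (c i) else 0) - (if 1 \<le> i' then int (c i') else 0)"
      using i i' by (simp add: sum_subtractf)
    \<comment> \<open>There is no simple root with index \<open>n\<close> or 0, and correspondingly
      \<open>c n = 0\<close>, because both weights have total \<open>L * k\<close>, and
      \<open>c 0 = 0\<close>.\<close>
    also have "(if i < n then int (c i) else 0) = int (c i)"
      using c[of n] Sn i kn by (cases "i = n") (auto simp: min_def)
    also have "(if 1 \<le> i' then int (c i') else 0) = int (c i')"
      using c[of 0] by (cases i') (auto simp: S_def)
    also have "int (c i) - int (c i') = int (L * min i k) - int (L * min i' k) - int (letter_count ks w i')"
      using c[of i] c[of i'] i i' by (simp add: S_def)
    also have "int (L * min i k) - int (L * min i' k) = top_weight i"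
    proof (cases "i \<le> k")
      case True
      then have "L * min i k = L * min i' k + L" using i' by (simp add: min_def)
      then show ?thesis using True by simp
    qed (simp add: i' min_def)
    finally show "top_weight i - \<mu> i = (\<Sum>p = 1..<n. int (c p) * simple_root p i)"
      using wt[OF w nz i] i' by simp
  qed
qed

lemma hw_generates:
  assumes W: "invariant_subspace (unitary_group n) (tensor_act n ks) W" and hw: "hw \<in> W"
  shows "V \<subseteq> W"
  unfolding cartan_module_def
proof (rule cfun.span_minimal)
  show "cfun.subspace W" using W by (simp add: invariant_subspace_def)
  show "plucker_tensor n k L ` unitary_group n \<subseteq> W"
  proof (intro image_subsetI)
    fix g assume g: "g \<in> unitary_group n"
    then have "tensor_act n ks g hw \<in> W" using W hw by (simp add: invariant_subspace_def)
    then show "plucker_tensor n k L g \<in> W"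
      using tensor_act_hw[of g] g by (simp add: unitary_group_def)
  qed
qed

text \<open>If every translate had coordinate 0 at \<open>snd\<close>, all translates would be
  orthogonal to \<open>hw\<close>. Moving the group element across the form makes \<open>u\<close>
  orthogonal to the orbit of \<open>hw\<close>, hence to all of the module and to itself.\<close>

lemma exists_unitary_translate:
  assumes u: "u \<in> V" and u0: "u \<noteq> 0"
  obtains g where "g \<in> unitary_group n" "tensor_act n ks g u (blocks ks snd) \<noteq> 0"
proof -
  have "\<exists>g\<in>unitary_group n. tensor_act n ks g u (blocks ks snd) \<noteq> 0"
  proof (rule ccontr)
    assume "\<not> ?thesis"
    then have zero: "tensor_act n ks g u (blocks ks snd) = 0" if "g \<in> unitary_group n" for g
      using that by blast
    have "tensor_inner n ks u (plucker_tensor n k L h) = 0" if h: "h \<in> unitary_group n" for h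
    proof -
      let ?g = "mat_adjoint h"
      have g: "?g \<in> unitary_group n" by (rule unitary_adjoint(1)[OF h])
      have c: "?g \<in> carrier_mat n n" "h \<in> carrier_mat n n" using g h by (auto simp: unitary_group_def)
      have gu: "tensor_act n ks ?g u \<in> ext_tensors n k L"
        using invariant_cartan_module g u cartan_module_ext by (auto simp: invariant_subspace_def)
      have "tensor_inner n ks (tensor_act n ks ?g u) hw = 0"
        unfolding tensor_inner_def
      proof (intro sum.neutral ballI)
        fix w assume w: "w \<in> words n ks"
        show "tensor_act n ks ?g u (blocks ks w) * cnj (hw (blocks ks w)) = 0"
        proof (cases "\<forall>b\<in>boxes L k. w b < k")
          case True
          then show ?thesis using tensor_product_ext_eps[OF gu w _ kn] zero[OF g] by simp
        next
          case False
          then show ?thesis using eps_prod_big hw_blocks[OF w] by auto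
        qed
      qed
      then show ?thesis
        using tensor_inner_adjoint[OF c(1), of ks u hw] tensor_act_hw[OF c(2)]
        by (simp add: unitary_adjoint(2)[OF h])
    qed
    moreover have "cfun.subspace {v. tensor_inner n ks u v = 0}"
      by (auto simp: cfun.subspace_def tensor_inner_def distrib_left sum.distrib mult.left_commute sum_distrib_left[symmetric])
    ultimately have "V \<subseteq> {v. tensor_inner n ks u v = 0}"
      unfolding cartan_module_def by (intro cfun.span_minimal) auto
    then have "tensor_inner n ks u u = 0" using u by blast
    then have "u (blocks ks w) = 0" if "w \<in> words n ks" for w using tensor_inner_self_zero that by blast
    moreover have "u J = 0" if "J \<notin> multi_indices n ks" for J
      using ext_tensors_outside u cartan_module_ext that by blast
    ultimately have "u = 0" by (intro multi_indices_ext[where d = n and ks = ks]) auto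
    then show False using u0 by simp
  qed
  then show ?thesis using that by blast
qed

lemma irreducible_cartan_module: "irreducible_rep (unitary_group n) (tensor_act n ks) V"
  unfolding irreducible_rep_def
proof (intro conjI allI impI)
  show "invariant_subspace (unitary_group n) (tensor_act n ks) V" by (rule invariant_cartan_module)
  show "V \<noteq> {0}" using hw_in_module hw_nonzero by blast
  fix W assume WV: "W \<subseteq> V" and W: "invariant_subspace (unitary_group n) (tensor_act n ks) W"
  have sub: "cfun.subspace W" using W by (simp add: invariant_subspace_def)
  show "W = {0} \<or> W = V"
  proof (cases "W = {0}")
    case False
    moreover have "0 \<in> W" using sub by (simp add: cfun.subspace_def)
    ultimately obtain u where u: "u \<in> W" "u \<noteq> 0" by blast
    obtain g where g: "g \<in> unitary_group n" "tensor_act n ks g u (blocks ks snd) \<noteq> 0"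
      using exists_unitary_translate u WV by blast
    define u' where "u' = tensor_act n ks g u"
    have u': "u' \<in> W" using W u g by (simp add: u'_def invariant_subspace_def)
    \<comment> \<open>The projection to the first \<open>k\<close> coordinates is singular, but
      \<open>W\<close> is stable under it by density. It erases every coordinate containing a later
      letter, leaving a multiple of \<open>hw\<close> with nonzero factor.\<close>
    define X where "X = mat n n (\<lambda>(i, j). if i = j \<and> i < k then 1 else 0 :: complex)"
    have X: "X \<in> carrier_mat n n" "diagonal_mat X" by (auto simp: X_def diagonal_mat_def)
    define u'' where "u'' = tensor_act n ks X u'"
    have u'': "u'' \<in> W" unfolding u''_def by (rule invariant_under_all_matrices[OF W u' X(1)])
    have val: "u'' (blocks ks w) = (\<Prod>b\<in>boxes L k. X $$ (w b, w b)) * u' (blocks ks w)" if "w \<in> words n ks" for w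
      unfolding u''_def by (rule tensor_act_diagonal[OF X that])
    have "u'' = (\<lambda>J. u'' (blocks ks snd) * hw J)"
    proof (rule ext_tensors_small)
      show "u'' \<in> ext_tensors n k L" using u'' WV cartan_module_ext by blast
      fix w b assume w: "w \<in> words n ks" and nz: "u'' (blocks ks w) \<noteq> 0" and b: "b \<in> boxes L k"
      then have "X $$ (w b, w b) \<noteq> 0" using val[OF w] by (auto simp: prod_zero_iff)
      then show "w b < k" using words_D[OF w b] by (auto simp: X_def split: if_splits)
    qed
    moreover have "u'' (blocks ks snd) = u' (blocks ks snd)"
    proof -
      have "blocks ks snd = blocks ks (restrict snd (boxes L k))" by (intro blocks_cong) simp
      moreover have "(\<Prod>b\<in>boxes L k. X $$ (restrict snd (boxes L k) b, restrict snd (boxes L k) b)) = 1"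
        using kn by (intro prod.neutral) (auto simp: X_def boxes_eq)
      ultimately show ?thesis using val[OF snd_word] by simp
    qed
    ultimately have "u'' J = u' (blocks ks snd) * hw J" for J by metis
    then have "(\<lambda>J. inverse (u' (blocks ks snd)) * u'' J) = hw"
      using g(2) by (simp add: u'_def)
    then have "hw \<in> W" using u'' sub by (metis cfun.subspace_def)
    then have "V \<subseteq> W" by (rule hw_generates[OF W])
    then show ?thesis using WV by blast
  qed simp
qed

lemma cartan_power_ext_eq: "cartan_power_ext n k L = V"
  unfolding cartan_power_ext_def
proof (rule the_equality)
  show "V \<subseteq> ext_tensors n k L \<and> irreducible_rep (unitary_group n) (tensor_act n ks) V
    \<and> has_highest_weight n (tensor_act n ks) V top_weight"
    using cartan_module_ext irreducible_cartan_module has_highest_weight_cartan_module by blast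
next
  fix U assume U: "U \<subseteq> ext_tensors n k L \<and> irreducible_rep (unitary_group n) (tensor_act n ks) U
    \<and> has_highest_weight n (tensor_act n ks) U top_weight"
  then have UE: "U \<subseteq> ext_tensors n k L" and inv: "invariant_subspace (unitary_group n) (tensor_act n ks) U"
    and irr: "\<And>W. W \<subseteq> U \<Longrightarrow> invariant_subspace (unitary_group n) (tensor_act n ks) W \<Longrightarrow> W = {0} \<or> W = U"
    and hwt: "weight_space n (tensor_act n ks) U top_weight \<noteq> {0}"
    by (auto simp: irreducible_rep_def has_highest_weight_def)
  have sub: "cfun.subspace U" using inv by (simp add: invariant_subspace_def)
  have "0 \<in> weight_space n (tensor_act n ks) U top_weight"
    unfolding weight_space_ext_iff[OF UE] using sub by (simp add: cfun.subspace_def)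
  then obtain u where u: "u \<in> weight_space n (tensor_act n ks) U top_weight" "u \<noteq> 0" using hwt by blast
  then have uU: "u \<in> U" and wt: "\<And>w i. w \<in> words n ks \<Longrightarrow> u (blocks ks w) \<noteq> 0 \<Longrightarrow> i \<in> {1..n} \<Longrightarrow> top_weight i = int (letter_count ks w (i - 1))"
    unfolding weight_space_ext_iff[OF UE] by auto
  \<comment> \<open>The top weight excludes letters \<open>>= k\<close>, so a vector of that weight
    has only the one free coordinate and is a multiple of \<open>hw\<close>. Thus \<open>U\<close>
    contains the module generated by \<open>hw\<close>, and irreducibility of \<open>U\<close> gives
    equality.\<close>
  have u_eq: "u = (\<lambda>J. u (blocks ks snd) * hw J)"
  proof (rule ext_tensors_small)
    show "u \<in> ext_tensors n k L" using uU UE by blast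
    fix w b assume w: "w \<in> words n ks" and nz: "u (blocks ks w) \<noteq> 0" and b: "b \<in> boxes L k"
    show "w b < k"
    proof (rule ccontr)
      assume "\<not> w b < k"
      then have "letter_count ks w (w b) = 0" using wt[OF w nz, of "Suc (w b)"] words_D[OF w b] by simp
      then have "{x \<in> boxes L k. w x = w b} = {}" by (simp only: letter_count_def card_eq_0_iff) simp
      then show False using b by blast
    qed
  qed
  define z where "z = u (blocks ks snd)"
  have uz: "u J = z * hw J" for J unfolding z_def by (rule fun_cong[OF u_eq])
  have "z \<noteq> 0"
  proof
    assume "z = 0"
    then have "u = 0" by (intro ext) (simp add: uz)
    then show False using u by simp
  qed
  then have "inverse z * u J = hw J" for J by (simp add: uz)
  then have "(\<lambda>J. inverse z * u J) = hw" by blast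
  then have "hw \<in> U" using uU sub by (metis cfun.subspace_def)
  then have "V \<subseteq> U" by (rule hw_generates[OF inv])
  then show "U = V" using irr[OF _ invariant_cartan_module] hw_in_module hw_nonzero by blast
qed

text \<open>Straightening shows that the coordinates at standard tableaux determine a weight vector.
  In the other direction the coefficients of a curve of translates are weight vectors, and their
  values at the tableaux are triangular in the order of exponents.\<close>

lemma cartan_weight_multiplicity:
  assumes rs: "length rs = n" "card (positions rs) = L * k"
    and \<mu>: "\<And>i. i \<in> {1..n} \<Longrightarrow> \<mu> i = int (rs ! (i - 1))"
  shows "weight_multiplicity n (tensor_act n ks) V \<mu> = card (standard_matrices L k rs)"
proof -
  let ?S = "weight_space n (tensor_act n ks) V \<mu>"
  define B where "B = Suc (L * k + L + k)"
  have B: "k < B" "L < B" "L * k < B" by (auto simp: B_def)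
  let ?e = "matrix_exponent B k n"
  \<comment> \<open>The coordinates of the curve of Plucker tensors of the matrices with entries
    \<open>t ^ place B k a j\<close>, as polynomials in \<open>t\<close>.\<close>
  define q where "q J = (if J \<in> multi_indices n ks then bracket_poly B L k (\<lambda>b. J ! fst b ! snd b) else 0)" for J
  have q: "q (blocks ks w) = bracket_poly B L k w" if "w \<in> words n ks" for w
  proof -
    have "bracket_poly B L k (\<lambda>b. blocks ks w ! fst b ! snd b) = bracket_poly B L k w"
      unfolding bracket_poly_def by (rule det_prod_cong) (simp only: blocks_box)
    then show ?thesis using blocks_words[OF that] by (simp add: q_def)
  qed
  have sub: "cfun.subspace V" unfolding cartan_module_def by (rule cfun.subspace_span)
  have S: "u \<in> ?S \<longleftrightarrow> u \<in> V \<and> (\<forall>w\<in>words n ks. u (blocks ks w) \<noteq> 0 \<longrightarrow> (\<forall>a<n. letter_count ks w a = rs ! a))" for u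
  proof -
    have "(\<forall>i\<in>{1..n}. \<mu> i = int (letter_count ks w (i - 1))) \<longleftrightarrow> (\<forall>a<n. letter_count ks w a = rs ! a)" for w
    proof
      assume l: "\<forall>i\<in>{1..n}. \<mu> i = int (letter_count ks w (i - 1))"
      show "\<forall>a<n. letter_count ks w a = rs ! a"
      proof (intro allI impI)
        fix a assume "a < n"
        then show "letter_count ks w a = rs ! a" using \<mu>[of "Suc a"] l[rule_format, of "Suc a"] by simp
      qed
    next
      assume r: "\<forall>a<n. letter_count ks w a = rs ! a"
      show "\<forall>i\<in>{1..n}. \<mu> i = int (letter_count ks w (i - 1))"
      proof
        fix i assume i: "i \<in> {1..n}"
        then have "i - 1 < n" by auto
        then show "\<mu> i = int (letter_count ks w (i - 1))" using \<mu>[OF i] r[rule_format, of "i - 1"] by simp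
      qed
    qed
    then show ?thesis unfolding weight_space_ext_iff[OF cartan_module_ext] by simp
  qed
  have subS: "cfun.subspace ?S"
    unfolding cfun.subspace_def
  proof (intro conjI ballI allI)
    show "0 \<in> ?S" unfolding S using sub by (simp add: cfun.subspace_def)
  next
    fix x y assume "x \<in> ?S" "y \<in> ?S"
    note xy = iffD1[OF S this(1)] iffD1[OF S this(2)]
    have "x + y \<in> V" using xy sub by (simp add: cfun.subspace_def)
    moreover have "x (blocks ks w) \<noteq> 0 \<or> y (blocks ks w) \<noteq> 0" if "(x + y) (blocks ks w) \<noteq> 0" for w
      using that by auto
    ultimately show "x + y \<in> ?S" unfolding S using xy by blast
  next
    fix c x assume "x \<in> ?S"
    note x = iffD1[OF S this]
    have "(\<lambda>i. c * x i) \<in> V" using x sub by (simp add: cfun.subspace_def)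
    then show "(\<lambda>i. c * x i) \<in> ?S" unfolding S using x by simp
  qed
  have tab: "restrict (tableau A) (boxes L k) \<in> words n ks" if "A \<in> standard_matrices L k rs" for A
    using tableau_less_length[OF that] rs by (auto simp: boxes_eq)
  let ?pt = "\<lambda>A. blocks ks (restrict (tableau A) (boxes L k))"
  let ?b = "\<lambda>A J. coeff (q J) (?e A)"
  show ?thesis
    unfolding weight_multiplicity_def
  proof (rule cfun_dim_eq_card(1)[where pt = ?pt and b = ?b])
    show "cfun.subspace ?S" by (rule subS)
    show "finite (standard_matrices L k rs)" by simp
  next
    fix u assume u: "u \<in> ?S" and zero: "\<And>A. A \<in> standard_matrices L k rs \<Longrightarrow> u (?pt A) = 0"
    have "u (blocks ks w) = 0" if w: "w \<in> words n ks" for w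
    proof (cases "\<forall>a<n. letter_count ks w a = rs ! a")
      case True
      \<comment> \<open>These coefficients do not depend on the matrix, so the relation is a linear
        condition satisfied by all generators, hence on the whole module.\<close>
      obtain c where c: "\<And>Y :: nat \<Rightarrow> nat \<Rightarrow> complex. det_prod L k (\<lambda>b. Y (w b)) =
          (\<Sum>A\<in>standard_matrices L k rs. c A * det_prod L k (\<lambda>b. Y (tableau A b)))"
        using straightening[OF rs(2), of w] words_D[OF w] True rs(1) by blast
      have "plucker_tensor n k L g (blocks ks w) = (\<Sum>A\<in>standard_matrices L k rs. c A * plucker_tensor n k L g (?pt A))" for g
      proof -
        have "plucker_tensor n k L g (?pt A) = det_prod L k (\<lambda>b j. g $$ (tableau A b, j))" if "A \<in> standard_matrices L k rs" for A
          unfolding plucker_tensor_blocks[OF tab[OF that]] by (rule det_prod_cong) simp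
        then show ?thesis using c[of "\<lambda>a j. g $$ (a, j)"] by (simp add: plucker_tensor_blocks[OF w])
      qed
      moreover have "cfun.subspace {v. v (blocks ks w) = (\<Sum>A\<in>standard_matrices L k rs. c A * v (?pt A))}"
        by (auto simp: cfun.subspace_def distrib_left sum.distrib sum_distrib_left mult.left_commute)
      ultimately have "V \<subseteq> {v. v (blocks ks w) = (\<Sum>A\<in>standard_matrices L k rs. c A * v (?pt A))}"
        unfolding cartan_module_def by (intro cfun.span_minimal) auto
      then have "u (blocks ks w) = (\<Sum>A\<in>standard_matrices L k rs. c A * u (?pt A))" using u S by blast
      then show ?thesis using zero by simp
    qed (use u S w in blast)
    moreover have "u J = 0" if "J \<notin> multi_indices n ks" for J
      using ext_tensors_outside u S cartan_module_ext that by blast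
    ultimately show "u = 0" by (intro multi_indices_ext[where d = n and ks = ks]) auto
  next
    fix A assume A: "A \<in> standard_matrices L k rs"
    \<comment> \<open>The curve stays in the module because all matrices, not just unitary ones,
      preserve it; its coefficient vectors then lie there too.\<close>
    have "?b A \<in> V"
    proof (rule subspace_polynomial_curve[OF sub, where T = UNIV and F = "multi_indices n ks"])
      fix t :: complex
      define X where "X = mat n n (\<lambda>(a, j). t ^ place B k a j)"
      have X: "X \<in> carrier_mat n n" by (simp add: X_def)
      have "plucker_tensor n k L X \<in> V"
        using invariant_under_all_matrices[OF invariant_cartan_module hw_in_module X] tensor_act_hw[OF X] by simp
      also have "plucker_tensor n k L X = (\<lambda>J. poly (q J) t)"
      proof (rule multi_indices_ext[where d = n and ks = ks])
        fix w assume w: "w \<in> words n ks"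
        have "det_prod L k (\<lambda>b j. X $$ (w b, j)) = det_prod L k (\<lambda>b j. t ^ place B k (w b) j)"
          using words_D[OF w] kn by (intro det_prod_cong) (auto simp: X_def)
        then show "plucker_tensor n k L X (blocks ks w) = poly (q (blocks ks w)) t"
          by (simp add: plucker_tensor_blocks[OF w] q[OF w] poly_bracket_poly)
      qed (simp add: plucker_tensor_outside q_def)
      finally show "(\<lambda>J. poly (q J) t) \<in> V" .
    next
      show "finite (multi_indices n ks)" by (rule finite_multi_indices)
    qed (auto simp: q_def infinite_UNIV_char_0)
    \<comment> \<open>The exponent of \<open>A\<close> encodes the content, so taking this one
      coefficient projects onto the weight.\<close>
    moreover have "letter_count ks w a = rs ! a" if "w \<in> words n ks" "?b A (blocks ks w) \<noteq> 0" "a < n" for w a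
    proof (rule bracket_poly_content[OF A B(3)])
      show "w b < length rs" if "b \<in> boxes L k" for b using words_D[OF \<open>w \<in> _\<close> that] rs by simp
      show "coeff (bracket_poly B L k w) (matrix_exponent B k (length rs) A) \<noteq> 0"
        using that(2) rs by (simp add: q[OF that(1)])
    qed (use that rs in simp)
    ultimately show "?b A \<in> ?S" unfolding S by blast
  next
    fix c assume zero: "\<And>J. (\<Sum>A\<in>standard_matrices L k rs. c A * ?b A J) = 0"
    show "\<forall>A\<in>standard_matrices L k rs. c A = 0"
    proof (rule ccontr)
      let ?C = "{A \<in> standard_matrices L k rs. c A \<noteq> 0}"
      assume "\<not> ?thesis"
      then have ne: "?C \<noteq> {}" and fin: "finite ?C" by auto
      \<comment> \<open>The minimal exponent this time: the polynomial at the tableau of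
        \<open>A\<close> is fixed and read at the exponents of the other matrices, which exceed its
        degree.\<close>
      then obtain A where A: "A \<in> ?C" "?e A = Min (?e ` ?C)"
        by (metis (no_types, lifting) Min_in finite_imageI image_iff image_is_empty)
      have qA: "q (?pt A) = bracket_poly B L k (tableau A)"
        using A(1) unfolding q[OF tab] bracket_poly_def by (subst q[OF tab]) (auto simp: bracket_poly_def intro!: det_prod_cong)
      have "c A' * ?b A' (?pt A) = (if A' = A then c A else 0)" if A': "A' \<in> standard_matrices L k rs" for A'
      proof (cases "A' = A \<or> c A' = 0")
        case True
        then show ?thesis using bracket_poly_tableau(1)[of A L k rs B] A(1) B(1) rs by (auto simp: qA)
      next
        case False
        then have "?e A \<le> ?e A'" using A(2) A' fin by simp
        moreover have "?e A' \<noteq> ?e A" using matrix_exponent_inj[OF A' _ B(2), of A] A(1) False rs by blast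
        ultimately have "matrix_exponent B k (length rs) A < ?e A'" using rs by simp
        then show ?thesis using bracket_poly_tableau(2)[of A L k rs B "?e A'"] A(1) B(1) False by (simp add: qA)
      qed
      then have "(\<Sum>A'\<in>standard_matrices L k rs. c A' * ?b A' (?pt A)) = (\<Sum>A'\<in>standard_matrices L k rs. if A' = A then c A else 0)"
        by (intro sum.cong) auto
      then show False using zero[of "?pt A"] A(1) by simp
    qed
  qed
qed

end

theorem theorem9p2p1:
  fixes m n L :: nat and r :: "nat \<Rightarrow> nat"
  assumes "m \<ge> 1" and "n \<ge> m + 1"
    and "\<forall>j\<in>{1..n}. r j > 0"
    and "real L = 1 / real (m + 1) * real (\<Sum>j=1..n. r j)"
  shows "character_multiplicity (unitary_group (m + 1)) (\<lambda>g. det g ^ L)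
           (tensor_act (m + 1) (map r [1..<n+1]))
           (tensor_product (map (\<lambda>j. sym_power (m + 1) (r j)) [1..<n+1]))
         = weight_multiplicity n (tensor_act n (replicate L (m + 1)))
             (cartan_power_ext n (m + 1) L) (\<lambda>i. int (r i))
       \<and> weight_multiplicity n (tensor_act n (replicate L (m + 1)))
           (cartan_power_ext n (m + 1) L) (\<lambda>i. int (r i))
         = card (lattice_points (gt_polytope m n r L))"
proof -
  define rs where "rs = map r [1..<n + 1]"
  have len: "length rs = n" by (simp add: rs_def)
  have rsn: "rs ! a = r (Suc a)" if "a < n" for a using that unfolding rs_def by (simp del: upt_Suc)
  have "card (positions rs) = (\<Sum>a<n. rs ! a)" by (simp add: positions_def len)
  also have "\<dots> = (\<Sum>a<n. r (Suc a))" by (intro sum.cong) (auto simp: rsn)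
  also have "\<dots> = (\<Sum>j=1..n. r j)"
    by (rule sum.reindex_bij_witness[where i = "\<lambda>j. j - 1" and j = Suc]) auto
  \<comment> \<open>The total degree: the quotient hypothesis over the reals becomes an equation of
    naturals after clearing the denominator.\<close>
  also have "\<dots> = L * (m + 1)"
  proof -
    have eq: "real L = real (\<Sum>j=1..n. r j) / real (m + 1)"
      using assms(4) by (simp only: times_divide_eq_left mult_1_left)
    have "real (m + 1) \<noteq> 0" by simp
    then have "real L * real (m + 1) = real (\<Sum>j=1..n. r j)"
      by (rule iffD1[OF nonzero_eq_divide_eq eq])
    then have "real (L * (m + 1)) = real (\<Sum>j=1..n. r j)" by (simp only: of_nat_mult)
    then show ?thesis by (simp only: of_nat_eq_iff)
  qed
  finally have N: "card (positions rs) = L * (m + 1)" .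
  have "weight_multiplicity n (tensor_act n (replicate L (m + 1))) (cartan_power_ext n (m + 1) L) (\<lambda>i. int (r i))
      = card (standard_matrices L (m + 1) rs)"
    unfolding cartan_power_ext_eq[OF assms(2)]
    by (rule cartan_weight_multiplicity[OF assms(2) len N]) (auto simp: rsn)
  moreover have "map (\<lambda>j. sym_power (m + 1) (r j)) [1..<n + 1] = map (sym_power (m + 1)) rs"
    by (simp add: rs_def)
  ultimately show ?thesis
    using character_multiplicity_det[OF N] card_lattice_points[OF assms(2), of r L]
    by (simp only: rs_def)
qed

end
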